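(* Let $n\ge1$, and let $\mathrm{m}$ denote either $\mathrm{mv}$ (mean value) or $\mathrm{med}$ (median), fixed throughout. For $\eta>0$ consider the inequality $$\sup_u\int_{\mathbb{R}^n}\exp\left(\exp(\eta|u|)\right)d\gamma_n<\infty,\qquad(\ast)$$ where the supremum is extended over all functions $u\in W_{\mathcal L}L^2(\mathbb{R}^n,\gamma_n)$ such that $$\|\mathcal L u\|_{L^\infty(\mathbb{R}^n,\gamma_n)}\le1\quad\text{and}\quad\mathrm{m}(u)=0.\qquad(\ast\ast)$$ (i) If $0<\eta<2$, then $(\ast)$ holds. (ii) If $\eta\ge2$, then $(\ast)$ fails. In particular, there exists a function $u$ obeying $(\ast\ast)$ that makes the integral in $(\ast)$ diverge.
   Context: $\gamma_n$ is the Gauss probability measure on $\mathbb{R}^n$, $d\gamma_n(x)=(2\pi)^{-n/2}e^{-|x|^2/2}\,dx$. $W^{1,2}(\mathbb{R}^n,\gamma_n)$ is the space of weakly differentiable $u\in L^2(\mathbb{R}^n,\gamma_n)$ with $|\nabla u|\in L^2(\mathbb{R}^n,\gamma_n)$. Ornstein-Uhlenbeck operator: $W_{\mathcal L}L^2(\mathbb{R}^n,\gamma_n)$ is the set of all $u\in W^{1,2}(\mathbb{R}^n,\gamma_n)$ for which there is $f\in L^2(\mathbb{R}^n,\gamma_n)$ with $\int_{\mathbb{R}^n}\nabla u\cdot\nabla v\,d\gamma_n=-\int_{\mathbb{R}^n}v f\,d\gamma_n$ for every $v\in W^{1,2}(\mathbb{R}^n,\gamma_n)$; one then sets $\mathcal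 L u=f$. (For $u$ in the second-order space $W^{2,2}(\mathbb{R}^n,\gamma_n)$ one has $\mathcal L u=\Delta u-x\cdot\nabla u$.) $\mathrm{mv}(u)=\int_{\mathbb{R}^n}u\,d\gamma_n$ and $\mathrm{med}(u)=\inf\{t\in\mathbb{R}:\gamma_n(\{u>t\})\le\frac12\}$. *)

theory Defs
  imports "HOL-Probability.Probability"
begin

definition gauss_measure :: "'a::euclidean_space measure" where
  "gauss_measure =
     density lborel (\<lambda>x. ennreal ((2 * pi) powr (- real DIM('a) / 2) * exp (- (norm x)\<^sup>2 / 2)))"

definition gauss_L2 :: "('a::euclidean_space \<Rightarrow> real) set" where
  "gauss_L2 = {u \<in> borel_measurable gauss_measure. integrable gauss_measure (\<lambda>x. (u x)\<^sup>2)}"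

primrec times_cont_diff :: "nat \<Rightarrow> ('a::euclidean_space \<Rightarrow> real) \<Rightarrow> bool" where
  "times_cont_diff 0 f \<longleftrightarrow> continuous_on UNIV f"
| "times_cont_diff (Suc k) f \<longleftrightarrow>
     (\<forall>x. f differentiable (at x)) \<and>
     (\<forall>b\<in>Basis. times_cont_diff k (\<lambda>x. frechet_derivative f (at x) b))"

definition test_functions :: "('a::euclidean_space \<Rightarrow> real) set" where
  "test_functions = {\<phi>. (\<forall>k. times_cont_diff k \<phi>) \<and> compact (closure {x. \<phi> x \<noteq> 0})}"

definition locally_integrable :: "('a::euclidean_space \<Rightarrow> 'b::euclidean_space) \<Rightarrow> bool" where
  "locally_integrable f \<longleftrightarrow> (\<forall>K. compact K \<longrightarrow> set_integrable lborel K f)"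

text \<open>Weak differentiability is with respect to Lebesgue measure. A weak gradient is determined
  only up to null sets, so it is treated as a relation; the same holds for the
  Ornstein-Uhlenbeck operator below.\<close>

definition has_weak_gradient ::
    "('a::euclidean_space \<Rightarrow> real) \<Rightarrow> ('a \<Rightarrow> 'a) \<Rightarrow> bool" where
  "has_weak_gradient u G \<longleftrightarrow>
     locally_integrable u \<and> locally_integrable G \<and>
     (\<forall>\<phi>\<in>test_functions. \<forall>b\<in>Basis.
        (\<integral>x. u x * frechet_derivative \<phi> (at x) b \<partial>lborel) = - (\<integral>x. (G x \<bullet> b) * \<phi> x \<partial>lborel))"

definition has_gauss_W12_gradient ::
    "('a::euclidean_space \<Rightarrow> real) \<Rightarrow> ('a \<Rightarrow> 'a) \<Rightarrow> bool" where
  "has_gauss_W12_gradient u G \<longleftrightarrow>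
     u \<in> gauss_L2 \<and> has_weak_gradient u G \<and> (\<lambda>x. norm (G x)) \<in> gauss_L2"

definition gauss_W12 :: "('a::euclidean_space \<Rightarrow> real) set" where
  "gauss_W12 = {u. \<exists>G. has_gauss_W12_gradient u G}"

text \<open>\<open>has_ornstein_uhlenbeck u f\<close> says that \<open>u\<close> lies in the domain \<open>ornstein_uhlenbeck_domain\<close>
  and that \<open>f\<close> represents its image under the operator.\<close>

definition has_ornstein_uhlenbeck ::
    "('a::euclidean_space \<Rightarrow> real) \<Rightarrow> ('a \<Rightarrow> real) \<Rightarrow> bool" where
  "has_ornstein_uhlenbeck u f \<longleftrightarrow>
     f \<in> gauss_L2 \<and>
     (\<exists>G. has_gauss_W12_gradient u G \<and>
        (\<forall>v\<in>gauss_W12. \<forall>H. has_gauss_W12_gradient v H \<longrightarrow>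
           (\<integral>x. G x \<bullet> H x \<partial>gauss_measure) = - (\<integral>x. v x * f x \<partial>gauss_measure)))"

definition ornstein_uhlenbeck_domain :: "('a::euclidean_space \<Rightarrow> real) set" where
  "ornstein_uhlenbeck_domain = {u \<in> gauss_W12. \<exists>f. has_ornstein_uhlenbeck u f}"

definition gauss_Linf_norm :: "('a::euclidean_space \<Rightarrow> real) \<Rightarrow> ereal" where
  "gauss_Linf_norm f = esssup gauss_measure (\<lambda>x. ereal \<bar>f x\<bar>)"

definition mv :: "('a::euclidean_space \<Rightarrow> real) \<Rightarrow> real" where
  "mv u = (\<integral>x. u x \<partial>gauss_measure)"

definition med :: "('a::euclidean_space \<Rightarrow> real) \<Rightarrow> real" where
  "med u = Inf {t. measure gauss_measure {x. u x > t} \<le> 1 / 2}"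

definition admissible ::
    "(('a::euclidean_space \<Rightarrow> real) \<Rightarrow> real) \<Rightarrow> ('a \<Rightarrow> real) set" where
  "admissible m =
     {u \<in> ornstein_uhlenbeck_domain.
        (\<exists>f. has_ornstein_uhlenbeck u f \<and> gauss_Linf_norm f \<le> 1) \<and> m u = 0}"

definition exp_exp_integral :: "real \<Rightarrow> ('a::euclidean_space \<Rightarrow> real) \<Rightarrow> ennreal" where
  "exp_exp_integral \<eta> u = (\<integral>\<^sup>+x. ennreal (exp (exp (\<eta> * \<bar>u x\<bar>))) \<partial>gauss_measure)"

end

theory Submission
  imports Defs "HOL-Real_Asymp.Real_Asymp"
begin

text \<open>
  Throughout, \<open>L u = \<Delta>u - x \<bullet> \<nabla>u\<close> denotes the Ornstein-Uhlenbeck operator and \<open>\<gamma>\<close> the Gauss measure.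

  For fixed dimension, the growth of a function with bounded \<open>L u\<close> can be controlled pointwise: if
  \<open>\<bar>L u\<bar> \<le> 1\<close>, then \<open>\<bar>u(x) - mv u\<bar> \<le> C + ln (1 + \<bar>x\<bar>)\<close> almost everywhere, with \<open>C\<close> depending only on the
  dimension (\<open>OU_log_growth\<close>). The coefficient 1 of the logarithm is what makes 2 the critical exponent:
  \<open>exp (\<eta> \<bar>u\<bar>)\<close> is at most a multiple of \<open>(1 + \<bar>x\<bar>) powr \<eta>\<close>, and the exponential of this is
  \<open>\<gamma>\<close>-integrable when \<open>\<eta> < 2\<close>. Mean and median differ by a bounded amount under such a growth condition, so
  both normalisations give a uniform bound.

  The pointwise bound comes from the Ornstein-Uhlenbeck semigroup \<open>P\<^sub>t\<close>. With \<open>f = L u\<close> one has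
  \<open>d/dt P\<^sub>t u = P\<^sub>t f\<close>, and \<open>P\<^sub>t u\<close> tends to the mean of \<open>u\<close>, so that \<open>mv u - u\<close> is the integral of
  \<open>P\<^sub>t f\<close> over all \<open>t > 0\<close>. Here \<open>\<bar>P\<^sub>t f\<bar> \<le> 1\<close>, and for large \<open>t\<close> also
  \<open>\<bar>P\<^sub>t f(x)\<bar> \<le> C exp (-t) (1 + \<bar>x\<bar>)\<close>, since \<open>f\<close> has mean zero and \<open>P\<^sub>t f(x)\<close> is an average of \<open>f\<close> with
  respect to a normal distribution close to \<open>\<gamma>\<close>. The two bounds balance near \<open>t = ln (1 + \<bar>x\<bar>)\<close>, which yields the
  logarithm. The semigroup is given by the explicit Mehler kernel. For a fixed point \<open>x\<close> and \<open>t > 0\<close> this kernel is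
  a smooth function with which the weak equation for \<open>u\<close> can be tested (\<open>OU_mehler_identity\<close>), so no
  regularity theory for \<open>u\<close> is involved. The bound for \<open>P\<^sub>t u\<close>, uniform in \<open>t\<close>, is \<open>OU_flow_bound\<close>; the
  limit \<open>t \<rightarrow> 0\<close> is taken weakly, by self-adjointness of the semigroup (\<open>mehler_weak_limit\<close>).

  For \<open>\<eta> \<ge> 2\<close> the function \<open>u(x) = arsinh ((x \<bullet> b) / sqrt 2)\<close> with a unit coordinate vector \<open>b\<close> is an explicit
  witness. It is smooth and odd, so its mean and median vanish; \<open>\<bar>L u\<bar> \<le> 1\<close> is a one-variable inequality
  (\<open>witness_OU_bound\<close>); and \<open>exp (2 \<bar>u\<bar>) \<ge> 2 (x \<bullet> b)\<^sup>2\<close>, which beats the Gaussian exponent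
  \<open>(x \<bullet> b)\<^sup>2 / 2\<close>.

  Both parts rest on integration by parts between weak gradients and smooth functions of moderate growth
  (\<open>gauss_green_formula\<close>). Weak gradients are defined by smooth test functions of compact support, so this
  requires smooth cut-offs.
\<close>

section \<open>The Gauss measure\<close>

definition gauss_density :: "'a::euclidean_space \<Rightarrow> real" where
  "gauss_density x = (2 * pi) powr (- real DIM('a) / 2) * exp (- (norm x)\<^sup>2 / 2)"

lemma gauss_density_pos [simp]: "gauss_density x > 0"
  by (simp add: gauss_density_def)

lemma gauss_density_nonneg [simp]: "gauss_density x \<ge> 0"
  by (simp add: gauss_density_def)

lemma gauss_density_measurable [measurable]: "gauss_density \<in> borel_measurable borel"
  unfolding gauss_density_def by measurable

lemma gauss_measure_density: "gauss_measure = density lborel (\<lambda>x. ennreal (gauss_density x))"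
  by (simp add: gauss_measure_def gauss_density_def)

lemma sets_gauss_measure [simp, measurable_cong]: "sets gauss_measure = sets borel"
  by (simp add: gauss_measure_def)

lemma space_gauss_measure [simp]: "space gauss_measure = UNIV"
  by (simp add: gauss_measure_def)

lemma borel_measurable_gauss [simp]: "borel_measurable gauss_measure = borel_measurable borel"
  by (rule measurable_cong_sets) simp_all

lemma nn_integral_gauss:
  assumes [measurable]: "f \<in> borel_measurable borel"
  shows "(\<integral>\<^sup>+x. f x \<partial>gauss_measure) = (\<integral>\<^sup>+x. ennreal (gauss_density x) * f x \<partial>lborel)"
  unfolding gauss_measure_density by (subst nn_integral_density) auto

lemma integral_gauss:
  fixes f :: "'a::euclidean_space \<Rightarrow> real"
  assumes [measurable]: "f \<in> borel_measurable borel"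
  shows "(\<integral>x. f x \<partial>gauss_measure) = (\<integral>x. gauss_density x * f x \<partial>lborel)"
  unfolding gauss_measure_density by (subst integral_density) auto

text \<open>Gaussians factorise over the coordinates; this reduces Gaussian integrals to dimension one.\<close>

lemma exp_neg_norm_sq_prod:
  fixes x :: "'a::euclidean_space"
  shows "exp (- c * (norm x)\<^sup>2) = (\<Prod>b\<in>Basis. exp (- c * (x \<bullet> b)\<^sup>2))"
proof -
  have "(norm x)\<^sup>2 = (\<Sum>b\<in>Basis. (x \<bullet> b)\<^sup>2)"
    by (subst power2_norm_eq_inner, subst euclidean_inner) (simp add: power2_eq_square)
  then show ?thesis
    by (simp add: sum_distrib_left exp_sum)
qed

lemma nn_integral_exp_neg_sq:
  assumes "c > 0"
  shows "(\<integral>\<^sup>+t. ennreal (exp (- c * t\<^sup>2)) \<partial>lborel) = ennreal (sqrt (pi / c))"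
proof -
  let ?s = "1 / sqrt (2 * c)"
  have s: "?s > 0" "?s\<^sup>2 = 1 / (2 * c)" using assms by (auto simp: power_divide)
  have "(\<integral>\<^sup>+t. ennreal (exp (- c * t\<^sup>2)) \<partial>lborel)
      = (\<integral>\<^sup>+t. ennreal (sqrt (pi / c)) * ennreal (normal_density 0 ?s t) \<partial>lborel)"
  proof (rule nn_integral_cong)
    fix t :: real
    have "normal_density 0 ?s t = 1 / sqrt (pi / c) * exp (- c * t\<^sup>2)"
      unfolding normal_density_def s(2) using assms by (simp add: field_simps)
    then have "exp (- c * t\<^sup>2) = sqrt (pi / c) * normal_density 0 ?s t"
      using assms by simp
    then show "ennreal (exp (- c * t\<^sup>2)) = ennreal (sqrt (pi / c)) * ennreal (normal_density 0 ?s t)"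
      using assms by (simp add: ennreal_mult)
  qed
  also have "\<dots> = ennreal (sqrt (pi / c)) * (\<integral>\<^sup>+t. ennreal (normal_density 0 ?s t) \<partial>lborel)"
    by (rule nn_integral_cmult) auto
  also have "(\<integral>\<^sup>+t. ennreal (normal_density 0 ?s t) \<partial>lborel) = 1"
    using prob_space.emeasure_space_1[OF prob_space_normal_density[OF s(1), of 0]]
    by (simp add: emeasure_density)
  finally show ?thesis by simp
qed

lemma nn_integral_exp_neg_norm_sq:
  assumes "c > 0"
  shows "(\<integral>\<^sup>+x. ennreal (exp (- c * (norm x)\<^sup>2)) \<partial>(lborel :: 'a::euclidean_space measure))
     = ennreal (sqrt (pi / c) ^ DIM('a))"
proof -
  have "(\<integral>\<^sup>+x. ennreal (exp (- c * (norm x)\<^sup>2)) \<partial>(lborel :: 'a measure))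
      = (\<integral>\<^sup>+x. (\<Prod>b\<in>Basis. ennreal (exp (- c * ((x::'a) \<bullet> b)\<^sup>2))) \<partial>lborel)"
    by (simp only: exp_neg_norm_sq_prod prod_ennreal exp_ge_zero)
  also have "\<dots> = (\<Prod>b\<in>(Basis :: 'a set). (\<integral>\<^sup>+t. ennreal (exp (- c * t\<^sup>2)) \<partial>lborel))"
    by (rule nn_integral_lborel_prod) auto
  also have "\<dots> = ennreal (sqrt (pi / c) ^ DIM('a))"
    using assms by (simp add: nn_integral_exp_neg_sq[OF assms, unfolded mult_minus_left] ennreal_power)
  finally show ?thesis .
qed

lemma emeasure_gauss_UNIV: "emeasure (gauss_measure :: 'a::euclidean_space measure) UNIV = 1"
proof -
  have "emeasure (gauss_measure :: 'a measure) UNIV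
     = (\<integral>\<^sup>+x. ennreal ((2 * pi) powr (- real DIM('a) / 2)) * ennreal (exp (- (1/2) * (norm x)\<^sup>2)) \<partial>(lborel :: 'a measure))"
    unfolding gauss_measure_density by (simp add: emeasure_density gauss_density_def ennreal_mult)
  also have "\<dots> = ennreal ((2 * pi) powr (- real DIM('a) / 2)) * ennreal (sqrt (pi / (1/2)) ^ DIM('a))"
    by (subst nn_integral_cmult, measurable, subst nn_integral_exp_neg_norm_sq) simp_all
  also have "sqrt (pi / (1/2)) ^ DIM('a) = (2 * pi) powr (real DIM('a) / 2)"
    by (simp add: powr_half_sqrt[symmetric] powr_powr flip: powr_realpow) (simp add: mult.commute)
  also have "ennreal ((2 * pi) powr (- real DIM('a) / 2)) * ennreal ((2 * pi) powr (real DIM('a) / 2)) = 1"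
    by (simp add: ennreal_mult[symmetric] powr_add[symmetric])
  finally show ?thesis .
qed

interpretation gauss: prob_space "gauss_measure :: 'a::euclidean_space measure"
  by standard (simp add: emeasure_gauss_UNIV)

lemma integrable_gauss_exp_norm_sq:
  assumes "c < 1/2"
  shows "integrable gauss_measure (\<lambda>x::'a::euclidean_space. exp (c * (norm x)\<^sup>2))"
proof (rule integrableI_bounded)
  have "(\<integral>\<^sup>+x. ennreal (norm (exp (c * (norm x)\<^sup>2))) \<partial>(gauss_measure :: 'a measure))
     = (\<integral>\<^sup>+x. ennreal ((2 * pi) powr (- real DIM('a) / 2)) * ennreal (exp (- (1/2 - c) * (norm x)\<^sup>2)) \<partial>(lborel :: 'a measure))"
    by (subst nn_integral_gauss)
       (auto intro!: nn_integral_cong simp: gauss_density_def ennreal_mult[symmetric] mult_exp_exp algebra_simps)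
  also have "\<dots> = ennreal ((2 * pi) powr (- real DIM('a) / 2)) * ennreal (sqrt (pi / (1/2 - c)) ^ DIM('a))"
    using assms by (subst nn_integral_cmult, measurable, subst nn_integral_exp_neg_norm_sq) simp_all
  also have "\<dots> < \<infinity>" by (simp add: ennreal_mult_less_top)
  finally show "(\<integral>\<^sup>+x. ennreal (norm (exp (c * (norm x)\<^sup>2))) \<partial>(gauss_measure :: 'a measure)) < \<infinity>" .
qed simp

lemma integrable_gauss_exp_norm:
  "integrable gauss_measure (\<lambda>x::'a::euclidean_space. exp (c * norm x))"
proof (rule Bochner_Integration.integrable_bound)
  show "integrable gauss_measure (\<lambda>x::'a. exp (c\<^sup>2) * exp ((1/4) * (norm x)\<^sup>2))"
    by (intro integrable_mult_right integrable_gauss_exp_norm_sq) simp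
  have "c * t \<le> c\<^sup>2 + 1/4 * t\<^sup>2" for t
    using zero_le_power2[of "c - t/2"] by (simp add: power2_eq_square algebra_simps)
  then show "AE x in gauss_measure. norm (exp (c * norm x)) \<le> norm (exp (c\<^sup>2) * exp ((1/4) * (norm (x::'a))\<^sup>2))"
    by (auto simp: mult_exp_exp)
qed simp

lemma gauss_L2_I:
  assumes "u \<in> borel_measurable borel" "integrable gauss_measure (\<lambda>x. (u x)\<^sup>2)"
  shows "u \<in> gauss_L2"
  using assms by (simp add: gauss_L2_def)

lemma gauss_L2_measurable: "u \<in> gauss_L2 \<Longrightarrow> u \<in> borel_measurable borel"
  by (simp add: gauss_L2_def)

lemma gauss_L2_mult_integrable:
  assumes "u \<in> gauss_L2" "v \<in> gauss_L2"
  shows "integrable gauss_measure (\<lambda>x. u x * v x)"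
proof (rule Bochner_Integration.integrable_bound)
  show "integrable gauss_measure (\<lambda>x. (u x)\<^sup>2 + (v x)\<^sup>2)"
    using assms by (auto simp: gauss_L2_def)
  show "AE x in gauss_measure. norm (u x * v x) \<le> norm ((u x)\<^sup>2 + (v x)\<^sup>2)"
  proof (rule AE_I2)
    fix x
    have "\<bar>u x\<bar> * \<bar>v x\<bar> \<le> (u x)\<^sup>2 + (v x)\<^sup>2"
      using sum_squares_bound[of "\<bar>u x\<bar>" "\<bar>v x\<bar>"] mult_nonneg_nonneg[of "\<bar>u x\<bar>" "\<bar>v x\<bar>"]
      by (simp del: mult_nonneg_nonneg)
    then show "norm (u x * v x) \<le> norm ((u x)\<^sup>2 + (v x)\<^sup>2)" by (simp add: abs_mult)
  qed
qed (use assms in \<open>auto simp: gauss_L2_def\<close>)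

lemma gauss_L2_bound:
  assumes "u \<in> borel_measurable borel" "v \<in> gauss_L2" "\<And>x. \<bar>u x\<bar> \<le> \<bar>v x\<bar>"
  shows "u \<in> gauss_L2"
proof (rule gauss_L2_I)
  show "integrable gauss_measure (\<lambda>x. (u x)\<^sup>2)"
  proof (rule Bochner_Integration.integrable_bound)
    show "integrable gauss_measure (\<lambda>x. (v x)\<^sup>2)" using assms by (simp add: gauss_L2_def)
    show "AE x in gauss_measure. norm ((u x)\<^sup>2) \<le> norm ((v x)\<^sup>2)"
      using assms(3) by (auto simp: abs_le_square_iff)
  qed (use assms in auto)
qed fact

lemma gauss_L2_exp_norm: "(\<lambda>x::'a::euclidean_space. c * exp (k * norm x)) \<in> gauss_L2"
proof (rule gauss_L2_I)
  show "integrable gauss_measure (\<lambda>x::'a. (c * exp (k * norm x))\<^sup>2)"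
    using integrable_mult_right[of "c\<^sup>2", OF integrable_gauss_exp_norm[of "2 * k", where 'a='a]]
    by (simp add: power_mult_distrib exp_double[symmetric] mult.assoc)
qed simp

lemma gauss_L2_const: "(\<lambda>x::'a::euclidean_space. c) \<in> gauss_L2"
  using gauss_L2_exp_norm[of c 0] by simp

lemma gauss_L2_integrable: "u \<in> gauss_L2 \<Longrightarrow> integrable gauss_measure u"
  using gauss_L2_mult_integrable[OF gauss_L2_const[of 1]] by simp

lemma norm_le_exp: "norm x \<le> exp (norm x)"
  using exp_ge_add_one_self[of "norm x"] by linarith

text \<open>A class of functions that is closed under sums and products and contained in \<open>gauss_L2\<close>; all
  integrability questions below reduce to it. A single constant serves as prefactor and as rate,
  which keeps the closure proofs short.\<close>

definition exp_bounded :: "('a::euclidean_space \<Rightarrow> real) \<Rightarrow> bool" where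
  "exp_bounded f \<longleftrightarrow> (\<exists>k\<ge>0. \<forall>x. \<bar>f x\<bar> \<le> k * exp (k * norm x))"

lemma exp_boundedI:
  fixes f :: "'a::euclidean_space \<Rightarrow> real"
  assumes "\<And>x. \<bar>f x\<bar> \<le> K * exp (k * norm x)"
  shows "exp_bounded f"
  unfolding exp_bounded_def
proof (intro exI conjI allI)
  let ?k = "max 0 (max K k)"
  show "0 \<le> ?k" by simp
  fix x :: 'a
  have "K * exp (k * norm x) \<le> ?k * exp (?k * norm x)"
    by (intro mult_mono exp_mono) (auto intro!: mult_right_mono)
  with assms[of x] show "\<bar>f x\<bar> \<le> ?k * exp (?k * norm x)" by linarith
qed

lemma exp_bounded_const: "exp_bounded (\<lambda>x. c)"
  by (rule exp_boundedI[of _ "\<bar>c\<bar>" 0]) simp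

lemma exp_bounded_inner: "exp_bounded (\<lambda>x. x \<bullet> a)"
proof (rule exp_boundedI)
  fix x
  have "\<bar>x \<bullet> a\<bar> \<le> norm x * norm a" by (rule Cauchy_Schwarz_ineq2)
  also have "\<dots> \<le> exp (norm x) * norm a" by (intro mult_right_mono norm_le_exp) simp
  finally show "\<bar>x \<bullet> a\<bar> \<le> norm a * exp (1 * norm x)" by (simp add: mult.commute)
qed

lemma exp_bounded_add:
  assumes "exp_bounded f" "exp_bounded g" shows "exp_bounded (\<lambda>x. f x + g x)"
proof -
  obtain k l where k: "k \<ge> 0" "\<And>x. \<bar>f x\<bar> \<le> k * exp (k * norm x)" and l: "l \<ge> 0" "\<And>x. \<bar>g x\<bar> \<le> l * exp (l * norm x)"
    using assms by (auto simp: exp_bounded_def)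
  show ?thesis
  proof (rule exp_boundedI)
    fix x
    have "\<bar>f x + g x\<bar> \<le> k * exp (k * norm x) + l * exp (l * norm x)"
      using k(2)[of x] l(2)[of x] by linarith
    also have "\<dots> \<le> k * exp ((k + l) * norm x) + l * exp ((k + l) * norm x)"
      using k l by (intro add_mono mult_left_mono exp_mono mult_right_mono) auto
    finally show "\<bar>f x + g x\<bar> \<le> (k + l) * exp ((k + l) * norm x)" by (simp add: distrib_right)
  qed
qed

lemma exp_bounded_mult:
  assumes "exp_bounded f" "exp_bounded g" shows "exp_bounded (\<lambda>x. f x * g x)"
proof -
  obtain k l where k: "k \<ge> 0" "\<And>x. \<bar>f x\<bar> \<le> k * exp (k * norm x)" and l: "l \<ge> 0" "\<And>x. \<bar>g x\<bar> \<le> l * exp (l * norm x)"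
    using assms by (auto simp: exp_bounded_def)
  show ?thesis
  proof (rule exp_boundedI)
    fix x
    have "\<bar>f x * g x\<bar> \<le> (k * exp (k * norm x)) * (l * exp (l * norm x))"
      unfolding abs_mult using k l by (intro mult_mono) auto
    also have "\<dots> = (k * l) * exp ((k + l) * norm x)"
      by (simp only: distrib_right[of k l "norm x"] exp_add) (simp only: mult_ac)
    finally show "\<bar>f x * g x\<bar> \<le> (k * l) * exp ((k + l) * norm x)" .
  qed
qed

lemma exp_bounded_L2:
  assumes "exp_bounded f" "f \<in> borel_measurable borel" shows "f \<in> gauss_L2"
proof -
  obtain k where "\<And>x. \<bar>f x\<bar> \<le> k * exp (k * norm x)" using assms(1) by (auto simp: exp_bounded_def)
  then show ?thesis
    by (intro gauss_L2_bound[OF assms(2) gauss_L2_exp_norm[of k k]]) (meson abs_ge_self order_trans)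
qed

lemma gauss_density_minus: "gauss_density (- x) = gauss_density x"
  by (simp add: gauss_density_def)

lemma distr_gauss_uminus:
  "distr gauss_measure borel uminus = (gauss_measure :: 'a::euclidean_space measure)"
proof -
  have l: "distr lborel borel (uminus :: 'a \<Rightarrow> 'a) = lborel"
    using lborel_affine[of "-1" "0::'a"] by (simp add: density_1)
  have "gauss_measure = density (distr lborel borel (uminus :: 'a \<Rightarrow> 'a)) (\<lambda>x. ennreal (gauss_density x))"
    unfolding l by (rule gauss_measure_density)
  also have "\<dots> = distr (density lborel (\<lambda>x. ennreal (gauss_density (- x :: 'a)))) borel uminus"
    by (subst density_distr) auto
  also have "\<dots> = distr gauss_measure borel uminus"
    by (simp add: gauss_density_minus gauss_measure_density)
  finally show ?thesis by simp
qed

section \<open>Smooth functions\<close>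

abbreviation partial :: "'a::euclidean_space \<Rightarrow> ('a \<Rightarrow> real) \<Rightarrow> 'a \<Rightarrow> real" where
  "partial b f \<equiv> \<lambda>x. frechet_derivative f (at x) b"

definition smooth :: "('a::euclidean_space \<Rightarrow> real) \<Rightarrow> bool" where
  "smooth f \<longleftrightarrow> (\<forall>k. times_cont_diff k f)"

text \<open>Any family of candidate derivatives will do, since a Frechet derivative at a point of an open set is
  unique. This avoids computing with \<open>frechet_derivative\<close>.\<close>

lemma times_cont_diff_SucI:
  assumes "\<And>x. (f has_derivative f' x) (at x)"
    and "\<And>b. b \<in> Basis \<Longrightarrow> times_cont_diff k (\<lambda>x. f' x b)"
  shows "times_cont_diff (Suc k) f"
proof -
  have "frechet_derivative f (at x) = f' x" for x
    using frechet_derivative_at[OF assms(1)] by simp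
  then show ?thesis
    using assms by (auto simp: differentiable_def)
qed

lemma times_cont_diff_has_derivative:
  assumes "times_cont_diff (Suc k) f"
  shows "(f has_derivative frechet_derivative f (at x)) (at x)"
  using assms by (simp add: frechet_derivative_works[symmetric])

lemma times_cont_diff_Suc_imp: "times_cont_diff (Suc k) f \<Longrightarrow> times_cont_diff k f"
proof (induction k arbitrary: f)
  case 0
  then show ?case
    by (auto intro!: differentiable_imp_continuous_on simp: differentiable_on_def differentiable_at_withinI)
qed auto

lemma times_cont_diff_continuous: "times_cont_diff k f \<Longrightarrow> continuous_on UNIV f"
  by (induction k) (use times_cont_diff_Suc_imp in \<open>auto simp del: times_cont_diff.simps(2)\<close>)

lemma times_cont_diff_const: "times_cont_diff k (\<lambda>x. c)"
proof (induction k arbitrary: c)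
  case (Suc k)
  show ?case by (rule times_cont_diff_SucI[where f' = "\<lambda>_ _. 0"]) (auto intro: Suc)
qed simp

lemma times_cont_diff_inner: "times_cont_diff k (\<lambda>x. x \<bullet> a)"
proof (cases k)
  case (Suc k)
  show ?thesis unfolding Suc
    by (rule times_cont_diff_SucI[where f' = "\<lambda>_ h. h \<bullet> a"])
       (auto intro!: has_derivative_inner_left has_derivative_ident times_cont_diff_const)
qed (auto intro: continuous_intros)

lemma times_cont_diff_add:
  "times_cont_diff k f \<Longrightarrow> times_cont_diff k g \<Longrightarrow> times_cont_diff k (\<lambda>x. f x + g x)"
proof (induction k arbitrary: f g)
  case (Suc k)
  show ?case
  proof (rule times_cont_diff_SucI)
    show "((\<lambda>x. f x + g x) has_derivative (\<lambda>h. frechet_derivative f (at x) h + frechet_derivative g (at x) h)) (at x)" for x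
      using Suc.prems[THEN times_cont_diff_has_derivative] by (rule has_derivative_add)
    show "times_cont_diff k (\<lambda>x. frechet_derivative f (at x) b + frechet_derivative g (at x) b)" if "b \<in> Basis" for b
      using Suc that by simp
  qed
qed (auto intro: continuous_intros)

lemma times_cont_diff_mult:
  "times_cont_diff k f \<Longrightarrow> times_cont_diff k g \<Longrightarrow> times_cont_diff k (\<lambda>x. f x * g x)"
proof (induction k arbitrary: f g)
  case (Suc k)
  show ?case
  proof (rule times_cont_diff_SucI)
    show "((\<lambda>x. f x * g x) has_derivative (\<lambda>h. f x * frechet_derivative g (at x) h + frechet_derivative f (at x) h * g x)) (at x)" for x
      using Suc.prems[THEN times_cont_diff_has_derivative] by (rule has_derivative_mult)
    show "times_cont_diff k (\<lambda>x. f x * frechet_derivative g (at x) b + frechet_derivative f (at x) b * g x)" if "b \<in> Basis" for b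
      using Suc that times_cont_diff_Suc_imp[OF Suc.prems(1)] times_cont_diff_Suc_imp[OF Suc.prems(2)]
      by (intro times_cont_diff_add Suc.IH) auto
  qed
qed (auto intro: continuous_intros)

lemma has_derivative_inner_self: "((\<lambda>x. x \<bullet> x) has_derivative (\<lambda>h. 2 * (x \<bullet> h))) (at x)"
  by (rule has_derivative_eq_rhs[OF has_derivative_inner[OF has_derivative_ident has_derivative_ident]])
     (simp add: inner_commute fun_eq_iff)

lemma times_cont_diff_inner_self: "times_cont_diff k (\<lambda>x. x \<bullet> x)"
proof (cases k)
  case (Suc k)
  show ?thesis unfolding Suc
  proof (rule times_cont_diff_SucI[where f' = "\<lambda>x h. 2 * (x \<bullet> h)"])
    show "((\<lambda>x. x \<bullet> x) has_derivative (\<lambda>h. 2 * (x \<bullet> h))) (at x)" for x :: 'a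
      by (rule has_derivative_inner_self)
    show "times_cont_diff k (\<lambda>x. 2 * (x \<bullet> b))" for b :: 'a
      by (intro times_cont_diff_mult times_cont_diff_const times_cont_diff_inner)
  qed
qed (auto intro: continuous_intros)

text \<open>Outer functions are given together with all their derivatives, as a sequence \<open>\<phi>\<close> with
  \<open>\<phi> (Suc j)\<close> the derivative of \<open>\<phi> j\<close>: the chain rule turns \<open>\<phi> j \<circ> f\<close> into a product that contains
  \<open>\<phi> (Suc j) \<circ> f\<close>, so the induction has to treat all \<open>j\<close> together. The set \<open>S\<close> admits outer
  functions such as real powers, which are smooth only on a half-line.\<close>

lemma times_cont_diff_compose:
  assumes \<phi>: "\<And>j s. s \<in> S \<Longrightarrow> (\<phi> j has_real_derivative \<phi> (Suc j) s) (at s)"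
    and f: "\<And>k. times_cont_diff k f" and S: "\<And>x. f x \<in> S"
  shows "times_cont_diff k (\<lambda>x. \<phi> j (f x))"
proof (induction k arbitrary: j)
  case 0
  have "isCont (\<lambda>x. \<phi> j (f x)) x" for x
  proof (rule isCont_o2[where f = f and g = "\<phi> j"])
    show "isCont f x"
      using f[of 0] by (simp add: continuous_on_eq_continuous_at)
    show "isCont (\<phi> j) (f x)"
      using \<phi>[OF S] by (rule DERIV_isCont)
  qed
  then show ?case by (simp add: continuous_on_eq_continuous_at)
next
  case (Suc k)
  show ?case
  proof (rule times_cont_diff_SucI[where f' = "\<lambda>x h. \<phi> (Suc j) (f x) * frechet_derivative f (at x) h"])
    show "((\<lambda>x. \<phi> j (f x)) has_derivative (\<lambda>h. \<phi> (Suc j) (f x) * frechet_derivative f (at x) h)) (at x)" for x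
      using has_derivative_compose[OF times_cont_diff_has_derivative[OF f[of "Suc 0"]] \<phi>[OF S, unfolded has_field_derivative_def]]
      by simp
    show "times_cont_diff k (\<lambda>x. \<phi> (Suc j) (f x) * frechet_derivative f (at x) b)" if "b \<in> Basis" for b
      using Suc f[of "Suc k"] that by (intro times_cont_diff_mult) auto
  qed
qed

lemma smooth_const: "smooth (\<lambda>x. c)"
  by (simp add: smooth_def times_cont_diff_const)

lemma smooth_inner: "smooth (\<lambda>x. x \<bullet> a)"
  by (simp add: smooth_def times_cont_diff_inner)

lemma smooth_inner_self: "smooth (\<lambda>x. x \<bullet> x)"
  by (simp add: smooth_def times_cont_diff_inner_self)

lemma smooth_add: "smooth f \<Longrightarrow> smooth g \<Longrightarrow> smooth (\<lambda>x. f x + g x)"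
  by (simp add: smooth_def times_cont_diff_add)

lemma smooth_mult: "smooth f \<Longrightarrow> smooth g \<Longrightarrow> smooth (\<lambda>x. f x * g x)"
  by (simp add: smooth_def times_cont_diff_mult)

lemma smooth_compose:
  assumes "\<And>j s. s \<in> S \<Longrightarrow> (\<phi> j has_real_derivative \<phi> (Suc j) s) (at s)"
    and "smooth f" and "\<And>x. f x \<in> S"
  shows "smooth (\<lambda>x. \<phi> 0 (f x))"
  unfolding smooth_def using assms
  by (intro allI times_cont_diff_compose[where \<phi> = \<phi> and S = S]) (auto simp: smooth_def)

lemma smooth_exp: "smooth f \<Longrightarrow> smooth (\<lambda>x. exp (f x))"
  by (rule smooth_compose[of UNIV "\<lambda>_. exp"]) (auto intro: DERIV_exp)

lemma smooth_partial: "smooth f \<Longrightarrow> b \<in> Basis \<Longrightarrow> smooth (partial b f)"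
  unfolding smooth_def by (metis times_cont_diff.simps(2))

lemma smoothI:
  assumes "\<And>x. (f has_derivative f' x) (at x)" "\<And>b. b \<in> Basis \<Longrightarrow> smooth (\<lambda>x. f' x b)"
  shows "smooth f"
  unfolding smooth_def
proof
  fix k
  have "times_cont_diff (Suc k) f"
    using assms by (intro times_cont_diff_SucI) (auto simp: smooth_def)
  then show "times_cont_diff k f" by (rule times_cont_diff_Suc_imp)
qed

lemma smooth_has_derivative:
  "smooth f \<Longrightarrow> (f has_derivative frechet_derivative f (at x)) (at x)"
  by (auto simp: smooth_def simp del: times_cont_diff.simps intro: times_cont_diff_has_derivative)

lemma smooth_continuous: "smooth f \<Longrightarrow> continuous_on UNIV f"
  by (auto simp: smooth_def intro: times_cont_diff_continuous)

lemma smooth_measurable: "smooth f \<Longrightarrow> f \<in> borel_measurable borel"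
  by (intro borel_measurable_continuous_onI smooth_continuous)

lemma partial_eqI: "(f has_derivative f') (at x) \<Longrightarrow> frechet_derivative f (at x) b = f' b"
  by (simp flip: frechet_derivative_at)

lemma partial_mult:
  assumes "smooth f" "smooth g"
  shows "partial b (\<lambda>x. f x * g x) x = f x * partial b g x + partial b f x * g x"
  by (rule partial_eqI[OF has_derivative_mult[OF assms[THEN smooth_has_derivative]]])

section \<open>Smooth cut-offs\<close>

text \<open>The functions \<open>p (1/s) exp (-1/s)\<close> on the positive half-line, extended by zero. For \<open>p = 1\<close> this is
  the standard smooth function with support in a half-line; the polynomial factor makes the class
  closed under differentiation.\<close>

definition bump_poly :: "real poly \<Rightarrow> real \<Rightarrow> real" where
  "bump_poly p s = (if s > 0 then poly p (1 / s) * exp (- (1 / s)) else 0)"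

lemma poly_mult_exp_tendsto_0:
  fixes p :: "real poly"
  shows "((\<lambda>t. poly p t * exp (- t)) \<longlongrightarrow> 0) at_top"
proof -
  have "((\<lambda>t. \<Sum>i\<le>degree p. coeff p i * (t ^ i / exp t)) \<longlongrightarrow> (\<Sum>i\<le>degree p. coeff p i * 0)) at_top"
    by (intro tendsto_sum tendsto_mult tendsto_const tendsto_power_div_exp_0)
  then show ?thesis
    by (simp add: poly_altdef sum_distrib_right exp_minus divide_inverse mult.assoc)
qed

text \<open>Differentiating \<open>p (1/s) exp (-1/s)\<close> replaces \<open>p\<close> by \<open>X\<^sup>2 (p - p')\<close>. At the origin the difference
  quotient is \<open>t p(t) exp (-t)\<close> with \<open>t = 1/s\<close>, which vanishes as \<open>t\<close> tends to infinity.\<close>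

lemma bump_poly_has_derivative:
  "(bump_poly p has_real_derivative bump_poly ([:0, 0, 1:] * (p - pderiv p)) s) (at s)"
proof -
  consider "s > 0" | "s < 0" | "s = 0" by linarith
  then show ?thesis
  proof cases
    case 1
    have "((\<lambda>s. poly p (1 / s) * exp (- (1 / s))) has_real_derivative
        bump_poly ([:0, 0, 1:] * (p - pderiv p)) s) (at s)"
    proof -
      have i: "((\<lambda>s. 1 / s) has_real_derivative - (1 / s\<^sup>2)) (at s)"
        using DERIV_inverse[of s] 1 by (simp add: divide_inverse power2_eq_square)
      have "((\<lambda>s. poly p (1 / s) * exp (- (1 / s))) has_real_derivative
        (poly (pderiv p) (1 / s) * - (1 / s\<^sup>2)) * exp (- (1 / s)) + (exp (- (1 / s)) * - (- (1 / s\<^sup>2))) * poly p (1 / s)) (at s)"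
        by (intro DERIV_mult DERIV_chain2[OF poly_DERIV] DERIV_chain2[OF DERIV_exp] DERIV_minus i)
      then show ?thesis
        using 1 by (simp add: bump_poly_def algebra_simps power2_eq_square)
    qed
    moreover have "eventually (\<lambda>t. t \<in> {0<..}) (nhds s)"
      using 1 by (intro eventually_nhds_in_open) auto
    ultimately show ?thesis
      by (subst DERIV_cong_ev[OF refl _ refl]) (auto elim!: eventually_mono simp: bump_poly_def)
  next
    case 2
    have "eventually (\<lambda>t. t \<in> {..<0}) (nhds s)"
      using 2 by (intro eventually_nhds_in_open) auto
    moreover have "((\<lambda>s. 0) has_real_derivative bump_poly ([:0, 0, 1:] * (p - pderiv p)) s) (at s)"
      using 2 by (auto simp: bump_poly_def)
    ultimately show ?thesis
      by (subst DERIV_cong_ev[OF refl _ refl, where g = "\<lambda>s. 0"]) (auto elim!: eventually_mono simp: bump_poly_def)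
  next
    case 3
    have "((\<lambda>h. bump_poly p h / h) \<longlongrightarrow> 0) (at_right 0)"
    proof -
      have "((\<lambda>t. poly ([:0, 1:] * p) t * exp (- t)) \<longlongrightarrow> 0) at_top"
        by (rule poly_mult_exp_tendsto_0)
      then have "((\<lambda>h. poly ([:0, 1:] * p) (inverse h) * exp (- inverse h)) \<longlongrightarrow> 0) (at_right 0)"
        by (rule filterlim_compose[OF _ filterlim_inverse_at_top_right])
      moreover have "eventually (\<lambda>h. poly ([:0, 1:] * p) (inverse h) * exp (- inverse h) = bump_poly p h / h) (at_right (0::real))"
        by (auto simp: eventually_at_filter bump_poly_def field_simps)
      ultimately show ?thesis
        by (rule Lim_transform_eventually)
    qed
    moreover have "((\<lambda>h. bump_poly p h / h) \<longlongrightarrow> 0) (at_left 0)"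
      by (rule Lim_transform_eventually[OF tendsto_const]) (auto simp: eventually_at_filter bump_poly_def)
    ultimately have "((\<lambda>h. bump_poly p h / h) \<longlongrightarrow> 0) (at 0)"
      by (rule filterlim_split_at[rotated])
    then show ?thesis
      using 3 by (simp add: has_field_derivative_iff bump_poly_def)
  qed
qed

primrec bump_deriv_poly :: "nat \<Rightarrow> real poly" where
  "bump_deriv_poly 0 = 1"
| "bump_deriv_poly (Suc k) = [:0, 0, 1:] * (bump_deriv_poly k - pderiv (bump_deriv_poly k))"

lemma bump_has_derivative:
  "(bump_poly (bump_deriv_poly k) has_real_derivative bump_poly (bump_deriv_poly (Suc k)) s) (at s)"
  using bump_poly_has_derivative[of "bump_deriv_poly k" s] by simp

lemma bump_poly_1: "bump_poly 1 s = (if s > 0 then exp (- (1 / s)) else 0)"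
  by (simp add: bump_poly_def)

text \<open>With \<open>t = 1/s\<close> the derivative is \<open>t\<^sup>2 exp (-t)\<close>, and \<open>exp t\<close> dominates \<open>t\<^sup>2 / 2\<close>.\<close>

lemma bump_derivative_bound: "\<bar>bump_poly (bump_deriv_poly (Suc 0)) s\<bar> \<le> 2"
proof (cases "s > 0")
  case True
  let ?t = "1 / s"
  have "?t\<^sup>2 / 2 \<le> exp ?t"
    using exp_lower_Taylor_quadratic[of ?t] True zero_less_divide_1_iff[of s] by linarith
  then have "?t\<^sup>2 * exp (- ?t) \<le> (2 * exp ?t) * exp (- ?t)"
    by (intro mult_right_mono) auto
  then have "?t\<^sup>2 * exp (- ?t) \<le> 2"
    by (simp add: mult.assoc mult_exp_exp)
  then show ?thesis using True by (simp add: bump_poly_def pderiv_1 power2_eq_square)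
qed (simp add: bump_poly_def)

text \<open>The factor \<open>exp 1\<close> normalises the value at the origin to 1. There is no plateau: it is enough that the
  cut-offs tend to 1 pointwise while their gradients tend to 0.\<close>

definition cutoff :: "real \<Rightarrow> 'a::euclidean_space \<Rightarrow> real" where
  "cutoff R x = exp 1 * bump_poly 1 (1 - (x \<bullet> x) / R\<^sup>2)"

lemma smooth_cutoff: "smooth (cutoff R :: 'a::euclidean_space \<Rightarrow> real)"
proof -
  have "smooth (\<lambda>x::'a. 1 + (- 1 / R\<^sup>2) * (x \<bullet> x))"
    by (intro smooth_add smooth_mult smooth_const smooth_inner_self)
  then have "smooth (\<lambda>x::'a. 1 - (x \<bullet> x) / R\<^sup>2)"
    by simp
  then have "smooth (\<lambda>x::'a. bump_poly (bump_deriv_poly 0) (1 - (x \<bullet> x) / R\<^sup>2))"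
    by (rule smooth_compose[where \<phi> = "\<lambda>k. bump_poly (bump_deriv_poly k)" and S = UNIV, rotated]) (auto intro: bump_has_derivative simp del: bump_deriv_poly.simps)
  then show ?thesis
    unfolding cutoff_def by (intro smooth_mult smooth_const) simp
qed

lemma cutoff_nonneg: "0 \<le> cutoff R x"
  by (simp add: cutoff_def bump_poly_1)

lemma cutoff_le_1: "cutoff R x \<le> 1"
proof (cases "1 - (x \<bullet> x) / R\<^sup>2 > 0")
  case True
  have "1 - (x \<bullet> x) / R\<^sup>2 \<le> 1" by simp
  then have "1 \<le> 1 / (1 - (x \<bullet> x) / R\<^sup>2)"
    using True by (simp add: le_divide_eq)
  then have "1 - 1 / (1 - (x \<bullet> x) / R\<^sup>2) \<le> 0" by simp
  then show ?thesis using True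
    by (simp only: cutoff_def bump_poly_1 if_True mult_exp_exp) simp
qed (simp add: cutoff_def bump_poly_1)

lemma cutoff_eq_0:
  assumes "R > 0" "norm x \<ge> R" shows "cutoff R x = 0"
proof -
  have "R\<^sup>2 \<le> x \<bullet> x"
    using assms by (simp flip: power2_norm_eq_inner)
  then show ?thesis using assms by (auto simp: cutoff_def bump_poly_1 field_simps)
qed

lemma partial_cutoff:
  "partial b (cutoff R) x = - (2 * exp 1 * (x \<bullet> b) / R\<^sup>2) * bump_poly (bump_deriv_poly (Suc 0)) (1 - (x \<bullet> x) / R\<^sup>2)"
proof -
  have "((\<lambda>x. 1 - (x \<bullet> x) / R\<^sup>2) has_derivative (\<lambda>h. - (2 * (x \<bullet> h) / R\<^sup>2))) (at x)"
    by (auto intro!: derivative_eq_intros simp: inner_commute fun_eq_iff divide_inverse)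
  from has_derivative_compose[OF this bump_has_derivative[of 0, unfolded has_field_derivative_def]]
  have "((\<lambda>x. exp 1 * bump_poly 1 (1 - (x \<bullet> x) / R\<^sup>2)) has_derivative
     (\<lambda>h. exp 1 * (bump_poly (bump_deriv_poly (Suc 0)) (1 - (x \<bullet> x) / R\<^sup>2) * - (2 * (x \<bullet> h) / R\<^sup>2)))) (at x)"
    unfolding bump_deriv_poly.simps(1) by (rule has_derivative_mult_right)
  from partial_eqI[OF this] show ?thesis
    unfolding cutoff_def[abs_def] by simp
qed

lemma partial_cutoff_bound:
  "\<bar>partial b (cutoff R) x\<bar> \<le> 4 * exp 1 / R\<^sup>2 * \<bar>x \<bullet> b\<bar>"
proof -
  have "\<bar>partial b (cutoff R) x\<bar> = (2 * exp 1 / R\<^sup>2 * \<bar>x \<bullet> b\<bar>) * \<bar>bump_poly (bump_deriv_poly (Suc 0)) (1 - (x \<bullet> x) / R\<^sup>2)\<bar>"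
    unfolding partial_cutoff by (simp add: abs_mult)
  also have "\<dots> \<le> (2 * exp 1 / R\<^sup>2 * \<bar>x \<bullet> b\<bar>) * 2"
    by (intro mult_left_mono bump_derivative_bound) auto
  finally show ?thesis by simp
qed

lemma cutoff_tendsto: "(\<lambda>n. cutoff (real (Suc n)) x) \<longlonglongrightarrow> 1"
proof -
  have l: "(\<lambda>n. 1 - (x \<bullet> x) / (real (Suc n))\<^sup>2) \<longlonglongrightarrow> 1 - 0"
  proof (rule tendsto_diff[OF tendsto_const])
    show "(\<lambda>n. (x \<bullet> x) / (real (Suc n))\<^sup>2) \<longlonglongrightarrow> 0"
      by real_asymp
  qed
  have "isCont (bump_poly 1) 1"
    using bump_has_derivative[of 0] by (auto intro: DERIV_isCont)
  from isCont_tendsto_compose[OF this l[unfolded diff_zero]]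
  have "(\<lambda>n. exp 1 * bump_poly 1 (1 - (x \<bullet> x) / (real (Suc n))\<^sup>2)) \<longlonglongrightarrow> exp 1 * bump_poly 1 1"
    by (rule tendsto_mult[OF tendsto_const])
  then show ?thesis by (simp add: cutoff_def bump_poly_1 mult_exp_exp)
qed

lemma smooth_gauss_density: "smooth (gauss_density :: 'a::euclidean_space \<Rightarrow> real)"
proof -
  have "smooth (\<lambda>x::'a. (2 * pi) powr (- real DIM('a) / 2) * exp ((- 1 / 2) * (x \<bullet> x)))"
    by (intro smooth_mult smooth_const smooth_exp smooth_inner_self)
  then show ?thesis
    by (simp add: gauss_density_def[abs_def] power2_norm_eq_inner)
qed

lemma partial_gauss_density:
  fixes x b :: "'a::euclidean_space"
  shows "partial b gauss_density x = - (x \<bullet> b) * gauss_density x"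
proof -
  have "((\<lambda>x. (- 1 / 2) * (x \<bullet> x)) has_derivative (\<lambda>h. (- 1 / 2) * (2 * (x \<bullet> h)))) (at x)"
    by (intro has_derivative_mult_right has_derivative_inner_self)
  then have "((\<lambda>x. - (x \<bullet> x) / 2) has_derivative (\<lambda>h. - (x \<bullet> h))) (at x)"
    by simp
  from has_derivative_compose[OF this DERIV_exp[unfolded has_field_derivative_def]]
  have "((\<lambda>x::'a. (2 * pi) powr (- real DIM('a) / 2) * exp (- (x \<bullet> x) / 2)) has_derivative
     (\<lambda>h. (2 * pi) powr (- real DIM('a) / 2) * (exp (- (x \<bullet> x) / 2) * (- (x \<bullet> h))))) (at x)"
    by (rule has_derivative_mult_right)
  from partial_eqI[OF this] show ?thesis
    by (simp add: gauss_density_def[abs_def] power2_norm_eq_inner)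
qed

section \<open>Integration by parts against smooth functions\<close>

definition grad :: "('a::euclidean_space \<Rightarrow> real) \<Rightarrow> 'a \<Rightarrow> 'a" where
  "grad h x = (\<Sum>b\<in>Basis. partial b h x *\<^sub>R b)"

lemma grad_inner_Basis: "b \<in> Basis \<Longrightarrow> grad h x \<bullet> b = partial b h x"
  by (simp add: grad_def)

lemma continuous_grad: "smooth h \<Longrightarrow> continuous_on UNIV (grad h)"
  unfolding grad_def[abs_def]
  by (intro continuous_on_sum continuous_on_scaleR continuous_on_const smooth_continuous smooth_partial)

lemma integrable_compact_support:
  fixes f :: "'a::euclidean_space \<Rightarrow> real"
  assumes "continuous_on UNIV f" "compact K" "\<And>x. x \<notin> K \<Longrightarrow> f x = 0"
  shows "integrable lborel f"
proof -
  have "integrable lborel (\<lambda>x. indicator K x *\<^sub>R f x)"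
    using assms by (intro borel_integrable_compact) (auto intro: continuous_on_subset)
  moreover have "(\<lambda>x. indicator K x *\<^sub>R f x) = f"
    using assms(3) by (auto simp: indicator_def fun_eq_iff)
  ultimately show ?thesis by simp
qed

lemma partial_eq_0_outside:
  assumes "closed K" "\<And>x. x \<notin> K \<Longrightarrow> f x = 0" "x \<notin> K"
  shows "partial b f x = 0"
proof -
  have "(f has_derivative (\<lambda>h. 0)) (at x)"
    by (rule has_derivative_transform_within_open[OF has_derivative_const, of "- K"])
       (use assms in \<open>auto simp: open_Compl\<close>)
  from partial_eqI[OF this] show ?thesis .
qed

lemma smooth_line_derivative:
  assumes "smooth f"
  shows "((\<lambda>s. f (x + s *\<^sub>R b)) has_real_derivative partial b f (x + s *\<^sub>R b)) (at s)"
proof -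
  have "((\<lambda>s. x + s *\<^sub>R b) has_derivative (\<lambda>h. h *\<^sub>R b)) (at s)"
    by (auto intro!: derivative_eq_intros)
  from has_derivative_compose[OF this smooth_has_derivative[OF assms]]
  have "((\<lambda>s. f (x + s *\<^sub>R b)) has_derivative (\<lambda>h. frechet_derivative f (at (x + s *\<^sub>R b)) (h *\<^sub>R b))) (at s)" .
  moreover have "frechet_derivative f (at y) (h *\<^sub>R b) = partial b f y * h" for h y
    using linear_scale[OF has_derivative_linear[OF smooth_has_derivative[OF assms]]] by simp
  ultimately show ?thesis by (simp add: has_field_derivative_def)
qed

lemma integral_lborel_translate:
  fixes f :: "'a::euclidean_space \<Rightarrow> real"
  assumes [measurable]: "f \<in> borel_measurable borel"
  shows "(\<integral>x. f (x + a) \<partial>lborel) = (\<integral>x. f x \<partial>lborel)"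
  by (subst (2) lborel_distr_plus[of a, symmetric], subst integral_distr) (auto simp: add.commute)

lemma integrable_lborel_translate:
  fixes f :: "'a::euclidean_space \<Rightarrow> real"
  assumes "integrable lborel f"
  shows "integrable lborel (\<lambda>x. f (x + a))"
  using assms
  by (subst (asm) lborel_distr_plus[of a, symmetric], subst (asm) integrable_distr_eq) (auto simp: add.commute)

text \<open>Lebesgue measure is translation invariant, so every difference quotient of \<open>f\<close> has integral zero; the
  difference quotients are dominated by a multiple of the indicator of a ball, because the partial
  derivative is bounded and vanishes outside \<open>K\<close>.\<close>

lemma integral_partial_eq_0:
  fixes f :: "'a::euclidean_space \<Rightarrow> real"
  assumes f: "smooth f" and K: "compact K" and f0: "\<And>x. x \<notin> K \<Longrightarrow> f x = 0" and b: "b \<in> Basis"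
  shows "(\<integral>x. partial b f x \<partial>lborel) = 0"
proof -
  let ?g = "partial b f"
  note [measurable] = smooth_measurable[OF f] smooth_measurable[OF smooth_partial[OF f b]]
  have g0: "?g x = 0" if "x \<notin> K" for x
    using partial_eq_0_outside[OF compact_imp_closed[OF K] f0 that] .
  obtain C0 where C0: "\<And>x. x \<in> K \<Longrightarrow> norm (?g x) \<le> C0"
    using compact_imp_bounded[OF compact_continuous_image[OF continuous_on_subset[OF smooth_continuous[OF smooth_partial[OF f b]]] K]]
    by (auto simp: bounded_iff)
  define C where "C = max C0 0"
  have C: "\<bar>?g x\<bar> \<le> C" "0 \<le> C" for x
    using C0[of x] g0[of x] by (cases "x \<in> K"; force simp: C_def)+
  obtain R where R: "\<And>x. x \<in> K \<Longrightarrow> norm x \<le> R"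
    using compact_imp_bounded[OF K] by (auto simp: bounded_iff)
  let ?h = "\<lambda>n. 1 / real (Suc n)"
  let ?D = "\<lambda>n x. (f (x + ?h n *\<^sub>R b) - f x) / ?h n"
  have intf: "integrable lborel f"
    by (rule integrable_compact_support[OF smooth_continuous[OF f] K f0])
  \<comment> \<open>Both sides of the difference quotient have the same integral.\<close>
  have D0: "(\<integral>x. ?D n x \<partial>lborel) = 0" for n
    using integral_lborel_translate[of f "?h n *\<^sub>R b"] intf integrable_lborel_translate[OF intf, of "?h n *\<^sub>R b"]
    by simp
  have "(\<lambda>n. \<integral>x. ?D n x \<partial>lborel) \<longlonglongrightarrow> (\<integral>x. ?g x \<partial>lborel)"
  proof (rule integral_dominated_convergence[where w = "\<lambda>x. C * indicator (cball 0 (R + 1)) x"])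
    show "integrable lborel (\<lambda>x::'a. C * indicator (cball 0 (R + 1)) x)"
      by (intro integrable_mult_right integrable_real_indicator) (use emeasure_lborel_cball_finite[of "0::'a" "R + 1"] in auto)
    show "AE x in lborel. (\<lambda>n. ?D n x) \<longlonglongrightarrow> ?g x"
    proof (rule AE_I2)
      fix x
      have "((\<lambda>h. (f (x + h *\<^sub>R b) - f x) / h) \<longlongrightarrow> ?g x) (at 0)"
        using smooth_line_derivative[OF f, of x b 0] by (simp add: has_field_derivative_iff)
      moreover have "filterlim ?h (at 0) sequentially"
        by (rule filterlim_atI) (real_asymp, simp)
      ultimately show "(\<lambda>n. ?D n x) \<longlonglongrightarrow> ?g x"
        by (rule filterlim_compose)
    qed
    show "AE x in lborel. norm (?D n x) \<le> C * indicator (cball 0 (R + 1)) x" for n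
    proof (rule AE_I2)
      fix x
      show "norm (?D n x) \<le> C * indicator (cball 0 (R + 1)) x"
      proof (cases "x \<in> cball 0 (R + 1)")
        case True
        have "\<exists>z. z > 0 \<and> z < ?h n \<and> f (x + ?h n *\<^sub>R b) - f (x + 0 *\<^sub>R b) = (?h n - 0) * ?g (x + z *\<^sub>R b)"
          by (rule MVT2) (auto intro!: smooth_line_derivative f)
        then obtain z where "f (x + ?h n *\<^sub>R b) - f x = ?h n * ?g (x + z *\<^sub>R b)"
          by auto
        then have "?D n x = ?g (x + z *\<^sub>R b)"
          by simp
        then show ?thesis using C True by simp
      next
        case False
        have "?h n \<le> 1" by simp
        then have "norm (?h n *\<^sub>R b) \<le> 1" using b by simp
        moreover have "norm x \<le> norm (x + ?h n *\<^sub>R b) + norm (?h n *\<^sub>R b)"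
          using norm_triangle_ineq4[of "x + ?h n *\<^sub>R b" "?h n *\<^sub>R b"] by simp
        moreover have "norm x > R + 1" using False by simp
        ultimately have "norm (x + ?h n *\<^sub>R b) > R"
          by linarith
        then have "x + ?h n *\<^sub>R b \<notin> K" "x \<notin> K"
          using False R[of x] R[of "x + ?h n *\<^sub>R b"] by force+
        then show ?thesis using C(2) f0 by simp
      qed
    qed
  qed measurable
  then show ?thesis
    unfolding D0 by (simp add: LIMSEQ_const_iff)
qed

lemma test_functionsI:
  assumes "smooth f" "compact K" "\<And>x. x \<notin> K \<Longrightarrow> f x = 0"
  shows "f \<in> test_functions"
proof -
  have "closure {x. f x \<noteq> 0} \<subseteq> K"
    using assms by (intro closure_minimal) (auto intro: compact_imp_closed)
  then have "compact (closure {x. f x \<noteq> 0})"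
    using compact_Int_closed[OF assms(2) closed_closure[of "{x. f x \<noteq> 0}"]] by (simp add: Int_absorb1)
  then show ?thesis using assms(1) by (simp add: test_functions_def smooth_def)
qed

lemma test_functionsE:
  assumes "f \<in> test_functions"
  obtains K where "smooth f" "compact K" "\<And>x. x \<notin> K \<Longrightarrow> f x = 0"
proof
  show "x \<notin> closure {x. f x \<noteq> 0} \<Longrightarrow> f x = 0" for x
    using closure_subset[of "{x. f x \<noteq> 0}"] by auto
qed (use assms in \<open>auto simp: test_functions_def smooth_def\<close>)

text \<open>The product of \<open>h\<close> with a test function is smooth with compact support, so its partial derivatives have
  integral zero.\<close>

lemma smooth_has_weak_gradient:
  fixes h :: "'a::euclidean_space \<Rightarrow> real"
  assumes h: "smooth h"
  shows "has_weak_gradient h (grad h)"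
  unfolding has_weak_gradient_def
proof (intro conjI ballI)
  show "locally_integrable h" "locally_integrable (grad h)"
    unfolding locally_integrable_def set_integrable_def
    by (intro allI impI borel_integrable_compact continuous_on_subset[OF smooth_continuous[OF h]]
        continuous_on_subset[OF continuous_grad[OF h]]; simp)+
  fix \<phi> :: "'a \<Rightarrow> real" and b :: 'a
  assume "\<phi> \<in> test_functions" and b: "b \<in> Basis"
  then obtain K where \<phi>: "smooth \<phi>" and K: "compact K" and \<phi>0: "\<And>x. x \<notin> K \<Longrightarrow> \<phi> x = 0"
    by (elim test_functionsE) blast
  have p0: "partial b \<phi> x = 0" if "x \<notin> K" for x
    using partial_eq_0_outside[OF compact_imp_closed[OF K] \<phi>0 that] .
  have i1: "integrable lborel (\<lambda>x. h x * partial b \<phi> x)"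
    by (rule integrable_compact_support[OF continuous_on_mult K])
       (auto simp: p0 intro!: smooth_continuous h smooth_partial \<phi> b)
  have i2: "integrable lborel (\<lambda>x. partial b h x * \<phi> x)"
    by (rule integrable_compact_support[OF continuous_on_mult K])
       (auto simp: \<phi>0 intro!: smooth_continuous h smooth_partial \<phi> b)
  have "0 = (\<integral>x. partial b (\<lambda>x. h x * \<phi> x) x \<partial>lborel)"
    by (rule integral_partial_eq_0[OF smooth_mult[OF h \<phi>] K _ b, symmetric]) (simp add: \<phi>0)
  also have "\<dots> = (\<integral>x. h x * partial b \<phi> x + partial b h x * \<phi> x \<partial>lborel)"
    using h \<phi> by (simp add: partial_mult)
  also have "\<dots> = (\<integral>x. h x * partial b \<phi> x \<partial>lborel) + (\<integral>x. partial b h x * \<phi> x \<partial>lborel)"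
    using i1 i2 by (rule Bochner_Integration.integral_add)
  finally show "(\<integral>x. h x * partial b \<phi> x \<partial>lborel) = - (\<integral>x. (grad h x \<bullet> b) * \<phi> x \<partial>lborel)"
    using b by (simp add: grad_inner_Basis)
qed

lemma smooth_gauss_W12:
  assumes h: "smooth h" "h \<in> gauss_L2" "\<And>b. b \<in> Basis \<Longrightarrow> partial b h \<in> gauss_L2"
  shows "has_gauss_W12_gradient h (grad h)"
  unfolding has_gauss_W12_gradient_def
proof (intro conjI h(2) smooth_has_weak_gradient h(1) gauss_L2_I)
  have [measurable]: "grad h \<in> borel_measurable borel"
    by (intro borel_measurable_continuous_onI continuous_grad h)
  show "(\<lambda>x. norm (grad h x)) \<in> borel_measurable borel" by measurable
  have "(norm (grad h x))\<^sup>2 = (\<Sum>b\<in>Basis. (partial b h x)\<^sup>2)" for x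
    by (subst power2_norm_eq_inner, subst euclidean_inner) (simp add: grad_inner_Basis power2_eq_square)
  then show "integrable gauss_measure (\<lambda>x. (norm (grad h x))\<^sup>2)"
    using h(3) by (simp add: gauss_L2_def)
qed

text \<open>Local integrability only speaks about truncations to compact sets; the function is their limit.\<close>

lemma locally_integrable_measurable:
  fixes f :: "'a::euclidean_space \<Rightarrow> 'b::euclidean_space"
  assumes "locally_integrable f"
  shows "f \<in> borel_measurable borel"
proof (rule borel_measurable_LIMSEQ_metric)
  show "(\<lambda>x. indicator (cball 0 (real n)) x *\<^sub>R f x) \<in> borel_measurable borel" for n
    using assms by (auto simp: locally_integrable_def set_integrable_def dest!: spec[of _ "cball 0 (real n)"] borel_measurable_integrable)
  fix x :: 'a
  have "eventually (\<lambda>n. f x = indicator (cball 0 (real n)) x *\<^sub>R f x) sequentially"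
    using eventually_ge_at_top[of "nat \<lceil>norm x\<rceil>"]
    by eventually_elim (auto simp: indicator_def nat_le_iff ceiling_le_iff)
  then show "(\<lambda>n. indicator (cball 0 (real n)) x *\<^sub>R f x) \<longlonglongrightarrow> f x"
    by (rule Lim_transform_eventually[OF tendsto_const])
qed

lemma W12_component_L2:
  assumes H: "has_gauss_W12_gradient v H" and b: "b \<in> Basis"
  shows "(\<lambda>x. H x \<bullet> b) \<in> gauss_L2"
proof (rule gauss_L2_bound)
  have [measurable]: "H \<in> borel_measurable borel"
    using H by (auto simp: has_gauss_W12_gradient_def has_weak_gradient_def intro: locally_integrable_measurable)
  show "(\<lambda>x. H x \<bullet> b) \<in> borel_measurable borel" by measurable
  show "(\<lambda>x. norm (H x)) \<in> gauss_L2" using H by (simp add: has_gauss_W12_gradient_def)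
  show "\<bar>H x \<bullet> b\<bar> \<le> \<bar>norm (H x)\<bar>" for x using Basis_le_norm[OF b] by simp
qed

text \<open>The weak gradient of \<open>v\<close> is tested with \<open>F\<close> times the Gauss density times a cut-off. The derivative of
  the density produces the drift term \<open>- (x \<bullet> b) F\<close>, and the term with the gradient of the cut-off
  disappears in the limit. Square integrability of \<open>F\<close>, its derivative and \<open>(x \<bullet> b) F\<close> gives the
  dominating function.\<close>

lemma gauss_integration_by_parts:
  fixes v :: "'a::euclidean_space \<Rightarrow> real"
  assumes H: "has_gauss_W12_gradient v H" and F: "smooth F" and b: "b \<in> Basis"
    and L: "F \<in> gauss_L2" "partial b F \<in> gauss_L2" "(\<lambda>x. (x \<bullet> b) * F x) \<in> gauss_L2"
  shows "(\<integral>x. (H x \<bullet> b) * F x \<partial>gauss_measure)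
     = - (\<integral>x. v x * (partial b F x - (x \<bullet> b) * F x) \<partial>gauss_measure)"
proof -
  have v: "v \<in> gauss_L2" using H by (simp add: has_gauss_W12_gradient_def)
  note Hb = W12_component_L2[OF H b]
  note [measurable] = gauss_L2_measurable[OF v] gauss_L2_measurable[OF Hb] smooth_measurable[OF F]
    smooth_measurable[OF smooth_partial[OF F b]]
  let ?\<chi> = "\<lambda>n. cutoff (real (Suc n)) :: 'a \<Rightarrow> real"
  let ?\<phi> = "\<lambda>n x. ?\<chi> n x * (F x * gauss_density x)"
  note c = smooth_cutoff smooth_gauss_density F
  have c1[measurable]: "?\<chi> n \<in> borel_measurable borel" "partial b (?\<chi> n) \<in> borel_measurable borel" for n
    by (intro smooth_measurable smooth_partial smooth_cutoff b)+
  have c\<chi>: "\<bar>?\<chi> n x\<bar> \<le> 1" for n x using cutoff_nonneg cutoff_le_1 by (simp add: abs_le_iff order_trans[OF _ cutoff_nonneg])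
  have p\<chi>: "\<bar>partial b (?\<chi> n) x\<bar> \<le> 4 * exp 1 * \<bar>x \<bullet> b\<bar>" for n x
  proof -
    have "4 * exp 1 / (real (Suc n))\<^sup>2 \<le> 4 * exp 1 / 1\<^sup>2"
      by (intro divide_left_mono power_mono) auto
    then show ?thesis
      by (intro order_trans[OF partial_cutoff_bound] mult_right_mono) auto
  qed
  have p\<chi>0: "(\<lambda>n. partial b (?\<chi> n) x) \<longlonglongrightarrow> 0" for x
  proof (rule Lim_null_comparison)
    show "eventually (\<lambda>n. norm (partial b (?\<chi> n) x) \<le> 4 * exp 1 / (real (Suc n))\<^sup>2 * \<bar>x \<bullet> b\<bar>) sequentially"
      by (rule always_eventually) (simp only: real_norm_def partial_cutoff_bound simp_thms)
    show "(\<lambda>n. 4 * exp 1 / (real (Suc n))\<^sup>2 * \<bar>x \<bullet> b\<bar>) \<longlonglongrightarrow> 0"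
      by real_asymp
  qed
  \<comment> \<open>The definition of the weak gradient for the test function, with the product rule applied.\<close>
  have eq: "(\<integral>x. v x * (?\<chi> n x * (partial b F x - (x \<bullet> b) * F x) + partial b (?\<chi> n) x * F x) \<partial>gauss_measure)
      = - (\<integral>x. (H x \<bullet> b) * F x * ?\<chi> n x \<partial>gauss_measure)" for n
  proof -
    have "?\<phi> n \<in> test_functions"
      by (rule test_functionsI[where K = "cball 0 (real (Suc n))"])
         (auto intro!: smooth_mult c simp: cutoff_eq_0)
    then have "(\<integral>x. v x * partial b (?\<phi> n) x \<partial>lborel) = - (\<integral>x. (H x \<bullet> b) * ?\<phi> n x \<partial>lborel)"
      using H b by (simp add: has_gauss_W12_gradient_def has_weak_gradient_def)
    moreover have "partial b (?\<phi> n) x = gauss_density x * (?\<chi> n x * (partial b F x - (x \<bullet> b) * F x) + partial b (?\<chi> n) x * F x)" for x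
      by (subst partial_mult, intro c, intro smooth_mult c, subst partial_mult, (intro c)+)
         (simp add: partial_gauss_density algebra_simps)
    ultimately show ?thesis
      by (subst (1 2) integral_gauss) (simp_all only: mult_ac, measurable)
  qed
  have d: "integrable gauss_measure (\<lambda>x. \<bar>v x * f x\<bar>)" if "f \<in> gauss_L2" for f
    using gauss_L2_mult_integrable[OF v that] by simp
  have "(\<lambda>n. \<integral>x. v x * (?\<chi> n x * (partial b F x - (x \<bullet> b) * F x) + partial b (?\<chi> n) x * F x) \<partial>gauss_measure)
      \<longlonglongrightarrow> (\<integral>x. v x * (1 * (partial b F x - (x \<bullet> b) * F x) + 0 * F x) \<partial>gauss_measure)"
  proof (rule integral_dominated_convergence[where
        w = "\<lambda>x. \<bar>v x * partial b F x\<bar> + (1 + 4 * exp 1) * \<bar>v x * ((x \<bullet> b) * F x)\<bar>"])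
    show "integrable gauss_measure (\<lambda>x. \<bar>v x * partial b F x\<bar> + (1 + 4 * exp 1) * \<bar>v x * ((x \<bullet> b) * F x)\<bar>)"
      by (intro Bochner_Integration.integrable_add integrable_mult_right d L)
    show "AE x in gauss_measure. (\<lambda>n. v x * (?\<chi> n x * (partial b F x - (x \<bullet> b) * F x) + partial b (?\<chi> n) x * F x))
        \<longlonglongrightarrow> v x * (1 * (partial b F x - (x \<bullet> b) * F x) + 0 * F x)"
      by (rule AE_I2) (intro tendsto_mult tendsto_add tendsto_const cutoff_tendsto p\<chi>0)
    fix n
    show "AE x in gauss_measure. norm (v x * (?\<chi> n x * (partial b F x - (x \<bullet> b) * F x) + partial b (?\<chi> n) x * F x))
        \<le> \<bar>v x * partial b F x\<bar> + (1 + 4 * exp 1) * \<bar>v x * ((x \<bullet> b) * F x)\<bar>"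
    proof (rule AE_I2)
      fix x
      have "\<bar>?\<chi> n x * (partial b F x - (x \<bullet> b) * F x) + partial b (?\<chi> n) x * F x\<bar>
          \<le> \<bar>?\<chi> n x\<bar> * \<bar>partial b F x - (x \<bullet> b) * F x\<bar> + \<bar>partial b (?\<chi> n) x\<bar> * \<bar>F x\<bar>"
        by (rule order_trans[OF abs_triangle_ineq]) (simp add: abs_mult)
      also have "\<dots> \<le> 1 * (\<bar>partial b F x\<bar> + \<bar>(x \<bullet> b) * F x\<bar>) + (4 * exp 1 * \<bar>x \<bullet> b\<bar>) * \<bar>F x\<bar>"
        by (intro add_mono mult_mono c\<chi> p\<chi> abs_triangle_ineq4) auto
      finally have "\<bar>v x\<bar> * \<bar>?\<chi> n x * (partial b F x - (x \<bullet> b) * F x) + partial b (?\<chi> n) x * F x\<bar>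
          \<le> \<bar>v x\<bar> * (1 * (\<bar>partial b F x\<bar> + \<bar>(x \<bullet> b) * F x\<bar>) + (4 * exp 1 * \<bar>x \<bullet> b\<bar>) * \<bar>F x\<bar>)"
        by (rule mult_left_mono) simp
      also have "\<dots> = \<bar>v x * partial b F x\<bar> + (1 + 4 * exp 1) * \<bar>v x * ((x \<bullet> b) * F x)\<bar>"
        by (simp add: abs_mult algebra_simps)
      finally show "norm (v x * (?\<chi> n x * (partial b F x - (x \<bullet> b) * F x) + partial b (?\<chi> n) x * F x))
        \<le> \<bar>v x * partial b F x\<bar> + (1 + 4 * exp 1) * \<bar>v x * ((x \<bullet> b) * F x)\<bar>"
        unfolding real_norm_def abs_mult[of "v x" "_ + _"] .
    qed
  qed measurable
  moreover have "(\<lambda>n. \<integral>x. (H x \<bullet> b) * F x * ?\<chi> n x \<partial>gauss_measure)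
      \<longlonglongrightarrow> (\<integral>x. (H x \<bullet> b) * F x * 1 \<partial>gauss_measure)"
  proof (rule integral_dominated_convergence[where w = "\<lambda>x. \<bar>(H x \<bullet> b) * F x\<bar>"])
    show "integrable gauss_measure (\<lambda>x. \<bar>(H x \<bullet> b) * F x\<bar>)"
      using gauss_L2_mult_integrable[OF Hb L(1)] by simp
    show "AE x in gauss_measure. (\<lambda>n. (H x \<bullet> b) * F x * ?\<chi> n x) \<longlonglongrightarrow> (H x \<bullet> b) * F x * 1"
      by (rule AE_I2) (intro tendsto_mult tendsto_const cutoff_tendsto)
    fix n
    show "AE x in gauss_measure. norm ((H x \<bullet> b) * F x * ?\<chi> n x) \<le> \<bar>(H x \<bullet> b) * F x\<bar>"
      using c\<chi>[of n] by (auto simp: abs_mult intro!: mult_left_le)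
  qed measurable
  ultimately show ?thesis
    unfolding eq using LIMSEQ_unique[OF _ tendsto_minus] by fastforce
qed

text \<open>The sum on the right is \<open>\<Delta>h - x \<bullet> \<nabla>h\<close>, the classical Ornstein-Uhlenbeck operator. Since \<open>v\<close> ranges over
  all Sobolev functions, this yields both that a smooth \<open>h\<close> lies in the domain of the operator, and
  that a weak solution \<open>v\<close> can be tested against \<open>h\<close> with all derivatives moved to \<open>h\<close>.\<close>

lemma gauss_green_formula:
  fixes h :: "'a::euclidean_space \<Rightarrow> real"
  assumes h: "smooth h"
    and L: "\<And>b. b \<in> Basis \<Longrightarrow> partial b h \<in> gauss_L2"
      "\<And>b. b \<in> Basis \<Longrightarrow> partial b (partial b h) \<in> gauss_L2"
      "\<And>b. b \<in> Basis \<Longrightarrow> (\<lambda>x. (x \<bullet> b) * partial b h x) \<in> gauss_L2"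
    and H: "has_gauss_W12_gradient v H"
  shows "(\<integral>x. H x \<bullet> grad h x \<partial>gauss_measure)
     = - (\<integral>x. v x * (\<Sum>b\<in>Basis. partial b (partial b h) x - (x \<bullet> b) * partial b h x) \<partial>gauss_measure)"
proof -
  have v: "v \<in> gauss_L2" using H by (simp add: has_gauss_W12_gradient_def)
  have i1: "integrable gauss_measure (\<lambda>x. (H x \<bullet> b) * partial b h x)" if "b \<in> Basis" for b
    by (rule gauss_L2_mult_integrable[OF W12_component_L2[OF H that] L(1)[OF that]])
  have i2: "integrable gauss_measure (\<lambda>x. v x * (partial b (partial b h) x - (x \<bullet> b) * partial b h x))" if "b \<in> Basis" for b
    unfolding right_diff_distrib
    by (intro Bochner_Integration.integrable_diff gauss_L2_mult_integrable v L that)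
  have "(\<integral>x. H x \<bullet> grad h x \<partial>gauss_measure) = (\<integral>x. (\<Sum>b\<in>Basis. (H x \<bullet> b) * partial b h x) \<partial>gauss_measure)"
    by (subst euclidean_inner) (simp add: grad_inner_Basis)
  also have "\<dots> = (\<Sum>b\<in>Basis. \<integral>x. (H x \<bullet> b) * partial b h x \<partial>gauss_measure)"
    by (rule Bochner_Integration.integral_sum[OF i1])
  also have "\<dots> = (\<Sum>b\<in>Basis. - (\<integral>x. v x * (partial b (partial b h) x - (x \<bullet> b) * partial b h x) \<partial>gauss_measure))"
    by (intro sum.cong refl gauss_integration_by_parts[OF H] smooth_partial h L) auto
  also have "\<dots> = - (\<integral>x. (\<Sum>b\<in>Basis. v x * (partial b (partial b h) x - (x \<bullet> b) * partial b h x)) \<partial>gauss_measure)"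
    by (subst Bochner_Integration.integral_sum[OF i2]) (auto simp: sum_negf)
  finally show ?thesis
    by (simp add: sum_distrib_left)
qed

section \<open>An unbounded admissible function for large exponents\<close>

lemma open_measure_gauss_pos:
  fixes U :: "'a::euclidean_space set"
  assumes "open U" "x \<in> U"
  shows "measure gauss_measure U > 0"
proof (rule ccontr)
  assume "\<not> measure gauss_measure U > 0"
  then have "measure gauss_measure U = 0"
    using measure_nonneg[of gauss_measure U] by linarith
  then have "U \<in> null_sets gauss_measure"
    using assms(1) by (intro null_setsI) (auto simp: gauss.emeasure_eq_measure)
  then have "AE y in lborel. y \<in> U \<longrightarrow> ennreal (gauss_density y) = 0"
    unfolding gauss_measure_density by (subst (asm) null_sets_density_iff) auto
  then have "AE y in lborel. y \<notin> U"
    by eventually_elim (simp add: ennreal_eq_0_iff linorder_not_less[symmetric])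
  then have U0: "emeasure lborel U = 0"
    using assms(1) by (subst (asm) AE_iff_measurable[of U]) auto
  obtain e where e: "e > 0" "ball x e \<subseteq> U"
    using assms by (auto simp: open_contains_ball)
  have "emeasure lborel (ball x e) \<le> emeasure lborel U"
    using assms e by (intro emeasure_mono) auto
  then have "measure lborel (ball x e) = 0"
    unfolding U0 by (simp add: measure_def)
  then show False using content_ball_pos[OF e(1), of x] by simp
qed

lemma mv_odd:
  assumes [measurable]: "u \<in> borel_measurable borel" and odd: "\<And>x. u (- x) = - u x"
  shows "mv u = 0"
proof -
  have "mv u = (\<integral>x. u x \<partial>distr gauss_measure borel uminus)"
    by (simp add: distr_gauss_uminus mv_def)
  also have "\<dots> = - mv u"
    by (subst integral_distr) (auto simp: odd mv_def)
  finally show ?thesis by simp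
qed

text \<open>Symmetry gives \<open>\<gamma>(u > t) = \<gamma>(u < -t)\<close>. For \<open>t \<ge> 0\<close> the two sets are disjoint, so each has measure at
  most one half. For \<open>t < 0\<close> they cover the space and overlap in a nonempty open set, which has positive
  measure, so each has measure larger than one half.\<close>

lemma med_odd:
  fixes u :: "'a::euclidean_space \<Rightarrow> real"
  assumes cont: "continuous_on UNIV u" and odd: "\<And>x. u (- x) = - u x"
  shows "med u = 0"
proof -
  have u[measurable]: "u \<in> borel_measurable borel" using cont by (rule borel_measurable_continuous_onI)
  let ?m = "measure (gauss_measure :: 'a measure)"
  have sets: "{x. u x > t} \<in> sets gauss_measure" "{x. u x < t} \<in> sets gauss_measure" for t
    using u by (auto simp: pred_def[symmetric])
  have sym: "?m {x. u x > t} = ?m {x. u x < - t}" for t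
  proof -
    have "?m {x. u x > t} = measure (distr gauss_measure borel uminus) {x. u x > t}"
      by (simp add: distr_gauss_uminus)
    also have "\<dots> = ?m {x. u x < - t}"
      using sets(1)[of t] by (subst measure_distr) (auto simp: odd intro!: arg_cong[where f = ?m])
    finally show ?thesis .
  qed
  have "{t. ?m {x. u x > t} \<le> 1 / 2} = {0..}"
  proof (intro antisym subsetI)
    fix t :: real assume "t \<in> {0..}"
    then have "?m {x. u x > t} \<le> ?m {x. u x > 0}"
      by (intro gauss.finite_measure_mono sets) auto
    moreover have "?m {x. u x > 0} + ?m {x. u x < 0} = ?m ({x. u x > 0} \<union> {x. u x < 0})"
      by (subst gauss.finite_measure_Union) (auto intro: sets)
    moreover have "\<dots> \<le> 1" by (rule gauss.prob_le_1)
    moreover have "?m {x. u x > 0} = ?m {x. u x < 0}" using sym[of 0] by simp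
    ultimately have "?m {x. u x > t} \<le> 1 / 2" by linarith
    then show "t \<in> {t. ?m {x. u x > t} \<le> 1 / 2}" by simp
  next
    fix t assume t: "t \<in> {t. ?m {x. u x > t} \<le> 1 / 2}"
    show "t \<in> {0..}"
    proof (rule ccontr)
      assume "t \<notin> {0..}"
      then have t0: "t < 0" by simp
      have u0: "u 0 = 0" using odd[of 0] by simp
      have "open ({x. u x > t} \<inter> {x. u x < - t})"
        using cont by (intro open_Int open_Collect_less) auto
      then have "?m ({x. u x > t} \<inter> {x. u x < - t}) > 0"
        using u0 t0 by (intro open_measure_gauss_pos[of _ 0]) auto
      moreover have "{x. u x > t} \<union> {x. u x < - t} = UNIV"
        using t0 by auto
      then have "?m ({x. u x > t} \<union> {x. u x < - t}) = 1"
        using gauss.prob_space[where 'a='a] by simp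
      moreover have "?m ({x. u x > t} \<union> {x. u x < - t}) = ?m {x. u x > t} + ?m {x. u x < - t} - ?m ({x. u x > t} \<inter> {x. u x < - t})"
        by (intro measure_Un3 fmeasurableI sets) (auto simp: less_top[symmetric])
      ultimately show False using sym[of t] t by simp
    qed
  qed
  then show ?thesis by (simp add: med_def)
qed

text \<open>The derivative of \<open>s \<mapsto> arsinh (s / sqrt 2)\<close>. The constant 2 matters: among the functions
  \<open>p(s) = 1 / sqrt (a + s\<^sup>2)\<close>, the bound \<open>\<bar>p' - s p\<bar> \<le> 1\<close> for all \<open>s\<close> requires \<open>a \<ge> 2\<close>.\<close>

definition witness_slope :: "real \<Rightarrow> real" where
  "witness_slope s = 1 / sqrt (2 + s * s)"

definition witness :: "'a::euclidean_space \<Rightarrow> 'a \<Rightarrow> real" where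
  "witness b x = arsinh ((x \<bullet> b) / sqrt 2)"

lemma two_plus_square_pos: "2 + s * s > (0::real)"
  by (rule add_pos_nonneg) auto

lemma witness_slope_sq: "(witness_slope s)\<^sup>2 = 1 / (2 + s * s)"
  using two_plus_square_pos[of s] by (simp add: witness_slope_def power_divide)

lemma witness_slope_bounds: "0 \<le> witness_slope s" "witness_slope s \<le> 1"
proof -
  show "0 \<le> witness_slope s" using two_plus_square_pos[of s] by (simp add: witness_slope_def)
  have "(witness_slope s)\<^sup>2 \<le> 1\<^sup>2"
    unfolding witness_slope_sq one_power2
    using two_plus_square_pos[of s] zero_le_square[of s] by (subst divide_le_eq_1_pos) linarith+
  then show "witness_slope s \<le> 1" by (rule power2_le_imp_le) simp
qed

lemma arsinh_scaled_derivative: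
  "((\<lambda>s. arsinh (s / sqrt 2)) has_real_derivative witness_slope s) (at s)"
proof -
  have "((\<lambda>s. arsinh (s / sqrt 2)) has_real_derivative 1 / sqrt ((s / sqrt 2)\<^sup>2 + 1) * (1 / sqrt 2)) (at s)"
    by (rule DERIV_chain2[OF arsinh_real_has_field_derivative DERIV_cdivide[OF DERIV_ident]])
  moreover have "1 / sqrt ((s / sqrt 2)\<^sup>2 + 1) * (1 / sqrt 2) = witness_slope s"
  proof -
    have "sqrt ((s / sqrt 2)\<^sup>2 + 1) * sqrt 2 = sqrt (((s / sqrt 2)\<^sup>2 + 1) * 2)"
      by (simp only: real_sqrt_mult)
    also have "((s / sqrt 2)\<^sup>2 + 1) * 2 = 2 + s * s"
      by (simp add: power_divide field_simps power2_eq_square)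
    finally show ?thesis by (simp add: witness_slope_def)
  qed
  ultimately show ?thesis by simp
qed

text \<open>The derivative of \<open>(2 + s\<^sup>2) powr (-1/2)\<close> is \<open>- s (2 + s\<^sup>2) powr (-3/2)\<close>.\<close>

lemma witness_slope_derivative:
  "(witness_slope has_real_derivative - (s * witness_slope s ^ 3)) (at s)"
proof -
  have "((\<lambda>s::real. 2 + s * s) has_real_derivative (0 + (1 * s + 1 * s))) (at s)"
    by (rule DERIV_add[OF DERIV_const DERIV_mult[OF DERIV_ident DERIV_ident]])
  from DERIV_chain2[OF DERIV_real_sqrt[OF two_plus_square_pos[of s]] this]
  have "((\<lambda>s. sqrt (2 + s * s)) has_real_derivative (inverse (sqrt (2 + s * s)) / 2) * (0 + (1 * s + 1 * s))) (at s)" .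
  then have "((\<lambda>s. inverse (sqrt (2 + s * s))) has_real_derivative
      - (inverse (sqrt (2 + s * s)) * ((inverse (sqrt (2 + s * s)) / 2) * (0 + (1 * s + 1 * s))) * inverse (sqrt (2 + s * s)))) (at s)"
    by (rule DERIV_inverse') (metis two_plus_square_pos real_sqrt_gt_0_iff less_irrefl)
  moreover have "- (inverse (sqrt (2 + s * s)) * ((inverse (sqrt (2 + s * s)) / 2) * (0 + (1 * s + 1 * s))) * inverse (sqrt (2 + s * s)))
      = - (s * witness_slope s ^ 3)"
  proof -
    have "- (i * ((i / 2) * (0 + (1 * s + 1 * s))) * i) = - (s * i ^ 3)" for i :: real
      by (simp add: power3_eq_cube)
    then show ?thesis unfolding witness_slope_def inverse_eq_divide .
  qed
  moreover have "witness_slope = (\<lambda>s. inverse (sqrt (2 + s * s)))"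
    by (rule ext) (simp only: witness_slope_def inverse_eq_divide)
  ultimately show ?thesis by (simp only:)
qed

lemma has_derivative_compose_inner:
  fixes g :: "real \<Rightarrow> real" and b x :: "'a::euclidean_space"
  assumes "(g has_real_derivative g') (at (x \<bullet> b))"
  shows "((\<lambda>x. g (x \<bullet> b)) has_derivative (\<lambda>h. g' * (h \<bullet> b))) (at x)"
proof (rule has_derivative_compose[where f = "\<lambda>x. x \<bullet> b" and g = g and f' = "\<lambda>h. h \<bullet> b" and g' = "\<lambda>y. g' * y"])
  show "((\<lambda>x. x \<bullet> b) has_derivative (\<lambda>h. h \<bullet> b)) (at x)"
    by (rule has_derivative_inner_left[OF has_derivative_ident])
  show "(g has_derivative (\<lambda>y. g' * y)) (at (x \<bullet> b))"
    using assms unfolding has_field_derivative_def .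
qed

lemma smooth_witness_slope: "smooth (\<lambda>x::'a::euclidean_space. witness_slope (x \<bullet> b))"
proof -
  \<comment> \<open>The iterated derivatives of \<open>s powr (-1/2)\<close>.\<close>
  let ?\<phi> = "\<lambda>k s. (\<Prod>i<k. - 1 / 2 - real i) * s powr (- 1 / 2 - real k)"
  have "smooth (\<lambda>x::'a. ?\<phi> 0 (2 + (x \<bullet> b) * (x \<bullet> b)))"
  proof (rule smooth_compose[where \<phi> = ?\<phi> and S = "{0<..}"])
    fix k and s :: real assume "s \<in> {0<..}"
    then have "((\<lambda>s. s powr (- 1 / 2 - real k)) has_real_derivative (- 1 / 2 - real k) * s powr (- 1 / 2 - real k - 1)) (at s)"
      by (intro has_real_derivative_powr) simp
    from DERIV_cmult[OF this, of "\<Prod>i<k. - 1 / 2 - real i"]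
    show "(?\<phi> k has_real_derivative ?\<phi> (Suc k) s) (at s)"
      by (simp add: mult.assoc algebra_simps)
  next
    show "smooth (\<lambda>x::'a. 2 + (x \<bullet> b) * (x \<bullet> b))"
      by (intro smooth_add smooth_mult smooth_const smooth_inner)
  qed (simp add: two_plus_square_pos)
  moreover have "?\<phi> 0 (2 + (x \<bullet> b) * (x \<bullet> b)) = witness_slope (x \<bullet> b)" for x :: 'a
  proof -
    have "y powr (- 1 / 2 - real 0) = 1 / sqrt y" if "y > 0" for y :: real
      using powr_minus_divide[of y "1/2"] powr_half_sqrt[of y] that by simp
    from this[OF two_plus_square_pos] show ?thesis
      unfolding witness_slope_def by simp
  qed
  ultimately show ?thesis by simp
qed

lemma witness_has_derivative:
  "(witness b has_derivative (\<lambda>h. witness_slope (x \<bullet> b) * (h \<bullet> b))) (at x)"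
  unfolding witness_def[abs_def]
  by (rule has_derivative_compose_inner[OF arsinh_scaled_derivative])

lemma smooth_witness: "smooth (witness b)"
  by (rule smoothI[OF witness_has_derivative]) (intro smooth_mult smooth_witness_slope smooth_const)

lemma partial_witness: "partial c (witness b) x = witness_slope (x \<bullet> b) * (c \<bullet> b)"
  by (rule partial_eqI[OF witness_has_derivative])

lemma partial_witness_slope:
  "partial c (\<lambda>x. witness_slope (x \<bullet> b) * k) x = - ((x \<bullet> b) * witness_slope (x \<bullet> b) ^ 3) * ((c \<bullet> b) * k)"
proof -
  have "((\<lambda>x. witness_slope (x \<bullet> b) * k) has_derivative
      (\<lambda>h. (- ((x \<bullet> b) * witness_slope (x \<bullet> b) ^ 3) * (h \<bullet> b)) * k)) (at x)"
    by (intro has_derivative_mult_left has_derivative_compose_inner witness_slope_derivative)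
  from partial_eqI[OF this] show ?thesis by simp
qed

text \<open>The image of the witness under the Ornstein-Uhlenbeck operator: \<open>U'' - s U'\<close> where \<open>U'\<close> is
  \<open>witness_slope\<close>.\<close>

definition witness_OU :: "real \<Rightarrow> real" where
  "witness_OU s = - (s * witness_slope s ^ 3) - s * witness_slope s"

text \<open>Put \<open>y = 1 / (2 + s\<^sup>2)\<close>. The square of the left-hand side is
  \<open>(1 - 2 y) (1 + y)\<^sup>2 = 1 - 3 y\<^sup>2 - 2 y\<^sup>3\<close>.\<close>

lemma witness_OU_bound: "\<bar>witness_OU s\<bar> \<le> 1"
proof -
  define y where "y = 1 / (2 + s * s)"
  have y: "y > 0" "s\<^sup>2 * y = 1 - 2 * y"
    using two_plus_square_pos[of s] by (auto simp: y_def field_simps power2_eq_square)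
  have "(witness_OU s)\<^sup>2 = s\<^sup>2 * (witness_slope s)\<^sup>2 * ((witness_slope s)\<^sup>2 + 1)\<^sup>2"
    by (simp add: witness_OU_def power2_eq_square power3_eq_cube algebra_simps)
  also have "\<dots> = (1 - 2 * y) * (y + 1)\<^sup>2"
    unfolding witness_slope_sq y_def[symmetric] y(2) ..
  also have "\<dots> = 1 - (3 * y\<^sup>2 + 2 * y ^ 3)"
    by (simp add: power2_eq_square power3_eq_cube algebra_simps)
  also have "\<dots> \<le> 1\<^sup>2"
  proof -
    have "0 \<le> 3 * y\<^sup>2 + 2 * y ^ 3" using y(1) by (intro add_nonneg_nonneg) auto
    then show ?thesis by simp
  qed
  finally show ?thesis
    using abs_le_square_iff[of "witness_OU s" 1] by simp
qed

lemma abs_arsinh: "\<bar>arsinh t\<bar> = arsinh \<bar>t\<bar>" for t :: real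
  by (cases t "0::real" rule: linorder_cases) (auto simp: abs_of_pos abs_of_neg)

lemma abs_arsinh_le: "\<bar>arsinh t\<bar> \<le> 2 * \<bar>t\<bar>" for t :: real
proof -
  have "sqrt (\<bar>t\<bar>\<^sup>2 + 1) \<le> \<bar>t\<bar> + 1"
    by (rule real_le_lsqrt) (auto simp: power2_eq_square algebra_simps)
  moreover have "arsinh \<bar>t\<bar> \<le> (\<bar>t\<bar> + sqrt (\<bar>t\<bar>\<^sup>2 + 1)) - 1"
    unfolding arsinh_real_def by (rule ln_le_minus_one) (rule arsinh_real_aux)
  ultimately show ?thesis unfolding abs_arsinh by linarith
qed

lemma witness_L2:
  shows "witness b \<in> gauss_L2" "(\<lambda>x. (x \<bullet> c) * (witness_slope (x \<bullet> b) * k)) \<in> gauss_L2"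
    "(\<lambda>x. witness_slope (x \<bullet> b) * k) \<in> gauss_L2"
    "(\<lambda>x. - ((x \<bullet> b) * witness_slope (x \<bullet> b) ^ 3) * k) \<in> gauss_L2"
proof -
  note [measurable] = smooth_measurable[OF smooth_witness_slope[of b]]
  have slope: "exp_bounded (\<lambda>x. witness_slope (x \<bullet> b))"
    by (rule exp_boundedI[of _ 1 0]) (use witness_slope_bounds in auto)
  have "exp_bounded (witness b)"
  proof (rule exp_boundedI)
    fix x
    have "\<bar>witness b x\<bar> \<le> 2 * \<bar>x \<bullet> b / sqrt 2\<bar>"
      unfolding witness_def by (rule abs_arsinh_le)
    also have "\<dots> \<le> 2 * \<bar>x \<bullet> b\<bar>"
      by (simp add: divide_le_eq mult_left_le[of "\<bar>x \<bullet> b\<bar>"] mult_le_cancel_left1)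
    also have "\<dots> \<le> 2 * (exp (norm x) * norm b)"
      using order_trans[OF Cauchy_Schwarz_ineq2[of x b] mult_right_mono[OF norm_le_exp norm_ge_zero]] by simp
    finally show "\<bar>witness b x\<bar> \<le> (2 * norm b) * exp (1 * norm x)" by (simp add: mult_ac)
  qed
  then show "witness b \<in> gauss_L2"
    by (rule exp_bounded_L2[OF _ smooth_measurable[OF smooth_witness]])
  show "(\<lambda>x. witness_slope (x \<bullet> b) * k) \<in> gauss_L2"
    by (rule exp_bounded_L2) (intro exp_bounded_mult slope exp_bounded_const, measurable)
  show "(\<lambda>x. (x \<bullet> c) * (witness_slope (x \<bullet> b) * k)) \<in> gauss_L2"
    by (rule exp_bounded_L2) (intro exp_bounded_mult exp_bounded_inner slope exp_bounded_const, measurable)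
  have "exp_bounded (\<lambda>x. - 1 * ((x \<bullet> b) * (witness_slope (x \<bullet> b) * (witness_slope (x \<bullet> b) * witness_slope (x \<bullet> b)))) * k)"
    by (intro exp_bounded_mult exp_bounded_inner slope exp_bounded_const)
  then have "exp_bounded (\<lambda>x. - ((x \<bullet> b) * witness_slope (x \<bullet> b) ^ 3) * k)"
    by (simp add: power3_eq_cube mult.assoc)
  then show "(\<lambda>x. - ((x \<bullet> b) * witness_slope (x \<bullet> b) ^ 3) * k) \<in> gauss_L2"
    by (rule exp_bounded_L2) measurable
qed

lemma witness_has_OU:
  assumes b: "b \<in> (Basis :: 'a::euclidean_space set)"
  shows "has_ornstein_uhlenbeck (witness b) (\<lambda>x. witness_OU (x \<bullet> b))"
  unfolding has_ornstein_uhlenbeck_def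
proof (intro conjI exI[of _ "grad (witness b)"] ballI allI impI)
  show "(\<lambda>x. witness_OU (x \<bullet> b)) \<in> gauss_L2"
  proof (rule gauss_L2_bound[OF _ gauss_L2_const[of 1]])
    have [measurable]: "(\<lambda>x. witness_slope (x \<bullet> b)) \<in> borel_measurable borel"
      by (rule smooth_measurable[OF smooth_witness_slope])
    show "(\<lambda>x. witness_OU (x \<bullet> b)) \<in> borel_measurable borel"
      unfolding witness_OU_def by measurable
  qed (simp add: witness_OU_bound)
  show "has_gauss_W12_gradient (witness b) (grad (witness b))"
    by (rule smooth_gauss_W12[OF smooth_witness]) (simp_all add: partial_witness witness_L2)
  fix v :: "'a \<Rightarrow> real" and H assume H: "has_gauss_W12_gradient v H"
  have s: "(\<Sum>c\<in>Basis. partial c (partial c (witness b)) x - (x \<bullet> c) * partial c (witness b) x) = witness_OU (x \<bullet> b)" for x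
  proof -
    have "(\<Sum>c\<in>Basis. partial c (partial c (witness b)) x - (x \<bullet> c) * partial c (witness b) x)
       = (\<Sum>c\<in>Basis. if c = b then witness_OU (x \<bullet> b) else 0)"
      unfolding partial_witness partial_witness_slope
      by (rule sum.cong) (auto simp: inner_Basis b witness_OU_def)
    then show ?thesis using b by simp
  qed
  have "(\<integral>x. H x \<bullet> grad (witness b) x \<partial>gauss_measure)
     = - (\<integral>x. v x * (\<Sum>c\<in>Basis. partial c (partial c (witness b)) x - (x \<bullet> c) * partial c (witness b) x) \<partial>gauss_measure)"
    by (rule gauss_green_formula[OF smooth_witness _ _ _ H]; unfold partial_witness partial_witness_slope;
        rule witness_L2)
  then show "(\<integral>x. grad (witness b) x \<bullet> H x \<partial>gauss_measure) = - (\<integral>x. v x * witness_OU (x \<bullet> b) \<partial>gauss_measure)"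
    by (simp add: s inner_commute)
qed

lemma witness_admissible:
  assumes b: "b \<in> (Basis :: 'a::euclidean_space set)" and m: "m = mv \<or> m = med"
  shows "witness b \<in> admissible m"
proof -
  have odd: "witness b (- x) = - witness b x" for x by (simp add: witness_def)
  have "m (witness b) = 0"
    using m mv_odd[OF smooth_measurable[OF smooth_witness] odd] med_odd[OF smooth_continuous[OF smooth_witness] odd]
    by auto
  moreover have "gauss_Linf_norm (\<lambda>x. witness_OU (x \<bullet> b)) \<le> 1"
    unfolding gauss_Linf_norm_def
  proof (rule esssup_I)
    have [measurable]: "(\<lambda>x. witness_OU (x \<bullet> b)) \<in> borel_measurable borel"
      using witness_has_OU[OF b] by (auto simp: has_ornstein_uhlenbeck_def gauss_L2_measurable)
    show "(\<lambda>x. ereal \<bar>witness_OU (x \<bullet> b)\<bar>) \<in> borel_measurable gauss_measure" by measurable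
  qed (simp add: witness_OU_bound)
  moreover have "witness b \<in> gauss_W12"
    using witness_has_OU[OF b] by (auto simp: has_ornstein_uhlenbeck_def gauss_W12_def)
  ultimately show ?thesis
    using witness_has_OU[OF b] by (auto simp: admissible_def ornstein_uhlenbeck_domain_def)
qed

text \<open>For \<open>t \<ge> 0\<close>, \<open>exp (arsinh t) = t + sqrt (t\<^sup>2 + 1) \<ge> 2 t\<close>. So \<open>exp (2 \<bar>witness b x\<bar>)\<close> exceeds the
  Gaussian exponent \<open>(x \<bullet> b)\<^sup>2 / 2\<close> in the direction \<open>b\<close> by a factor of four.\<close>

lemma exp_two_abs_witness_ge: "2 * (x \<bullet> b)\<^sup>2 \<le> exp (2 * \<bar>witness b x\<bar>)"
proof -
  define t where "t = \<bar>(x \<bullet> b) / sqrt 2\<bar>"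
  have "exp \<bar>witness b x\<bar> = t + sqrt (t\<^sup>2 + 1)"
    unfolding witness_def abs_arsinh t_def[symmetric] unfolding arsinh_real_def
    by (rule exp_ln[OF arsinh_real_aux])
  moreover have "sqrt (t\<^sup>2) \<le> sqrt (t\<^sup>2 + 1)" by (rule real_sqrt_le_mono) simp
  then have "t \<le> sqrt (t\<^sup>2 + 1)" by (simp add: t_def)
  ultimately have "2 * t \<le> exp \<bar>witness b x\<bar>" by simp
  then have "(2 * t)\<^sup>2 \<le> (exp \<bar>witness b x\<bar>)\<^sup>2"
    by (rule power_mono) (simp add: t_def)
  moreover have "(2 * t)\<^sup>2 = 2 * (x \<bullet> b)\<^sup>2" by (simp add: t_def power_mult_distrib power_divide)
  ultimately show ?thesis by (simp add: exp_double)
qed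

text \<open>The integrand times the density dominates a product over the coordinates whose factor in the direction
  \<open>b\<close> is \<open>exp (3 t\<^sup>2 / 2)\<close>, of infinite integral, and whose other factors have positive integrals.\<close>

lemma witness_exp_exp_integral:
  assumes b: "b \<in> (Basis :: 'a::euclidean_space set)" and \<eta>: "\<eta> \<ge> 2"
  shows "exp_exp_integral \<eta> (witness b) = \<infinity>"
proof -
  let ?C = "(2 * pi) powr (- real DIM('a) / 2)"
  let ?f = "\<lambda>c t. if c = b then exp (3 / 2 * t\<^sup>2) else exp (- (1 / 2) * t\<^sup>2 :: real)"
  have le: "ennreal ?C * (\<Prod>c\<in>Basis. ennreal (?f c (x \<bullet> c))) \<le> ennreal (gauss_density x) * ennreal (exp (exp (\<eta> * \<bar>witness b x\<bar>)))" for x :: 'a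
  proof -
    have "(\<Prod>c\<in>Basis. ?f c (x \<bullet> c)) = exp (2 * (x \<bullet> b)\<^sup>2) * exp (- (1/2) * (norm x)\<^sup>2)"
      unfolding exp_neg_norm_sq_prod
      by (subst (1 2) prod.remove[OF _ b]) (auto simp: mult_exp_exp mult.assoc[symmetric] intro!: arg_cong2[where f = "(*)"] prod.cong)
    also have "exp (2 * (x \<bullet> b)\<^sup>2) \<le> exp (exp (\<eta> * \<bar>witness b x\<bar>))"
    proof -
      have "2 * (x \<bullet> b)\<^sup>2 \<le> exp (2 * \<bar>witness b x\<bar>)" by (rule exp_two_abs_witness_ge)
      also have "\<dots> \<le> exp (\<eta> * \<bar>witness b x\<bar>)" using \<eta> by (simp add: mult_right_mono)
      finally show ?thesis by simp
    qed
    finally have "?C * (\<Prod>c\<in>Basis. ?f c (x \<bullet> c)) \<le> ?C * (exp (exp (\<eta> * \<bar>witness b x\<bar>)) * exp (- (1/2) * (norm x)\<^sup>2))"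
      by (intro mult_left_mono) auto
    then show ?thesis
      by (simp add: prod_ennreal ennreal_mult[symmetric] prod_nonneg gauss_density_def mult_ac)
  qed
  have "(\<Prod>c\<in>Basis. \<integral>\<^sup>+t. ennreal (?f c t) \<partial>lborel) = \<infinity>"
  proof -
    have "(\<integral>\<^sup>+t. ennreal (?f b t) \<partial>lborel) \<ge> (\<integral>\<^sup>+t. 1 \<partial>(lborel :: real measure))"
      by (intro nn_integral_mono) simp
    then have t: "(\<integral>\<^sup>+t. ennreal (?f b t) \<partial>lborel) = top"
      by (simp add: top_unique)
    have "(\<integral>\<^sup>+t. ennreal (?f c t) \<partial>lborel) = ennreal (sqrt (pi / (1/2)))" if "c \<in> Basis - {b}" for c
      using that nn_integral_exp_neg_sq[of "1/2"] by simp
    then have "(\<Prod>c\<in>Basis - {b}. \<integral>\<^sup>+t. ennreal (?f c t) \<partial>lborel) = (\<Prod>c\<in>Basis - {b}. ennreal (sqrt (pi / (1/2))))"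
      by (rule prod.cong[OF refl])
    also have "\<dots> \<noteq> 0" using pi_gt_zero by (simp add: ennreal_eq_0_iff not_le)
    finally show ?thesis
      by (subst prod.remove[OF _ b]) (auto simp only: t ennreal_top_mult finite_Basis split: if_splits, simp)
  qed
  then have "\<infinity> = ennreal ?C * (\<Prod>c\<in>Basis. \<integral>\<^sup>+t. ennreal (?f c t) \<partial>lborel)"
    by (simp add: ennreal_mult_top)
  also have "\<dots> = ennreal ?C * (\<integral>\<^sup>+x. (\<Prod>c\<in>Basis. ennreal (?f c (x \<bullet> c))) \<partial>(lborel :: 'a measure))"
    by (subst nn_integral_lborel_prod) auto
  also have "\<dots> = (\<integral>\<^sup>+x. ennreal ?C * (\<Prod>c\<in>Basis. ennreal (?f c (x \<bullet> c))) \<partial>(lborel :: 'a measure))"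
    by (rule nn_integral_cmult[symmetric]) auto
  also have "\<dots> \<le> (\<integral>\<^sup>+x. ennreal (gauss_density x) * ennreal (exp (exp (\<eta> * \<bar>witness b x\<bar>))) \<partial>lborel)"
    by (intro nn_integral_mono le)
  also have "\<dots> = exp_exp_integral \<eta> (witness b)"
    unfolding exp_exp_integral_def using smooth_measurable[OF smooth_witness[of b]]
    by (subst nn_integral_gauss) auto
  finally show ?thesis by (simp add: top_unique)
qed

section \<open>The Mehler kernel\<close>

text \<open>Differentiation under the integral sign, by the mean value inequality and dominated convergence.\<close>

lemma has_real_derivative_integral_dominated:
  fixes f f' :: "real \<Rightarrow> 'b \<Rightarrow> real"
  assumes S: "open S" "convex S" "r \<in> S"
    and f: "\<And>t. t \<in> S \<Longrightarrow> integrable M (f t)"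
    and d: "\<And>t y. t \<in> S \<Longrightarrow> ((\<lambda>t. f t y) has_real_derivative f' t y) (at t)"
    and bound: "\<And>t y. t \<in> S \<Longrightarrow> \<bar>f' t y\<bar> \<le> W y"
    and W: "integrable M W" and [measurable]: "f' r \<in> borel_measurable M"
  shows "((\<lambda>t. \<integral>y. f t y \<partial>M) has_real_derivative (\<integral>y. f' r y \<partial>M)) (at r)"
proof -
  have "((\<lambda>t. ((\<integral>y. f t y \<partial>M) - (\<integral>y. f r y \<partial>M)) / (t - r)) \<longlongrightarrow> (\<integral>y. f' r y \<partial>M)) (at r within S)"
    unfolding tendsto_at_iff_sequentially comp_def
  proof (intro allI impI)
    fix X assume X: "\<forall>i. X i \<in> S - {r}" and lim: "X \<longlonglongrightarrow> r"
    have [measurable]: "f (X i) \<in> borel_measurable M" "f r \<in> borel_measurable M" for i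
      using f[of "X i"] f[of r] X S by (auto intro: borel_measurable_integrable)
    have "(\<lambda>i. \<integral>y. (f (X i) y - f r y) / (X i - r) \<partial>M) \<longlonglongrightarrow> (\<integral>y. f' r y \<partial>M)"
    proof (rule integral_dominated_convergence[OF _ _ W])
      show "AE y in M. (\<lambda>i. (f (X i) y - f r y) / (X i - r)) \<longlonglongrightarrow> f' r y"
      proof (rule AE_I2)
        fix y
        have "((\<lambda>t. (f t y - f r y) / (t - r)) \<longlongrightarrow> f' r y) (at r)"
          using d[OF S(3)] by (simp add: has_field_derivative_iff)
        moreover have "filterlim X (at r) sequentially"
          using X lim by (intro filterlim_atI) auto
        ultimately show "(\<lambda>i. (f (X i) y - f r y) / (X i - r)) \<longlonglongrightarrow> f' r y"
          by (rule filterlim_compose)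
      qed
      fix i
      show "AE y in M. norm ((f (X i) y - f r y) / (X i - r)) \<le> W y"
      proof (rule AE_I2)
        fix y
        have "norm (f (X i) y - f r y) \<le> W y * norm (X i - r)"
          by (rule field_differentiable_bound[OF S(2), where f' = "\<lambda>t. f' t y"])
             (use X S d bound in \<open>auto intro: has_field_derivative_at_within\<close>)
        moreover have "norm (X i - r) > 0" using X by auto
        ultimately show "norm ((f (X i) y - f r y) / (X i - r)) \<le> W y"
          by (simp add: norm_divide divide_le_eq del: zero_less_norm_iff)
      qed
    qed measurable
    moreover have "(\<integral>y. (f (X i) y - f r y) / (X i - r) \<partial>M) = ((\<integral>y. f (X i) y \<partial>M) - (\<integral>y. f r y \<partial>M)) / (X i - r)" for i
      using f X S by (subst Bochner_Integration.integral_divide_zero) (auto simp: Bochner_Integration.integral_diff)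
    ultimately show "(\<lambda>i. ((\<integral>y. f (X i) y \<partial>M) - (\<integral>y. f r y \<partial>M)) / (X i - r)) \<longlonglongrightarrow> (\<integral>y. f' r y \<partial>M)"
      by (simp only:)
  qed
  then show ?thesis
    unfolding has_field_derivative_iff at_within_open[OF S(3,1)] .
qed

text \<open>The density with respect to the Gauss measure of the Ornstein-Uhlenbeck transition kernel at time \<open>t\<close>,
  written in the parameter \<open>r = exp (-t)\<close>. In this parameter the equilibrium \<open>t = \<infinity>\<close> is the interior
  point \<open>r = 0\<close>, where the kernel is constantly 1, and the kernel is smooth in \<open>r\<close> on \<open>(-1, 1)\<close>.\<close>

definition mehler :: "real \<Rightarrow> 'a::euclidean_space \<Rightarrow> 'a \<Rightarrow> real" where
  "mehler r z y = (1 - r\<^sup>2) powr (- real DIM('a) / 2)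
     * exp ((2 * r * (z \<bullet> y) - r\<^sup>2 * (z \<bullet> z) - r\<^sup>2 * (y \<bullet> y)) / (2 * (1 - r\<^sup>2)))"

lemma mehler_commute: "mehler r z y = mehler r y z"
  by (simp add: mehler_def inner_commute algebra_simps)

lemma mehler_nonneg: "0 \<le> mehler r z y"
  by (simp add: mehler_def)

lemma mehler_0: "mehler 0 z y = 1"
  by (simp add: mehler_def)

lemma one_minus_sq_pos: "\<bar>r\<bar> < 1 \<Longrightarrow> 1 - r\<^sup>2 > (0::real)"
  by (simp add: abs_square_less_1)

lemma mehler_measurable_pair:
  "(\<lambda>(z, y). mehler r z y) \<in> borel_measurable (borel \<Otimes>\<^sub>M borel)"
  unfolding mehler_def by measurable

lemma mehler_measurable[measurable]: "mehler r z \<in> borel_measurable borel"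
  unfolding mehler_def[abs_def] by measurable

text \<open>The gradient in \<open>y\<close> of the logarithm of the kernel.\<close>

definition mehler_score :: "real \<Rightarrow> 'a::euclidean_space \<Rightarrow> 'a \<Rightarrow> 'a" where
  "mehler_score r z y = (r / (1 - r\<^sup>2)) *\<^sub>R z - (r\<^sup>2 / (1 - r\<^sup>2)) *\<^sub>R y"

lemma mehler_exponent_split:
  fixes s :: real
  assumes "s > 0"
  shows "(2 * r * (z \<bullet> y) - p - q * k) / (2 * s) = - p / (2 * s) + ((r / s) * (y \<bullet> z) + (- q / (2 * s)) * k)"
  using assms by (simp add: inner_commute field_simps)

lemma mehler_has_derivative:
  fixes z y :: "'a::euclidean_space"
  assumes r: "\<bar>r\<bar> < 1"
  shows "(mehler r z has_derivative (\<lambda>h. mehler r z y * (mehler_score r z y \<bullet> h))) (at y)"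
proof -
  let ?s = "1 - r\<^sup>2"
  let ?q = "\<lambda>y. - (r\<^sup>2 * (z \<bullet> z)) / (2 * ?s) + ((r / ?s) * (y \<bullet> z) + (- (r\<^sup>2) / (2 * ?s)) * (y \<bullet> y))"
  have s: "?s > 0" by (rule one_minus_sq_pos[OF r])
  have q: "(2 * r * (z \<bullet> y) - r\<^sup>2 * (z \<bullet> z) - r\<^sup>2 * (y \<bullet> y)) / (2 * ?s) = ?q y" for y
    by (rule mehler_exponent_split[OF s])
  have "(?q has_derivative (\<lambda>h. 0 + ((r / ?s) * (h \<bullet> z) + (- (r\<^sup>2) / (2 * ?s)) * (2 * (y \<bullet> h))))) (at y)"
    by (intro has_derivative_add has_derivative_const has_derivative_mult_right
        has_derivative_inner_left has_derivative_ident has_derivative_inner_self)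
  moreover have "0 + ((r / ?s) * (h \<bullet> z) + (- (r\<^sup>2) / (2 * ?s)) * (2 * (y \<bullet> h))) = mehler_score r z y \<bullet> h" for h
  proof -
    have "(- q / (2 * s)) * (2 * w) = - (q / s) * w" for q s w :: real
      by simp
    from this[of "r\<^sup>2" ?s "y \<bullet> h"] show ?thesis
      unfolding mehler_score_def inner_diff_left inner_scaleR_left by (simp only: inner_commute[of h z])
  qed
  ultimately have "(?q has_derivative (\<lambda>h. mehler_score r z y \<bullet> h)) (at y)" by simp
  from has_derivative_compose[OF this DERIV_exp[unfolded has_field_derivative_def]]
  have "((\<lambda>y. exp (?q y)) has_derivative (\<lambda>h. exp (?q y) * (mehler_score r z y \<bullet> h))) (at y)" .
  from has_derivative_mult_right[OF this, of "?s powr (- real DIM('a) / 2)"]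
  show ?thesis
    unfolding mehler_def[abs_def] q by (simp add: mult.assoc)
qed

lemma smooth_mehler:
  fixes z :: "'a::euclidean_space"
  assumes r: "\<bar>r\<bar> < 1"
  shows "smooth (mehler r z)"
proof -
  let ?s = "1 - r\<^sup>2"
  let ?q = "\<lambda>y. - (r\<^sup>2 * (z \<bullet> z)) / (2 * ?s) + ((r / ?s) * (y \<bullet> z) + (- (r\<^sup>2) / (2 * ?s)) * (y \<bullet> y))"
  have s: "?s > 0" by (rule one_minus_sq_pos[OF r])
  have q: "(2 * r * (z \<bullet> y) - r\<^sup>2 * (z \<bullet> z) - r\<^sup>2 * (y \<bullet> y)) / (2 * ?s) = ?q y" for y
    by (rule mehler_exponent_split[OF s])
  show ?thesis
    unfolding mehler_def[abs_def] q
    by (intro smooth_mult smooth_const smooth_exp smooth_add smooth_inner smooth_inner_self)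
qed

lemma partial_mehler:
  assumes "\<bar>r\<bar> < 1"
  shows "partial b (mehler r z) y = mehler r z y * (mehler_score r z y \<bullet> b)"
  by (rule partial_eqI[OF mehler_has_derivative[OF assms]])

lemma partial_partial_mehler:
  assumes r: "\<bar>r\<bar> < 1"
  shows "partial b (\<lambda>y. mehler r z y * (mehler_score r z y \<bullet> b)) y
    = mehler r z y * ((mehler_score r z y \<bullet> b)\<^sup>2 - r\<^sup>2 / (1 - r\<^sup>2) * (b \<bullet> b))"
proof -
  have "((\<lambda>y. mehler_score r z y \<bullet> b) has_derivative (\<lambda>h. (0 - (r\<^sup>2 / (1 - r\<^sup>2)) *\<^sub>R h) \<bullet> b)) (at y)"
    unfolding mehler_score_def
    by (intro has_derivative_inner_left has_derivative_diff has_derivative_const has_derivative_scaleR_right has_derivative_ident)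
  from partial_eqI[OF has_derivative_mult[OF mehler_has_derivative[OF r] this]]
  show ?thesis by (simp add: power2_eq_square algebra_simps)
qed

lemma mehler_le:
  fixes z y :: "'a::euclidean_space"
  assumes r: "\<bar>r\<bar> \<le> R" "R < 1"
  shows "mehler r z y \<le> (1 - R\<^sup>2) powr (- real DIM('a) / 2) * exp (norm z / (1 - R\<^sup>2) * norm y)"
proof -
  have R: "1 - R\<^sup>2 > 0" "1 - R\<^sup>2 \<le> 1 - r\<^sup>2"
    using r one_minus_sq_pos[of R] by (auto intro!: power2_le_iff_abs_le[THEN iffD2])
  have "2 * r * (z \<bullet> y) \<le> 2 * (norm z * norm y)"
  proof -
    have "r * (z \<bullet> y) \<le> \<bar>r\<bar> * \<bar>z \<bullet> y\<bar>" by (simp flip: abs_mult)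
    also have "\<dots> \<le> 1 * (norm z * norm y)" using r by (intro mult_mono Cauchy_Schwarz_ineq2) auto
    finally show ?thesis by simp
  qed
  moreover have "0 \<le> r\<^sup>2 * (z \<bullet> z)" "0 \<le> r\<^sup>2 * (y \<bullet> y)" by auto
  ultimately have "2 * r * (z \<bullet> y) - r\<^sup>2 * (z \<bullet> z) - r\<^sup>2 * (y \<bullet> y) \<le> 2 * (norm z * norm y)" by linarith
  then have "(2 * r * (z \<bullet> y) - r\<^sup>2 * (z \<bullet> z) - r\<^sup>2 * (y \<bullet> y)) / (2 * (1 - r\<^sup>2)) \<le> (2 * (norm z * norm y)) / (2 * (1 - R\<^sup>2))"
    using R by (intro frac_le) auto
  also have "\<dots> = norm z / (1 - R\<^sup>2) * norm y"
    by (subst mult_divide_mult_cancel_left) auto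
  finally show ?thesis
    unfolding mehler_def using R by (intro mult_mono powr_mono2') auto
qed

lemma exp_bounded_mehler:
  assumes "\<bar>r\<bar> < 1" shows "exp_bounded (mehler r z)"
proof (rule exp_boundedI)
  fix y
  show "\<bar>mehler r z y\<bar> \<le> (1 - \<bar>r\<bar>\<^sup>2) powr (- real DIM('a) / 2) * exp (norm z / (1 - \<bar>r\<bar>\<^sup>2) * norm (y::'a))"
    using mehler_le[OF order_refl assms] unfolding abs_of_nonneg[OF mehler_nonneg] .
qed

lemma exp_bounded_mehler_score: "exp_bounded (\<lambda>y. mehler_score r z y \<bullet> b)"
proof -
  have "exp_bounded (\<lambda>y. (r / (1 - r\<^sup>2)) * (z \<bullet> b) + (- (r\<^sup>2 / (1 - r\<^sup>2))) * (y \<bullet> b))"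
    by (intro exp_bounded_add exp_bounded_mult exp_bounded_const exp_bounded_inner)
  then show ?thesis by (simp add: mehler_score_def inner_diff_left)
qed

lemma mehler_score_measurable[measurable]: "mehler_score r z \<in> borel_measurable borel"
  unfolding mehler_score_def[abs_def] by measurable

lemma mehler_L2:
  fixes z b :: "'a::euclidean_space"
  assumes r: "\<bar>r\<bar> < 1"
  shows "mehler r z \<in> gauss_L2" "(\<lambda>y. mehler r z y * (mehler_score r z y \<bullet> b)) \<in> gauss_L2"
    "(\<lambda>y. mehler r z y * ((mehler_score r z y \<bullet> b)\<^sup>2 - c)) \<in> gauss_L2"
    "(\<lambda>y. (y \<bullet> b) * (mehler r z y * (mehler_score r z y \<bullet> b))) \<in> gauss_L2"
proof -
  note K = exp_bounded_mehler[OF r, of z] and c = exp_bounded_mehler_score[of r z b]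
  have [measurable]: "(\<lambda>y. mehler_score r z y \<bullet> b) \<in> borel_measurable borel"
    by (intro borel_measurable_inner mehler_score_measurable borel_measurable_const)
  have [measurable]: "(\<lambda>y. y \<bullet> b) \<in> borel_measurable borel"
    by (intro borel_measurable_inner measurable_ident_sets borel_measurable_const) simp
  have Kc: "exp_bounded (\<lambda>y. mehler r z y * (mehler_score r z y \<bullet> b))"
    by (rule exp_bounded_mult[OF K c])
  have c2: "exp_bounded (\<lambda>y. (mehler_score r z y \<bullet> b)\<^sup>2 - c)"
    using exp_bounded_add[OF exp_bounded_mult[OF c c] exp_bounded_const[of "- c"]]
    by (simp add: power2_eq_square)
  show "mehler r z \<in> gauss_L2"
    by (rule exp_bounded_L2[OF K mehler_measurable])
  show "(\<lambda>y. mehler r z y * (mehler_score r z y \<bullet> b)) \<in> gauss_L2"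
    by (rule exp_bounded_L2[OF Kc]) (intro borel_measurable_times mehler_measurable, measurable)
  show "(\<lambda>y. mehler r z y * ((mehler_score r z y \<bullet> b)\<^sup>2 - c)) \<in> gauss_L2"
    by (rule exp_bounded_L2[OF exp_bounded_mult[OF K c2]]) (intro borel_measurable_times mehler_measurable, measurable)
  show "(\<lambda>y. (y \<bullet> b) * (mehler r z y * (mehler_score r z y \<bullet> b))) \<in> gauss_L2"
    by (rule exp_bounded_L2[OF exp_bounded_mult[OF exp_bounded_inner Kc]]) (intro borel_measurable_times mehler_measurable, measurable)
qed

lemma mehler_W12:
  assumes "\<bar>r\<bar> < 1"
  shows "has_gauss_W12_gradient (mehler r z) (grad (mehler r z))"
  by (rule smooth_gauss_W12[OF smooth_mehler[OF assms] mehler_L2(1)[OF assms]])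
     (simp only: partial_mehler[OF assms] mehler_L2(2)[OF assms])

text \<open>The derivative in \<open>r\<close> of the logarithm of the kernel, written in terms of \<open>y - r z\<close>, the deviation
  of \<open>y\<close> from the mean of the transition probability.\<close>

definition mehler_rate :: "real \<Rightarrow> 'a::euclidean_space \<Rightarrow> 'a \<Rightarrow> real" where
  "mehler_rate r z y = real DIM('a) * r / (1 - r\<^sup>2) + (z \<bullet> (y - r *\<^sub>R z)) / (1 - r\<^sup>2)
     - r * (norm (y - r *\<^sub>R z))\<^sup>2 / (1 - r\<^sup>2)\<^sup>2"

lemma norm_diff_scaled_square: "(norm (y - r *\<^sub>R z))\<^sup>2 = y \<bullet> y - 2 * r * (z \<bullet> y) + r\<^sup>2 * (z \<bullet> z)"
  unfolding power2_norm_eq_inner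
  by (simp add: inner_diff_left inner_diff_right inner_commute power2_eq_square algebra_simps)

lemma mehler_rate_measurable[measurable]: "mehler_rate r z \<in> borel_measurable borel"
  unfolding mehler_rate_def[abs_def] by measurable

lemma mehler_derivative_param:
  fixes z y :: "'a::euclidean_space"
  assumes r: "\<bar>r\<bar> < 1"
  shows "((\<lambda>r. mehler r z y) has_real_derivative mehler r z y * mehler_rate r z y) (at r)"
proof -
  let ?n = "real DIM('a)"
  let ?W = "z \<bullet> y" and ?Z = "z \<bullet> z" and ?Y = "y \<bullet> y"
  define s where "s = 1 - r\<^sup>2"
  have s: "s > 0" unfolding s_def by (rule one_minus_sq_pos[OF r])
  let ?N = "2 * r * ?W - r\<^sup>2 * ?Z - r\<^sup>2 * ?Y"
  have ds: "((\<lambda>r::real. 1 - r\<^sup>2) has_real_derivative - (2 * r)) (at r)"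
    by (auto intro!: derivative_eq_intros)
  have "((\<lambda>r. (1 - r\<^sup>2) powr (- ?n / 2)) has_real_derivative ((- ?n / 2) * s powr (- ?n / 2 - 1)) * - (2 * r)) (at r)"
    unfolding s_def
    by (rule DERIV_chain2[where f = "\<lambda>u. u powr (- ?n / 2)" and g = "\<lambda>r. 1 - r\<^sup>2"])
       (rule has_real_derivative_powr[OF s[unfolded s_def]] ds)+
  moreover have "((- ?n / 2) * s powr (- ?n / 2 - 1)) * - (2 * r) = s powr (- ?n / 2) * (?n * r / s)"
  proof -
    have "s powr (- ?n / 2 - 1) = s powr (- ?n / 2) / s" using s by (subst powr_diff) simp
    then show ?thesis by simp
  qed
  ultimately have dA: "((\<lambda>r. (1 - r\<^sup>2) powr (- ?n / 2)) has_real_derivative s powr (- ?n / 2) * (?n * r / s)) (at r)"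
    by (simp only:)
  have dN: "((\<lambda>r. 2 * r * ?W - r\<^sup>2 * ?Z - r\<^sup>2 * ?Y) has_real_derivative (2 * ?W - 2 * r * ?Z - 2 * r * ?Y)) (at r)"
    by (auto intro!: derivative_eq_intros)
  have d2: "((\<lambda>r::real. 2 * (1 - r\<^sup>2)) has_real_derivative 2 * - (2 * r)) (at r)"
    by (rule DERIV_cmult[OF ds])
  have dq: "((\<lambda>r. (2 * r * ?W - r\<^sup>2 * ?Z - r\<^sup>2 * ?Y) / (2 * (1 - r\<^sup>2))) has_real_derivative
     ((2 * ?W - 2 * r * ?Z - 2 * r * ?Y) * (2 * s) - ?N * (2 * - (2 * r))) / ((2 * s) * (2 * s))) (at r)"
    using DERIV_divide[OF dN d2] s by (simp add: s_def[symmetric])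
  have "((\<lambda>r. exp ((2 * r * ?W - r\<^sup>2 * ?Z - r\<^sup>2 * ?Y) / (2 * (1 - r\<^sup>2)))) has_real_derivative
     exp (?N / (2 * s)) * (((2 * ?W - 2 * r * ?Z - 2 * r * ?Y) * (2 * s) - ?N * (2 * - (2 * r))) / ((2 * s) * (2 * s)))) (at r)"
    using DERIV_chain2[OF DERIV_exp dq] by (simp only: s_def[symmetric])
  from DERIV_mult[OF dA this]
  have "((\<lambda>r. mehler r z y) has_real_derivative
     mehler r z y * (?n * r / s + ((2 * ?W - 2 * r * ?Z - 2 * r * ?Y) * (2 * s) - ?N * (2 * - (2 * r))) / ((2 * s) * (2 * s)))) (at r)"
    unfolding mehler_def s_def[symmetric] by (simp only: distrib_left mult_ac)
  moreover have "((2 * ?W - 2 * r * ?Z - 2 * r * ?Y) * (2 * s) - ?N * (2 * - (2 * r))) / ((2 * s) * (2 * s))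
     = (?W - r * ?Z) / s - r * (?Y - 2 * r * ?W + r\<^sup>2 * ?Z) / s\<^sup>2"
  proof -
    have "(2 * ?W - 2 * r * ?Z - 2 * r * ?Y) * (2 * s) - ?N * (2 * - (2 * r))
        = 4 * ((?W - r * ?Z) * s - r * (?Y * s + r\<^sup>2 * ?Y - 2 * r * ?W + r\<^sup>2 * ?Z))"
      by (simp add: algebra_simps power2_eq_square)
    also have "?Y * s + r\<^sup>2 * ?Y = ?Y" by (simp add: s_def algebra_simps)
    finally show ?thesis using s by (simp add: diff_divide_distrib power2_eq_square)
  qed
  ultimately show ?thesis
    unfolding mehler_rate_def norm_diff_scaled_square s_def[symmetric]
    by (simp add: inner_diff_right add_diff_eq)
qed

text \<open>The Kolmogorov equation: the Ornstein-Uhlenbeck operator in \<open>y\<close>, applied to the kernel, is the time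
  derivative \<open>\<partial>\<^sub>t = - r \<partial>\<^sub>r\<close>.\<close>

lemma mehler_heat_equation:
  fixes z y :: "'a::euclidean_space"
  assumes r: "\<bar>r\<bar> < 1"
  shows "(\<Sum>b\<in>Basis. mehler r z y * ((mehler_score r z y \<bullet> b)\<^sup>2 - r\<^sup>2 / (1 - r\<^sup>2) * (b \<bullet> b))
      - (y \<bullet> b) * (mehler r z y * (mehler_score r z y \<bullet> b)))
    = - (r * (mehler r z y * mehler_rate r z y))" (is "?L = _")
proof -
  let ?W = "z \<bullet> y" and ?Z = "z \<bullet> z" and ?Y = "y \<bullet> y"
  define s where "s = 1 - r\<^sup>2"
  have s: "s > 0" unfolding s_def by (rule one_minus_sq_pos[OF r])
  let ?c = "mehler_score r z y"
  have "?L = mehler r z y * (\<Sum>b\<in>Basis. (?c \<bullet> b)\<^sup>2 - r\<^sup>2 / s - (y \<bullet> b) * (?c \<bullet> b))"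
    unfolding sum_distrib_left s_def by (rule sum.cong) (auto simp: algebra_simps inner_Basis)
  also have "(\<Sum>b\<in>Basis. (?c \<bullet> b)\<^sup>2 - r\<^sup>2 / s - (y \<bullet> b) * (?c \<bullet> b)) = ?c \<bullet> ?c - real DIM('a) * (r\<^sup>2 / s) - y \<bullet> ?c"
    by (subst (1 2) euclidean_inner) (simp add: sum_subtractf power2_eq_square)
  also have "\<dots> = - (r * mehler_rate r z y)"
  proof -
    have "?c \<bullet> ?c = (r\<^sup>2 * ?Z - 2 * r ^ 3 * ?W + r ^ 4 * ?Y) / s\<^sup>2"
      unfolding mehler_score_def s_def[symmetric] using s
      by (simp add: inner_diff_left inner_diff_right inner_commute field_simps power2_eq_square power3_eq_cube power4_eq_xxxx)
    moreover have "y \<bullet> ?c = (r * ?W - r\<^sup>2 * ?Y) / s"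
      unfolding mehler_score_def s_def[symmetric]
      by (simp add: inner_diff_right inner_commute diff_divide_distrib)
    moreover have "(r\<^sup>2 * ?Z - 2 * r ^ 3 * ?W + r ^ 4 * ?Y) / s\<^sup>2 - (r * ?W - r\<^sup>2 * ?Y) / s
       = - (r * ((?W - r * ?Z) / s - r * (?Y - 2 * r * ?W + r\<^sup>2 * ?Z) / s\<^sup>2))"
    proof -
      have "(r\<^sup>2 * ?Z - 2 * r ^ 3 * ?W + r ^ 4 * ?Y) - (r * ?W - r\<^sup>2 * ?Y) * s
         = - (r * ((?W - r * ?Z) * s - r * (?Y - 2 * r * ?W + r\<^sup>2 * ?Z)))"
        unfolding s_def by (simp add: algebra_simps power2_eq_square power3_eq_cube power4_eq_xxxx)
      then have "((r\<^sup>2 * ?Z - 2 * r ^ 3 * ?W + r ^ 4 * ?Y) - (r * ?W - r\<^sup>2 * ?Y) * s) / s\<^sup>2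
         = - (r * ((?W - r * ?Z) * s - r * (?Y - 2 * r * ?W + r\<^sup>2 * ?Z))) / s\<^sup>2"
        by simp
      then show ?thesis
        using s by (simp add: diff_divide_distrib power2_eq_square right_diff_distrib)
    qed
    ultimately show ?thesis
      unfolding mehler_rate_def norm_diff_scaled_square s_def[symmetric]
      by (simp add: inner_diff_right power2_eq_square algebra_simps)
  qed
  finally show ?thesis by simp
qed

lemma abs_add_diff_le: "\<bar>a + b - c\<bar> \<le> \<bar>a\<bar> + \<bar>b\<bar> + \<bar>c\<bar>" for a b c :: real
  by linarith

section \<open>The Ornstein-Uhlenbeck flow\<close>

text \<open>Locally uniformly in \<open>r\<close>, the \<open>r\<close>-derivative of the kernel grows at most exponentially in \<open>y\<close>. This is
  the domination needed to differentiate integrals of the kernel against functions in \<open>gauss_L2\<close>.\<close>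

lemma mehler_times_rate_le:
  fixes z :: "'a::euclidean_space"
  assumes R: "0 \<le> R" "R < 1"
  shows "\<exists>K k. \<forall>r y. \<bar>r\<bar> \<le> R \<longrightarrow> \<bar>mehler r z y * mehler_rate r z y\<bar> \<le> K * exp (k * norm y)"
proof -
  let ?S = "1 - R\<^sup>2" and ?n = "real DIM('a)"
  let ?A = "?S powr (- ?n / 2)" and ?a = "norm z / ?S"
  let ?B = "?n / ?S + norm z * (1 + norm z) / ?S + (1 + norm z)\<^sup>2 / ?S\<^sup>2"
  have S: "?S > 0" using one_minus_sq_pos[of R] R by simp
  have "\<bar>mehler r z y * mehler_rate r z y\<bar> \<le> (?A * ?B) * exp ((?a + 2) * norm y)" if r: "\<bar>r\<bar> \<le> R" for r y
  proof -
    define s where "s = 1 - r\<^sup>2"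
    have s: "?S \<le> s" unfolding s_def using r R by (auto intro!: power2_le_iff_abs_le[THEN iffD2])
    then have s0: "s > 0" using S by linarith
    let ?e = "exp (norm y)"
    have e: "1 \<le> ?e" by simp
    have r1: "\<bar>r\<bar> \<le> 1" using r R by simp
    have d: "norm (y - r *\<^sub>R z) \<le> (1 + norm z) * ?e"
    proof -
      have "norm (y - r *\<^sub>R z) \<le> norm y + \<bar>r\<bar> * norm z"
        using norm_triangle_ineq4[of y "r *\<^sub>R z"] by simp
      also have "\<dots> \<le> ?e + 1 * norm z"
        using r1 by (intro add_mono norm_le_exp mult_right_mono) auto
      also have "\<dots> \<le> ?e + ?e * norm z"
        using e by (intro add_left_mono mult_right_mono) auto
      finally show ?thesis by (simp add: algebra_simps)
    qed
    have "\<bar>mehler_rate r z y\<bar> \<le> \<bar>?n * r / s\<bar> + \<bar>(z \<bullet> (y - r *\<^sub>R z)) / s\<bar> + \<bar>r * (norm (y - r *\<^sub>R z))\<^sup>2 / s\<^sup>2\<bar>"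
      unfolding mehler_rate_def s_def[symmetric] by (rule abs_add_diff_le)
    also have "\<dots> \<le> ?n / ?S * ?e\<^sup>2 + norm z * (1 + norm z) / ?S * ?e\<^sup>2 + (1 + norm z)\<^sup>2 / ?S\<^sup>2 * ?e\<^sup>2"
    proof (intro add_mono)
      have e2: "1 \<le> ?e\<^sup>2" "?e \<le> ?e\<^sup>2" using one_le_power[OF e, of 2] self_le_power[OF e, of 2] by simp_all
      have "\<bar>?n * r / s\<bar> = ?n * \<bar>r\<bar> / s" using s0 by (simp add: abs_mult)
      also have "\<dots> \<le> ?n * 1 / ?S"
        using r1 s S by (intro frac_le mult_left_mono) auto
      also have "\<dots> \<le> ?n / ?S * ?e\<^sup>2"
        using mult_left_mono[OF e2(1), of "?n / ?S"] S by simp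
      finally show "\<bar>?n * r / s\<bar> \<le> ?n / ?S * ?e\<^sup>2" .
      have "\<bar>(z \<bullet> (y - r *\<^sub>R z)) / s\<bar> = \<bar>z \<bullet> (y - r *\<^sub>R z)\<bar> / s" using s0 by simp
      also have "\<dots> \<le> (norm z * ((1 + norm z) * ?e)) / ?S"
        using s S d by (intro frac_le order_trans[OF Cauchy_Schwarz_ineq2] mult_left_mono) auto
      also have "\<dots> = norm z * (1 + norm z) / ?S * ?e" by simp
      also have "\<dots> \<le> norm z * (1 + norm z) / ?S * ?e\<^sup>2"
        using S by (intro mult_left_mono e2) auto
      finally show "\<bar>(z \<bullet> (y - r *\<^sub>R z)) / s\<bar> \<le> norm z * (1 + norm z) / ?S * ?e\<^sup>2" .
      have "\<bar>r * (norm (y - r *\<^sub>R z))\<^sup>2 / s\<^sup>2\<bar> = \<bar>r\<bar> * (norm (y - r *\<^sub>R z))\<^sup>2 / s\<^sup>2"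
        by (simp add: abs_mult)
      also have "\<dots> \<le> (1 * ((1 + norm z) * ?e)\<^sup>2) / ?S\<^sup>2"
        using r1 s S d by (intro frac_le mult_mono power_mono) auto
      finally show "\<bar>r * (norm (y - r *\<^sub>R z))\<^sup>2 / s\<^sup>2\<bar> \<le> (1 + norm z)\<^sup>2 / ?S\<^sup>2 * ?e\<^sup>2"
        by (simp add: power_mult_distrib)
    qed
    also have "\<dots> = ?B * ?e\<^sup>2" by (simp only: distrib_right)
    also have "?e\<^sup>2 = exp (2 * norm y)" by (rule exp_double[symmetric])
    finally have rate: "\<bar>mehler_rate r z y\<bar> \<le> ?B * exp (2 * norm y)" .
    have "\<bar>mehler r z y * mehler_rate r z y\<bar> = mehler r z y * \<bar>mehler_rate r z y\<bar>"
      by (simp add: abs_mult mehler_nonneg)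
    also have "\<dots> \<le> (?A * exp (?a * norm y)) * (?B * exp (2 * norm y))"
      using rate by (intro mult_mono mehler_le[OF r R(2)]) auto
    also have "\<dots> = (?A * ?B) * exp ((?a + 2) * norm y)"
      by (simp only: distrib_right[of ?a 2 "norm y"] exp_add) (simp only: mult_ac)
    finally show ?thesis .
  qed
  then show ?thesis by blast
qed

lemma mehler_flow_derivative:
  fixes z :: "'a::euclidean_space"
  assumes w: "w \<in> gauss_L2" and r: "\<bar>r\<bar> < 1"
  shows "((\<lambda>r. \<integral>y. w y * mehler r z y \<partial>gauss_measure) has_real_derivative
    (\<integral>y. w y * (mehler r z y * mehler_rate r z y) \<partial>gauss_measure)) (at r)"
proof -
  \<comment> \<open>Any radius strictly between \<open>\<bar>r\<bar>\<close> and 1 gives a neighbourhood of \<open>r\<close> with uniform domination.\<close>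
  define R where "R = (1 + \<bar>r\<bar>) / 2"
  have R: "0 \<le> R" "R < 1" "\<bar>r\<bar> < R" using r by (auto simp: R_def)
  note [measurable] = gauss_L2_measurable[OF w]
  obtain K k where K: "\<And>r y. \<bar>r\<bar> \<le> R \<Longrightarrow> \<bar>mehler r z y * mehler_rate r z y\<bar> \<le> K * exp (k * norm y)"
    using mehler_times_rate_le[OF R(1,2)] by blast
  show ?thesis
  proof (rule has_real_derivative_integral_dominated[where S = "{- R<..<R}" and W = "\<lambda>y. \<bar>w y * (K * exp (k * norm y))\<bar>"])
    show "r \<in> {- R<..<R}" using R by auto
    fix t y assume t: "t \<in> {- R<..<R}"
    then have t1: "\<bar>t\<bar> < 1" "\<bar>t\<bar> \<le> R" using R by auto
    show "integrable gauss_measure (\<lambda>y. w y * mehler t z y)"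
      by (rule gauss_L2_mult_integrable[OF w mehler_L2(1)[OF t1(1)]])
    show "((\<lambda>t. w y * mehler t z y) has_real_derivative w y * (mehler t z y * mehler_rate t z y)) (at t)"
      by (rule DERIV_cmult[OF mehler_derivative_param[OF t1(1)]])
    show "\<bar>w y * (mehler t z y * mehler_rate t z y)\<bar> \<le> \<bar>w y * (K * exp (k * norm y))\<bar>"
      unfolding abs_mult[of "w y"] by (rule mult_left_mono) (use K[OF t1(2), of y] in linarith, simp)
  next
    show "integrable gauss_measure (\<lambda>y. \<bar>w y * (K * exp (k * norm y))\<bar>)"
      by (intro integrable_abs gauss_L2_mult_integrable w gauss_L2_exp_norm)
    show "(\<lambda>y. w y * (mehler r z y * mehler_rate r z y)) \<in> borel_measurable gauss_measure"
      by measurable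
  qed auto
qed

text \<open>Under the kernel, \<open>y\<close> has the normal distribution with mean \<open>r z\<close> and covariance \<open>1 - r\<^sup>2\<close>. The
  proof completes the square in the exponent.\<close>

lemma mehler_transport:
  fixes z :: "'a::euclidean_space"
  assumes r: "\<bar>r\<bar> < 1"
  shows "density gauss_measure (\<lambda>y. ennreal (mehler r z y))
    = distr gauss_measure borel (\<lambda>x. r *\<^sub>R z + sqrt (1 - r\<^sup>2) *\<^sub>R x)"
proof -
  define s where "s = 1 - r\<^sup>2"
  have s: "s > 0" unfolding s_def by (rule one_minus_sq_pos[OF r])
  let ?c = "sqrt s" and ?n = "DIM('a)"
  let ?T = "\<lambda>x. r *\<^sub>R z + ?c *\<^sub>R x"
  have c: "?c > 0" using s by simp
  have T[measurable]: "?T \<in> borel \<rightarrow>\<^sub>M borel" by measurable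
  \<comment> \<open>The Jacobian of the affine map cancels the normalisation of the kernel.\<close>
  have eq: "gauss_density y * mehler r z y * ?c ^ ?n = gauss_density ((1 / ?c) *\<^sub>R (y - r *\<^sub>R z))" for y
  proof -
    have "?c ^ ?n = s powr (real ?n / 2)"
      using s by (simp add: powr_half_sqrt[symmetric] powr_powr powr_realpow[symmetric] mult.commute)
    then have 1: "s powr (- real ?n / 2) * ?c ^ ?n = 1"
      using s by (simp add: powr_add[symmetric])
    have 2: "- (norm y)\<^sup>2 / 2 + (2 * r * (z \<bullet> y) - r\<^sup>2 * (z \<bullet> z) - r\<^sup>2 * (y \<bullet> y)) / (2 * s)
        = - (norm ((1 / ?c) *\<^sub>R (y - r *\<^sub>R z)))\<^sup>2 / 2"
    proof -
      have "(norm ((1 / ?c) *\<^sub>R (y - r *\<^sub>R z)))\<^sup>2 = (y \<bullet> y - 2 * r * (z \<bullet> y) + r\<^sup>2 * (z \<bullet> z)) / s"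
        unfolding norm_scaleR power_mult_distrib norm_diff_scaled_square using s by (simp add: power_divide)
      moreover have "- Y / 2 + (2 * r * W - r\<^sup>2 * Z - r\<^sup>2 * Y) / (2 * s) = - ((Y - 2 * r * W + r\<^sup>2 * Z) / s) / 2" for Y W Z
      proof -
        have "- Y / 2 = (- Y * s) / (2 * s)" using s by simp
        then have "- Y / 2 + (2 * r * W - r\<^sup>2 * Z - r\<^sup>2 * Y) / (2 * s)
           = ((- Y * s) + (2 * r * W - r\<^sup>2 * Z - r\<^sup>2 * Y)) / (2 * s)"
          by (simp only: add_divide_distrib)
        also have "(- Y * s) + (2 * r * W - r\<^sup>2 * Z - r\<^sup>2 * Y) = - (Y - 2 * r * W + r\<^sup>2 * Z)"
          by (simp add: s_def algebra_simps)
        also have "- P / (2 * s) = - (P / s) / 2" for P by simp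
        finally show ?thesis .
      qed
      ultimately show ?thesis by (simp add: power2_norm_eq_inner)
    qed
    have "gauss_density y * mehler r z y * ?c ^ ?n
      = (2 * pi) powr (- real ?n / 2) * (s powr (- real ?n / 2) * ?c ^ ?n)
        * exp (- (norm y)\<^sup>2 / 2 + (2 * r * (z \<bullet> y) - r\<^sup>2 * (z \<bullet> z) - r\<^sup>2 * (y \<bullet> y)) / (2 * s))"
      unfolding gauss_density_def mehler_def s_def[symmetric] exp_add by (simp only: mult_ac)
    then show ?thesis unfolding 1 2 by (simp add: gauss_density_def)
  qed
  have "density gauss_measure (\<lambda>y. ennreal (mehler r z y))
      = density lborel (\<lambda>y. ennreal (gauss_density y) * ennreal (mehler r z y))"
    unfolding gauss_measure_density by (rule density_density_eq) measurable
  also have "\<dots> = density (density (distr lborel borel ?T) (\<lambda>_. ennreal (\<bar>?c\<bar> ^ ?n)))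
      (\<lambda>y. ennreal (gauss_density y) * ennreal (mehler r z y))"
    using lborel_affine[of ?c "r *\<^sub>R z"] c by simp
  also have "\<dots> = density (distr lborel borel ?T) (\<lambda>y. ennreal (\<bar>?c\<bar> ^ ?n) * (ennreal (gauss_density y) * ennreal (mehler r z y)))"
    by (rule density_density_eq) measurable
  also have "\<dots> = density (distr lborel borel ?T) (\<lambda>y. ennreal (gauss_density ((1 / ?c) *\<^sub>R (y - r *\<^sub>R z))))"
    unfolding eq[symmetric] using c by (simp add: ennreal_mult mehler_nonneg mult_ac)
  also have "\<dots> = distr (density lborel (\<lambda>x. ennreal (gauss_density ((1 / ?c) *\<^sub>R (?T x - r *\<^sub>R z))))) borel ?T"
    by (rule density_distr) measurable
  also have "(\<lambda>x. ennreal (gauss_density ((1 / ?c) *\<^sub>R (?T x - r *\<^sub>R z)))) = (\<lambda>x. ennreal (gauss_density x))"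
    using c by simp
  finally show ?thesis unfolding gauss_measure_density s_def .
qed

lemma integral_mehler:
  fixes z :: "'a::euclidean_space" and g :: "'a \<Rightarrow> real"
  assumes r: "\<bar>r\<bar> < 1" and [measurable]: "g \<in> borel_measurable borel"
  shows "(\<integral>y. mehler r z y * g y \<partial>gauss_measure) = (\<integral>x. g (r *\<^sub>R z + sqrt (1 - r\<^sup>2) *\<^sub>R x) \<partial>gauss_measure)"
proof -
  have "(\<integral>y. mehler r z y * g y \<partial>gauss_measure) = (\<integral>y. g y \<partial>density gauss_measure (\<lambda>y. ennreal (mehler r z y)))"
    by (subst integral_density) (auto simp: mehler_nonneg)
  also have "\<dots> = (\<integral>x. g (r *\<^sub>R z + sqrt (1 - r\<^sup>2) *\<^sub>R x) \<partial>gauss_measure)"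
    unfolding mehler_transport[OF r] by (subst integral_distr) auto
  finally show ?thesis .
qed

lemma integral_mehler_1: "\<bar>r\<bar> < 1 \<Longrightarrow> (\<integral>y. mehler r z y \<partial>gauss_measure) = 1"
  using integral_mehler[of r "\<lambda>_. 1" z] gauss.prob_space by simp

lemma mehler_integrable: "\<bar>r\<bar> < 1 \<Longrightarrow> integrable gauss_measure (mehler r z)"
  by (rule gauss_L2_integrable[OF mehler_L2(1)])

text \<open>After the change of variables \<open>y = r z + sqrt (1 - r\<^sup>2) x\<close> the logarithmic derivative is a polynomial in
  \<open>x\<close> whose coefficients are bounded by a multiple of \<open>1 + \<bar>z\<bar>\<close>, and Gaussian moments are finite. The
  constant depends on the dimension.\<close>

lemma mehler_rate_L1:
  "\<exists>C\<ge>0. \<forall>r (z::'a::euclidean_space). 0 \<le> r \<longrightarrow> r \<le> 1/2 \<longrightarrow>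
     (\<integral>y. \<bar>mehler r z y * mehler_rate r z y\<bar> \<partial>gauss_measure) \<le> C * (1 + norm z)"
proof -
  let ?n = "real DIM('a)"
  let ?m1 = "\<integral>x. norm (x::'a) \<partial>gauss_measure" and ?m2 = "\<integral>x. (norm (x::'a))\<^sup>2 \<partial>gauss_measure"
  have nL2: "(\<lambda>x::'a. norm x) \<in> gauss_L2"
    by (rule gauss_L2_bound[OF _ gauss_L2_exp_norm[of 1 1]]) (auto simp: norm_le_exp)
  have i1: "integrable gauss_measure (\<lambda>x::'a. norm x)" by (rule gauss_L2_integrable[OF nL2])
  have i2: "integrable gauss_measure (\<lambda>x::'a. (norm x)\<^sup>2)" using nL2 by (simp add: gauss_L2_def)
  have m: "0 \<le> ?m1" "0 \<le> ?m2" by (auto intro!: Bochner_Integration.integral_nonneg)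
  let ?C = "2 * ?n + 2 * ?m1 + 2 * ?m2"
  have "(\<integral>y. \<bar>mehler r z y * mehler_rate r z y\<bar> \<partial>gauss_measure) \<le> ?C * (1 + norm z)"
    if r: "0 \<le> r" "r \<le> 1/2" for r and z :: 'a
  proof -
    define s where "s = 1 - r\<^sup>2"
    have "r\<^sup>2 \<le> (1/2)\<^sup>2" using r by (intro power_mono) auto
    then have s: "1/2 \<le> s" "s \<le> 1" "s > 0" by (auto simp: s_def power_divide)
    have r1: "\<bar>r\<bar> < 1" using r by simp
    have bound: "\<bar>mehler_rate r z (r *\<^sub>R z + sqrt s *\<^sub>R x)\<bar> \<le> 2 * ?n + (2 * norm z) * norm x + 2 * (norm x)\<^sup>2" for x
    proof -
      have "mehler_rate r z (r *\<^sub>R z + sqrt s *\<^sub>R x) = ?n * r / s + (sqrt s * (z \<bullet> x)) / s - r * (norm x)\<^sup>2 / s"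
      proof -
        have "(norm (sqrt s *\<^sub>R x))\<^sup>2 = s * (norm x)\<^sup>2"
          using s by (simp add: power_mult_distrib)
        then show ?thesis
          unfolding mehler_rate_def s_def[symmetric] add_diff_cancel_left' using s
          by (simp add: power2_eq_square[of s])
      qed
      then have "\<bar>mehler_rate r z (r *\<^sub>R z + sqrt s *\<^sub>R x)\<bar> \<le> \<bar>?n * r / s\<bar> + \<bar>(sqrt s * (z \<bullet> x)) / s\<bar> + \<bar>r * (norm x)\<^sup>2 / s\<bar>"
        by (simp only: abs_add_diff_le)
      also have "\<dots> = ?n * r / s + (sqrt s * \<bar>z \<bullet> x\<bar>) / s + r * (norm x)\<^sup>2 / s"
        using s r by (simp add: abs_mult)
      also have "\<dots> \<le> (?n * 1) / (1/2) + (1 * (norm z * norm x)) / (1/2) + (1 * (norm x)\<^sup>2) / (1/2)"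
        using s r by (intro add_mono frac_le mult_mono Cauchy_Schwarz_ineq2) auto
      finally show ?thesis by simp
    qed
    have i: "integrable gauss_measure (\<lambda>x. 2 * ?n + (2 * norm z) * norm x + 2 * (norm (x::'a))\<^sup>2)"
      by (intro gauss.integrable_const Bochner_Integration.integrable_add integrable_mult_right i1 i2)
    have "(\<integral>y. \<bar>mehler r z y * mehler_rate r z y\<bar> \<partial>gauss_measure) = (\<integral>y. mehler r z y * \<bar>mehler_rate r z y\<bar> \<partial>gauss_measure)"
      by (simp add: abs_mult mehler_nonneg)
    also have "\<dots> = (\<integral>x. \<bar>mehler_rate r z (r *\<^sub>R z + sqrt s *\<^sub>R x)\<bar> \<partial>gauss_measure)"
      unfolding s_def by (rule integral_mehler[OF r1]) measurable
    also have "\<dots> \<le> (\<integral>x. 2 * ?n + (2 * norm z) * norm x + 2 * (norm (x::'a))\<^sup>2 \<partial>gauss_measure)"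
    proof (rule integral_mono[OF _ i bound])
      show "integrable gauss_measure (\<lambda>x. \<bar>mehler_rate r z (r *\<^sub>R z + sqrt s *\<^sub>R x)\<bar>)"
        by (rule Bochner_Integration.integrable_bound[OF i]) (measurable, use bound in \<open>auto intro: order_trans\<close>)
    qed
    also have "\<dots> = 2 * ?n + (2 * norm z) * ?m1 + 2 * ?m2"
      using i1 i2 gauss.prob_space[where 'a='a] by simp
    also have "\<dots> \<le> ?C * (1 + norm z)"
      using m by (simp add: algebra_simps)
    finally show ?thesis .
  qed
  then show ?thesis using m by (intro exI[of _ ?C]) auto
qed

text \<open>The equation for \<open>u\<close> is tested with the kernel; the derivatives are moved onto the kernel and become an
  \<open>r\<close>-derivative there. In terms of the semigroup, \<open>d/dt P\<^sub>t u = P\<^sub>t f\<close>.\<close>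

lemma OU_mehler_identity:
  fixes u :: "'a::euclidean_space \<Rightarrow> real"
  assumes u: "has_ornstein_uhlenbeck u f" and r: "\<bar>r\<bar> < 1"
  shows "r * (\<integral>y. u y * (mehler r z y * mehler_rate r z y) \<partial>gauss_measure) = - (\<integral>y. f y * mehler r z y \<partial>gauss_measure)"
proof -
  from u obtain G where G: "has_gauss_W12_gradient u G"
    and weak: "\<And>v H. has_gauss_W12_gradient v H \<Longrightarrow> (\<integral>x. G x \<bullet> H x \<partial>gauss_measure) = - (\<integral>x. v x * f x \<partial>gauss_measure)"
    by (auto simp: has_ornstein_uhlenbeck_def gauss_W12_def)
  let ?h = "mehler r z"
  have "(\<integral>x. G x \<bullet> grad ?h x \<partial>gauss_measure)
     = - (\<integral>x. u x * (\<Sum>b\<in>Basis. partial b (partial b ?h) x - (x \<bullet> b) * partial b ?h x) \<partial>gauss_measure)"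
    by (rule gauss_green_formula[OF smooth_mehler[OF r] _ _ _ G];
        unfold partial_mehler[OF r] partial_partial_mehler[OF r]; rule mehler_L2[OF r])
  also have "\<dots> = - (\<integral>x. u x * - (r * (?h x * mehler_rate r z x)) \<partial>gauss_measure)"
    unfolding partial_mehler[OF r] partial_partial_mehler[OF r] mehler_heat_equation[OF r] ..
  also have "\<dots> = r * (\<integral>x. u x * (?h x * mehler_rate r z x) \<partial>gauss_measure)"
    by (simp add: mult.left_commute[of _ r])
  finally show ?thesis
    using weak[OF mehler_W12[OF r, of z]] by (simp add: mult.commute)
qed

text \<open>Write \<open>Q(r)\<close> for the integral on the left and \<open>F(r)\<close> for the corresponding integral of \<open>f\<close>, so that
  \<open>r Q'(r) = - F(r)\<close>. Always \<open>\<bar>F\<bar> \<le> 1\<close>, whence \<open>\<bar>Q'(r)\<bar> \<le> 1/r\<close>. Moreover \<open>F(0) = 0\<close>, because the mean of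
  \<open>f\<close> vanishes, and for \<open>r \<le> 1/2\<close> the derivative \<open>\<bar>F'\<bar>\<close> is at most a multiple \<open>B\<close> of \<open>1 + \<bar>z\<bar>\<close>,
  whence \<open>\<bar>Q'(r)\<bar> \<le> B\<close>. Integrating the second bound up to a radius of order \<open>1 / (1 + \<bar>z\<bar>)\<close> costs a constant, and
  integrating the first one from there to \<open>r < 1\<close> costs \<open>ln (1 + \<bar>z\<bar>)\<close> up to a constant. At \<open>r = 0\<close>
  the value \<open>Q(0)\<close> is the mean of \<open>u\<close>.\<close>

lemma OU_flow_bound:
  "\<exists>C. \<forall>(u::'a::euclidean_space \<Rightarrow> real) f. has_ornstein_uhlenbeck u f \<longrightarrow> (AE x in gauss_measure. \<bar>f x\<bar> \<le> 1) \<longrightarrow>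
    (\<forall>z r. 0 \<le> r \<longrightarrow> r < 1 \<longrightarrow> \<bar>(\<integral>y. u y * mehler r z y \<partial>gauss_measure) - mv u\<bar> \<le> C + ln (1 + norm z))"
proof -
  obtain C where C: "C \<ge> 0" and CL1: "\<And>r (z::'a). 0 \<le> r \<Longrightarrow> r \<le> 1/2 \<Longrightarrow>
     (\<integral>y. \<bar>mehler r z y * mehler_rate r z y\<bar> \<partial>gauss_measure) \<le> C * (1 + norm z)"
    using mehler_rate_L1 by blast
  have "\<bar>(\<integral>y. u y * mehler r z y \<partial>gauss_measure) - mv u\<bar> \<le> (C / 2 + ln 2) + ln (1 + norm z)"
    if ou: "has_ornstein_uhlenbeck u f" and f1: "AE x in gauss_measure. \<bar>f x\<bar> \<le> 1" and r: "0 \<le> r" "r < 1"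
    for u f and z :: 'a and r
  proof -
    have u: "u \<in> gauss_L2" and f: "f \<in> gauss_L2"
      using ou by (auto simp: has_ornstein_uhlenbeck_def has_gauss_W12_gradient_def)
    note [measurable] = gauss_L2_measurable[OF u] gauss_L2_measurable[OF f]
    let ?Q = "\<lambda>r. \<integral>y. u y * mehler r z y \<partial>gauss_measure"
    let ?Q' = "\<lambda>r. \<integral>y. u y * (mehler r z y * mehler_rate r z y) \<partial>gauss_measure"
    let ?F = "\<lambda>r. \<integral>y. f y * mehler r z y \<partial>gauss_measure"
    let ?F' = "\<lambda>r. \<integral>y. f y * (mehler r z y * mehler_rate r z y) \<partial>gauss_measure"
    let ?B = "C * (1 + norm z)"
    have B: "?B \<ge> 0" using C by simp
    have QF: "t * ?Q' t = - ?F t" if "\<bar>t\<bar> < 1" for t by (rule OU_mehler_identity[OF ou that])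
    \<comment> \<open>At \<open>r = 0\<close> the kernel is 1, and the identity says that \<open>f\<close> has mean zero.\<close>
    have F0: "?F 0 = 0" using QF[of 0] by simp
    have F_le: "\<bar>?F t\<bar> \<le> 1" if t: "\<bar>t\<bar> < 1" for t
    proof -
      have "\<bar>?F t\<bar> \<le> (\<integral>y. \<bar>f y * mehler t z y\<bar> \<partial>gauss_measure)"
        using integral_norm_bound[of gauss_measure "\<lambda>y. f y * mehler t z y"] by simp
      also have "\<dots> \<le> (\<integral>y. mehler t z y \<partial>gauss_measure)"
      proof (rule integral_mono_AE)
        show "integrable gauss_measure (\<lambda>y. \<bar>f y * mehler t z y\<bar>)"
          by (intro integrable_abs gauss_L2_mult_integrable f mehler_L2 t)
        show "AE y in gauss_measure. \<bar>f y * mehler t z y\<bar> \<le> mehler t z y"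
          using f1 by eventually_elim (auto simp: abs_mult mehler_nonneg intro!: mult_left_le_one_le)
      qed (rule mehler_integrable[OF t])
      finally show ?thesis by (simp add: integral_mehler_1[OF t])
    qed
    have F'_le: "\<bar>?F' t\<bar> \<le> ?B" if t: "0 \<le> t" "t \<le> 1/2" for t
    proof -
      have t1: "\<bar>t\<bar> < 1" using t by simp
      obtain K k where K: "\<And>y. \<bar>mehler t z y * mehler_rate t z y\<bar> \<le> K * exp (k * norm y)"
        using mehler_times_rate_le[of "\<bar>t\<bar>" z] t1 by auto
      have L2: "(\<lambda>y. mehler t z y * mehler_rate t z y) \<in> gauss_L2"
        by (rule exp_bounded_L2[OF exp_boundedI[OF K]]) measurable
      have "\<bar>?F' t\<bar> \<le> (\<integral>y. \<bar>f y * (mehler t z y * mehler_rate t z y)\<bar> \<partial>gauss_measure)"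
        using integral_norm_bound[of gauss_measure "\<lambda>y. f y * (mehler t z y * mehler_rate t z y)"] by simp
      also have "\<dots> \<le> (\<integral>y. \<bar>mehler t z y * mehler_rate t z y\<bar> \<partial>gauss_measure)"
      proof (rule integral_mono_AE)
        show "integrable gauss_measure (\<lambda>y. \<bar>f y * (mehler t z y * mehler_rate t z y)\<bar>)"
          by (intro integrable_abs gauss_L2_mult_integrable f L2)
        show "integrable gauss_measure (\<lambda>y. \<bar>mehler t z y * mehler_rate t z y\<bar>)"
          by (intro integrable_abs gauss_L2_integrable L2)
        show "AE y in gauss_measure. \<bar>f y * (mehler t z y * mehler_rate t z y)\<bar> \<le> \<bar>mehler t z y * mehler_rate t z y\<bar>"
          using f1 by eventually_elim (simp add: abs_mult[of "f _"] mult_left_le_one_le)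
      qed
      also have "\<dots> \<le> ?B" by (rule CL1[OF t])
      finally show ?thesis .
    qed
    have F_small: "\<bar>?F t\<bar> \<le> ?B * t" if t: "0 \<le> t" "t \<le> 1/2" for t
    proof -
      have "norm (?F t - ?F 0) \<le> ?B * norm (t - 0)"
        by (rule field_differentiable_bound[where S = "{0..1/2}" and f' = ?F'])
           (use t F'_le in \<open>auto intro!: has_field_derivative_at_within mehler_flow_derivative[OF f]\<close>)
      then show ?thesis using t F0 by simp
    qed
    have dQ: "(?Q has_real_derivative ?Q' t) (at t)" if "\<bar>t\<bar> < 1" for t
      by (rule mehler_flow_derivative[OF u that])
    have Q'_small: "\<bar>?Q' t\<bar> \<le> ?B" if t: "0 < t" "t \<le> 1/2" for t
    proof -
      have "t * \<bar>?Q' t\<bar> = \<bar>?F t\<bar>" using arg_cong[OF QF[of t], of abs] t by (simp add: abs_mult)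
      also have "\<dots> \<le> t * ?B" using F_small[of t] t by (simp add: mult.commute)
      finally show ?thesis using t by simp
    qed
    have Q'_le: "\<bar>?Q' t\<bar> \<le> 1 / t" if t: "0 < t" "t < 1" for t
    proof -
      have "t * \<bar>?Q' t\<bar> = \<bar>?F t\<bar>" using arg_cong[OF QF[of t], of abs] t by (simp add: abs_mult)
      also have "\<dots> \<le> 1" using F_le[of t] t by simp
      finally show ?thesis using t by (simp add: field_simps)
    qed
    \<comment> \<open>The two bounds on the derivative balance at radius \<open>1 / (1 + \<bar>z\<bar>)\<close>; the factor 2 keeps \<open>\<rho> \<le> 1/2\<close>.\<close>
    define \<rho> where "\<rho> = 1 / (2 * (1 + norm z))"
    have n1: "1 + norm z \<ge> 1" by simp
    have \<rho>: "0 < \<rho>" "\<rho> \<le> 1/2"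
    proof -
      have p: "0 < 2 * (1 + norm z)" "2 \<le> 2 * (1 + norm z)"
        by (rule mult_pos_pos) (auto simp: add_pos_nonneg)
      show "0 < \<rho>" unfolding \<rho>_def by (rule divide_pos_pos[OF zero_less_one p(1)])
      show "\<rho> \<le> 1/2" unfolding \<rho>_def by (rule frac_le[OF _ order_refl _ p(2)]) auto
    qed
    have B\<rho>: "?B * \<rho> = C / 2"
    proof -
      have "(C * w) * (1 / (2 * w)) = C / 2" if "w \<ge> 1" for w
        using that by simp
      from this[OF n1] show ?thesis unfolding \<rho>_def .
    qed
    have first: "\<bar>?Q t - ?Q 0\<bar> \<le> C / 2" if t: "0 \<le> t" "t \<le> \<rho>" for t
    proof (cases "t = 0")
      case False
      then have t0: "0 < t" using t by simp
      have "\<exists>l x. 0 < x \<and> x < t \<and> (?Q has_real_derivative l) (at x) \<and> ?Q t - ?Q 0 = (t - 0) * l"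
      proof (rule MVT[OF t0])
        show "continuous_on {0..t} ?Q"
          using t \<rho> by (intro continuous_at_imp_continuous_on ballI DERIV_isCont[OF dQ]) auto
        show "?Q differentiable (at x)" if "0 < x" "x < t" for x
          using dQ[of x] that t \<rho> unfolding real_differentiable_def by auto
      qed
      then obtain l x where x: "0 < x" "x < t" and l: "(?Q has_real_derivative l) (at x)" and eq: "?Q t - ?Q 0 = (t - 0) * l"
        by blast
      have "l = ?Q' x" by (rule DERIV_unique[OF l dQ]) (use x t \<rho> in auto)
      then have "\<bar>?Q t - ?Q 0\<bar> \<le> t * ?B"
        unfolding eq abs_mult using Q'_small[of x] x t \<rho> by (intro mult_mono) auto
      also have "\<dots> \<le> \<rho> * ?B" using t B by (intro mult_right_mono) auto
      also have "\<dots> = C / 2" using B\<rho> by (simp only: mult.commute)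
      finally show ?thesis .
    qed (use C in simp)
    have second: "\<bar>?Q t - ?Q \<rho>\<bar> \<le> ln t - ln \<rho>" if t: "\<rho> \<le> t" "t < 1" for t
    proof -
      have "?Q t - ln t \<le> ?Q \<rho> - ln \<rho>"
      proof (rule DERIV_nonpos_imp_nonincreasing[OF t(1)])
        fix x assume x: "\<rho> \<le> x" "x \<le> t"
        have "((\<lambda>t. ?Q t - ln t) has_real_derivative ?Q' x - inverse x) (at x)"
          using x \<rho> t by (intro DERIV_diff dQ DERIV_ln) auto
        moreover have "?Q' x - inverse x \<le> 0" using Q'_le[of x] x \<rho> t by (simp add: inverse_eq_divide)
        ultimately show "\<exists>y. ((\<lambda>t. ?Q t - ln t) has_real_derivative y) (at x) \<and> y \<le> 0" by blast
      qed
      moreover have "?Q \<rho> + ln \<rho> \<le> ?Q t + ln t"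
      proof (rule DERIV_nonneg_imp_nondecreasing[OF t(1)])
        fix x assume x: "\<rho> \<le> x" "x \<le> t"
        have "((\<lambda>t. ?Q t + ln t) has_real_derivative ?Q' x + inverse x) (at x)"
          using x \<rho> t by (intro DERIV_add dQ DERIV_ln) auto
        moreover have "0 \<le> ?Q' x + inverse x" using Q'_le[of x] x \<rho> t by (simp add: inverse_eq_divide)
        ultimately show "\<exists>y. ((\<lambda>t. ?Q t + ln t) has_real_derivative y) (at x) \<and> 0 \<le> y" by blast
      qed
      ultimately show ?thesis by linarith
    qed
    have Q0: "?Q 0 = mv u" by (simp add: mehler_0 mv_def)
    have ln\<rho>: "- ln \<rho> = ln 2 + ln (1 + norm z)"
    proof -
      have "- ln (1 / (2 * w)) = ln 2 + ln w" if "w \<ge> 1" for w :: real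
        using that by (simp add: ln_div ln_mult)
      from this[OF n1] show ?thesis unfolding \<rho>_def .
    qed
    show ?thesis
    proof (cases "r \<le> \<rho>")
      case True
      moreover have "0 \<le> ln 2 + ln (1 + norm z)" using n1 by (intro add_nonneg_nonneg ln_ge_zero) auto
      ultimately show ?thesis using first[of r] r Q0 by linarith
    next
      case False
      then have "ln r \<le> 0" using r \<rho> by (simp add: ln_le_zero_iff)
      then show ?thesis using second[of r] first[of \<rho>] False r \<rho> Q0 ln\<rho> by linarith
    qed
  qed
  then show ?thesis by blast
qed

section \<open>Pointwise logarithmic growth\<close>

text \<open>Fubini and the symmetry of the kernel: the semigroup is self-adjoint with respect to the Gauss measure.\<close>

lemma mehler_duality:
  fixes u g :: "'a::euclidean_space \<Rightarrow> real"
  assumes r: "\<bar>r\<bar> < 1" and u: "u \<in> gauss_L2" and g: "g \<in> borel_measurable borel" "\<And>x. 0 \<le> g x" "\<And>x. g x \<le> 1"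
  shows "integrable gauss_measure (\<lambda>z. g z * (\<integral>y. u y * mehler r z y \<partial>gauss_measure))"
    and "(\<integral>z. g z * (\<integral>y. u y * mehler r z y \<partial>gauss_measure) \<partial>gauss_measure)
      = (\<integral>y. u y * (\<integral>x. g (r *\<^sub>R y + sqrt (1 - r\<^sup>2) *\<^sub>R x) \<partial>gauss_measure) \<partial>gauss_measure)"
proof -
  interpret P: pair_sigma_finite "gauss_measure :: 'a measure" "gauss_measure :: 'a measure" ..
  note [measurable] = gauss_L2_measurable[OF u] g(1) mehler_measurable_pair
  let ?f = "\<lambda>y z. u y * (mehler r y z * g z)"
  have mf[measurable]: "case_prod ?f \<in> borel_measurable (gauss_measure \<Otimes>\<^sub>M gauss_measure)"
  proof -
    have "(\<lambda>p. mehler r (fst p) (snd p)) \<in> borel_measurable (gauss_measure \<Otimes>\<^sub>M gauss_measure)"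
      using mehler_measurable_pair[of r, where 'a='a] by (simp add: case_prod_beta cong: measurable_cong_sets sets_pair_measure_cong)
    then show ?thesis by (simp add: case_prod_beta) measurable
  qed
  have inner_int: "integrable gauss_measure (\<lambda>z. mehler r y z * g z)" for y
    by (rule Bochner_Integration.integrable_bound[OF mehler_integrable[OF r, of y]])
       (measurable, use g in \<open>auto simp: abs_mult mehler_nonneg intro!: mult_right_le_one_le\<close>)
  have inner_le: "0 \<le> (\<integral>z. mehler r y z * g z \<partial>gauss_measure)" "(\<integral>z. mehler r y z * g z \<partial>gauss_measure) \<le> 1" for y
  proof -
    show "0 \<le> (\<integral>z. mehler r y z * g z \<partial>gauss_measure)"
      by (intro Bochner_Integration.integral_nonneg mult_nonneg_nonneg mehler_nonneg g)
    have "(\<integral>z. mehler r y z * g z \<partial>gauss_measure) \<le> (\<integral>z. mehler r y z \<partial>gauss_measure)"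
      using g mehler_nonneg[of r y] by (intro integral_mono inner_int mehler_integrable r) (simp add: mult_right_le_one_le)
    then show "(\<integral>z. mehler r y z * g z \<partial>gauss_measure) \<le> 1" by (simp add: integral_mehler_1[OF r])
  qed
  have int: "integrable (gauss_measure \<Otimes>\<^sub>M gauss_measure) (case_prod ?f)"
  proof (rule P.Fubini_integrable[OF mf])
    have eq: "(\<integral>z. norm (case_prod ?f (y, z)) \<partial>gauss_measure) = \<bar>u y\<bar> * (\<integral>z. mehler r y z * g z \<partial>gauss_measure)" for y
      using g mehler_nonneg[of r y] by (simp add: abs_mult)
    have [measurable]: "(\<lambda>y. \<integral>z. mehler r y z * g z \<partial>gauss_measure) \<in> borel_measurable borel"
      unfolding integral_mehler[OF r g(1)] by measurable
    show "integrable gauss_measure (\<lambda>y. \<integral>z. norm (case_prod ?f (y, z)) \<partial>gauss_measure)"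
      unfolding eq
    proof (rule Bochner_Integration.integrable_bound[OF gauss_L2_integrable[OF u]])
      show "AE y in gauss_measure. norm (\<bar>u y\<bar> * (\<integral>z. mehler r y z * g z \<partial>gauss_measure)) \<le> norm (u y)"
        by (rule AE_I2) (simp add: abs_mult inner_le mult_right_le_one_le)
    qed measurable
    show "AE y in gauss_measure. integrable gauss_measure (\<lambda>z. case_prod ?f (y, z))"
      using inner_int by (intro AE_I2) simp
  qed
  have eq: "(\<integral>y. ?f y z \<partial>gauss_measure) = g z * (\<integral>y. u y * mehler r z y \<partial>gauss_measure)" for z
  proof -
    have "(\<integral>y. ?f y z \<partial>gauss_measure) = (\<integral>y. g z * (u y * mehler r z y) \<partial>gauss_measure)"
      by (subst mehler_commute) (simp add: mult_ac)
    then show ?thesis by simp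
  qed
  show "integrable gauss_measure (\<lambda>z. g z * (\<integral>y. u y * mehler r z y \<partial>gauss_measure))"
    using P.integrable_snd[OF int] unfolding eq .
  show "(\<integral>z. g z * (\<integral>y. u y * mehler r z y \<partial>gauss_measure) \<partial>gauss_measure)
      = (\<integral>y. u y * (\<integral>x. g (r *\<^sub>R y + sqrt (1 - r\<^sup>2) *\<^sub>R x) \<partial>gauss_measure) \<partial>gauss_measure)"
    using P.Fubini_integral[OF int] unfolding eq by (simp add: integral_mehler[OF r g(1)])
qed

text \<open>As \<open>r\<close> tends to 1, the flow of \<open>u\<close> returns to \<open>u\<close> weakly. By duality the limit falls on the continuous
  function \<open>g\<close>, where it is a pointwise one, so almost everywhere convergence for \<open>u\<close> itself is avoided.\<close>

lemma mehler_weak_limit: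
  fixes u g :: "'a::euclidean_space \<Rightarrow> real"
  assumes u: "u \<in> gauss_L2" and g: "continuous_on UNIV g" "\<And>x. 0 \<le> g x" "\<And>x. g x \<le> 1"
    and r: "\<And>k. \<bar>r k\<bar> < 1" "r \<longlonglongrightarrow> 1"
  shows "(\<lambda>k. \<integral>z. g z * (\<integral>y. u y * mehler (r k) z y \<partial>gauss_measure) \<partial>gauss_measure)
    \<longlonglongrightarrow> (\<integral>z. g z * u z \<partial>gauss_measure)"
proof -
  have gm[measurable]: "g \<in> borel_measurable borel" by (rule borel_measurable_continuous_onI[OF g(1)])
  note [measurable] = gauss_L2_measurable[OF u]
  let ?P = "\<lambda>k y. \<integral>x. g (r k *\<^sub>R y + sqrt (1 - (r k)\<^sup>2) *\<^sub>R x) \<partial>gauss_measure"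
  have s0: "(\<lambda>k. sqrt (1 - (r k)\<^sup>2)) \<longlonglongrightarrow> sqrt (1 - 1\<^sup>2)"
    by (intro tendsto_real_sqrt tendsto_diff tendsto_const tendsto_power r)
  have Plim: "(\<lambda>k. ?P k y) \<longlonglongrightarrow> g y" for y
  proof -
    have "(\<lambda>k. ?P k y) \<longlonglongrightarrow> (\<integral>x. g y \<partial>(gauss_measure :: 'a measure))"
    proof (rule integral_dominated_convergence[where w = "\<lambda>_. 1"])
      show "AE x in gauss_measure. (\<lambda>k. g (r k *\<^sub>R y + sqrt (1 - (r k)\<^sup>2) *\<^sub>R x)) \<longlonglongrightarrow> g y"
      proof (rule AE_I2)
        fix x :: 'a
        have "(\<lambda>k. r k *\<^sub>R y + sqrt (1 - (r k)\<^sup>2) *\<^sub>R x) \<longlonglongrightarrow> 1 *\<^sub>R y + sqrt (1 - 1\<^sup>2) *\<^sub>R x"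
          by (intro tendsto_add tendsto_scaleR tendsto_const r s0)
        then have "(\<lambda>k. r k *\<^sub>R y + sqrt (1 - (r k)\<^sup>2) *\<^sub>R x) \<longlonglongrightarrow> y" by simp
        with g(1) show "(\<lambda>k. g (r k *\<^sub>R y + sqrt (1 - (r k)\<^sup>2) *\<^sub>R x)) \<longlonglongrightarrow> g y"
          by (intro isCont_tendsto_compose[where g = g]) (auto simp: continuous_on_eq_continuous_at)
      qed
    qed (use g in auto)
    then show ?thesis using gauss.prob_space[where 'a='a] by simp
  qed
  have P01: "0 \<le> ?P k y" "?P k y \<le> 1" for k y
  proof -
    show "0 \<le> ?P k y" using g by (intro Bochner_Integration.integral_nonneg) auto
    have "?P k y \<le> (\<integral>x. 1 \<partial>(gauss_measure :: 'a measure))"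
      by (rule integral_mono) (use g in \<open>auto intro!: gauss.integrable_const_bound[where B = 1]\<close>)
    then show "?P k y \<le> 1" using gauss.prob_space[where 'a='a] by simp
  qed
  have [measurable]: "?P k \<in> borel_measurable borel" for k by measurable
  have "(\<lambda>k. \<integral>y. u y * ?P k y \<partial>gauss_measure) \<longlonglongrightarrow> (\<integral>y. u y * g y \<partial>gauss_measure)"
  proof (rule integral_dominated_convergence[where w = "\<lambda>y. \<bar>u y\<bar>"])
    show "integrable gauss_measure (\<lambda>y. \<bar>u y\<bar>)" using gauss_L2_integrable[OF u] by simp
    show "AE y in gauss_measure. (\<lambda>k. u y * ?P k y) \<longlonglongrightarrow> u y * g y"
      by (intro AE_I2 tendsto_mult tendsto_const Plim)
    show "AE y in gauss_measure. norm (u y * ?P k y) \<le> \<bar>u y\<bar>" for k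
      by (rule AE_I2) (simp add: abs_mult P01 mult_right_le_one_le)
  qed measurable
  then show ?thesis
    unfolding mehler_duality(2)[OF r(1) u gm g(2,3)] by (simp add: mult.commute)
qed

text \<open>Indicators of compact sets are decreasing limits of continuous functions, so \<open>w\<close> has nonnegative
  integral over each compact subset of \<open>{w < 0}\<close>, which is therefore a null set; inner regularity
  carries this over to \<open>{w < 0}\<close>.\<close>

lemma AE_nonneg_if_integrals_nonneg:
  fixes w :: "'a::euclidean_space \<Rightarrow> real"
  assumes w: "integrable gauss_measure w"
    and nonneg: "\<And>g :: 'a \<Rightarrow> real. continuous_on UNIV g \<Longrightarrow> (\<And>x. 0 \<le> g x) \<Longrightarrow> (\<And>x. g x \<le> 1) \<Longrightarrow> 0 \<le> (\<integral>x. g x * w x \<partial>gauss_measure)"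
  shows "AE x in gauss_measure. 0 \<le> w x"
proof -
  have [measurable]: "w \<in> borel_measurable borel" using borel_measurable_integrable[OF w] by simp
  let ?B = "{x. w x < 0}"
  have B: "?B \<in> sets borel" by measurable
  have K0: "emeasure gauss_measure K = 0" if K: "compact K" "K \<subseteq> ?B" for K
  proof (cases "K = {}")
    case False
    have Ks[measurable]: "K \<in> sets borel" using K by (simp add: borel_compact)
    let ?g = "\<lambda>n x. max 0 (1 - real n * infdist x K)"
    have lim: "(\<lambda>n. ?g n x) \<longlonglongrightarrow> indicator K x" for x
    proof (cases "x \<in> K")
      case True then show ?thesis by simp
    next
      case False
      then have d: "infdist x K > 0"
        using K \<open>K \<noteq> {}\<close> infdist_pos_not_in_closed compact_imp_closed by blast
      have "eventually (\<lambda>n. ?g n x = 0) sequentially"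
        using eventually_ge_at_top[of "nat \<lceil>1 / infdist x K\<rceil>"]
      proof eventually_elim
        case (elim n)
        then have "1 / infdist x K \<le> real n" by (simp add: nat_le_iff ceiling_le_iff)
        then show ?case using d by (simp add: field_simps)
      qed
      then show ?thesis using False by (simp add: tendsto_eventually)
    qed
    have gc: "continuous_on UNIV (?g n)" for n by (intro continuous_intros)
    have [measurable]: "?g n \<in> borel_measurable borel" for n by (rule borel_measurable_continuous_onI[OF gc])
    have g1: "?g n x \<le> 1" for n x by (simp add: infdist_nonneg)
    have "(\<lambda>n. \<integral>x. ?g n x * w x \<partial>gauss_measure) \<longlonglongrightarrow> (\<integral>x. indicator K x * w x \<partial>gauss_measure)"
    proof (rule integral_dominated_convergence[where w = "\<lambda>x. \<bar>w x\<bar>"])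
      show "integrable gauss_measure (\<lambda>x. \<bar>w x\<bar>)" using w by simp
      show "AE x in gauss_measure. (\<lambda>n. ?g n x * w x) \<longlonglongrightarrow> indicator K x * w x"
        by (intro AE_I2 tendsto_mult tendsto_const lim)
      show "AE x in gauss_measure. norm (?g n x * w x) \<le> \<bar>w x\<bar>" for n
      proof (rule AE_I2)
        fix x
        have "\<bar>?g n x\<bar> * \<bar>w x\<bar> \<le> 1 * \<bar>w x\<bar>" using g1[of n x] by (intro mult_right_mono) auto
        then show "norm (?g n x * w x) \<le> \<bar>w x\<bar>" by (simp only: real_norm_def abs_mult mult_1)
      qed
    qed measurable
    moreover have "0 \<le> (\<integral>x. ?g n x * w x \<partial>gauss_measure)" for n
      by (rule nonneg[OF gc]) (auto simp: infdist_nonneg)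
    ultimately have "0 \<le> (\<integral>x. indicator K x * w x \<partial>gauss_measure)"
      by (intro LIMSEQ_le_const) auto
    moreover have iK: "integrable gauss_measure (\<lambda>x. - (indicator K x * w x))"
      using integrable_mult_indicator[of K gauss_measure w] w by simp
    moreover have pos: "AE x in gauss_measure. 0 \<le> - (indicator K x * w x)"
      using K(2) by (intro AE_I2) (auto simp: indicator_def less_imp_le)
    moreover have "0 \<le> (\<integral>x. - (indicator K x * w x) \<partial>gauss_measure)"
      by (rule integral_nonneg_AE[OF pos])
    ultimately have "(\<integral>x. - (indicator K x * w x) \<partial>gauss_measure) = 0" by simp
    then have "AE x in gauss_measure. - (indicator K x * w x) = 0"
      using integral_nonneg_eq_0_iff_AE[OF iK pos] by blast
    then have "AE x in gauss_measure. x \<notin> K"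
      by eventually_elim (use K(2) in \<open>auto simp: indicator_def split: if_splits\<close>)
    then show ?thesis by (subst (asm) AE_iff_measurable[of K]) auto
  qed simp
  have "emeasure gauss_measure ?B = (SUP K \<in> {K. K \<subseteq> ?B \<and> compact K}. emeasure gauss_measure K)"
    by (rule inner_regular) (use B in auto)
  also have "\<dots> = 0" using K0 by (auto intro!: antisym SUP_least)
  finally have "emeasure gauss_measure ?B = 0" .
  then show ?thesis by (subst AE_iff_measurable[of ?B]) (auto simp: not_le)
qed

lemma log_growth_L2: "(\<lambda>z::'a::euclidean_space. c + ln (1 + norm z)) \<in> gauss_L2"
proof (rule exp_bounded_L2)
  have "exp_bounded (\<lambda>z::'a. ln (1 + norm z))"
  proof (rule exp_boundedI)
    fix z :: 'a
    have "ln (1 + norm z) \<le> norm z" by (rule ln_add_one_self_le_self) simp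
    then show "\<bar>ln (1 + norm z)\<bar> \<le> 1 * exp (1 * norm z)"
      using norm_le_exp[of z] by (simp add: ln_ge_zero)
  qed
  then show "exp_bounded (\<lambda>z::'a. c + ln (1 + norm z))"
    by (intro exp_bounded_add exp_bounded_const)
qed measurable

text \<open>The bound on the flow passes to the limit \<open>r \<rightarrow> 1\<close> when tested against nonnegative continuous functions.\<close>

lemma OU_log_growth:
  "\<exists>C. \<forall>(u::'a::euclidean_space \<Rightarrow> real) f. has_ornstein_uhlenbeck u f \<longrightarrow> (AE x in gauss_measure. \<bar>f x\<bar> \<le> 1) \<longrightarrow>
    (AE z in gauss_measure. \<bar>u z - mv u\<bar> \<le> C + ln (1 + norm z))"
proof -
  obtain C where C: "\<And>(u::'a \<Rightarrow> real) f z r. has_ornstein_uhlenbeck u f \<Longrightarrow> (AE x in gauss_measure. \<bar>f x\<bar> \<le> 1) \<Longrightarrow>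
    0 \<le> r \<Longrightarrow> r < 1 \<Longrightarrow> \<bar>(\<integral>y. u y * mehler r z y \<partial>gauss_measure) - mv u\<bar> \<le> C + ln (1 + norm z)"
    using OU_flow_bound by blast
  have "AE z in gauss_measure. \<bar>u z - mv u\<bar> \<le> C + ln (1 + norm z)"
    if ou: "has_ornstein_uhlenbeck u f" and f1: "AE x in gauss_measure. \<bar>f x\<bar> \<le> 1" for u f :: "'a \<Rightarrow> real"
  proof -
    have u: "u \<in> gauss_L2"
      using ou by (auto simp: has_ornstein_uhlenbeck_def has_gauss_W12_gradient_def)
    define r where "r k = 1 - 1 / real (k + 2)" for k
    have r: "0 \<le> r k" "r k < 1" "\<bar>r k\<bar> < 1" for k by (auto simp: r_def field_simps)
    have r1: "r \<longlonglongrightarrow> 1" unfolding r_def by real_asymp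
    let ?Q = "\<lambda>k z. \<integral>y. u y * mehler (r k) z y \<partial>gauss_measure"
    have bounds: "?Q k z \<le> (mv u + C) + ln (1 + norm z)" "(mv u - C) + - ln (1 + norm z) \<le> ?Q k z" for k z
      using C[OF ou f1 r(1,2), of k z] by linarith+
    have up: "(\<lambda>z::'a. (mv u + C) + ln (1 + norm z)) \<in> gauss_L2" by (rule log_growth_L2)
    have low: "integrable gauss_measure (\<lambda>z::'a. (mv u - C) + - ln (1 + norm z))"
      using gauss_L2_integrable[OF log_growth_L2[of "C - mv u", where 'a='a], THEN integrable_minus]
      by (simp add: algebra_simps)
    have gint: "integrable gauss_measure (\<lambda>z. g z * w z)"
      if g: "continuous_on UNIV g" "\<And>x. 0 \<le> g x" "\<And>x. g x \<le> 1" and w: "integrable gauss_measure w" for g w :: "'a \<Rightarrow> real"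
    proof (rule Bochner_Integration.integrable_bound[OF w])
      show "(\<lambda>z. g z * w z) \<in> borel_measurable gauss_measure"
        using borel_measurable_continuous_onI[OF g(1)] borel_measurable_integrable[OF w] by simp
      show "AE z in gauss_measure. norm (g z * w z) \<le> norm (w z)"
        using g by (intro AE_I2) (simp add: abs_mult mult_left_le_one_le)
    qed
    have ge: "0 \<le> (\<integral>z. g z * (((mv u + C) + ln (1 + norm z)) - u z) \<partial>gauss_measure)"
      and le: "0 \<le> (\<integral>z. g z * (u z - ((mv u - C) + - ln (1 + norm z))) \<partial>gauss_measure)"
      if g: "continuous_on UNIV g" "\<And>x. 0 \<le> g x" "\<And>x. g x \<le> 1" for g :: "'a \<Rightarrow> real"
    proof -
      have gm: "g \<in> borel_measurable borel" by (rule borel_measurable_continuous_onI[OF g(1)])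
      note Qint = mehler_duality(1)[OF r(3) u gm g(2,3)]
      note gu = gint[OF g gauss_L2_integrable[OF u]]
      note lim = mehler_weak_limit[OF u g r(3) r1]
      have "(\<integral>z. g z * u z \<partial>gauss_measure) \<le> (\<integral>z. g z * ((mv u + C) + ln (1 + norm z)) \<partial>gauss_measure)"
      proof (rule LIMSEQ_le_const2[OF lim], intro exI allI impI)
        fix k
        show "(\<integral>z. g z * ?Q k z \<partial>gauss_measure) \<le> (\<integral>z. g z * ((mv u + C) + ln (1 + norm z)) \<partial>gauss_measure)"
          by (intro integral_mono Qint gint g gauss_L2_integrable up mult_left_mono bounds)
      qed
      then show "0 \<le> (\<integral>z. g z * (((mv u + C) + ln (1 + norm z)) - u z) \<partial>gauss_measure)"
        unfolding right_diff_distrib[of "g _"]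
        by (subst Bochner_Integration.integral_diff[OF gint[OF g gauss_L2_integrable[OF up]] gu]) simp
      have "(\<integral>z. g z * ((mv u - C) + - ln (1 + norm z)) \<partial>gauss_measure) \<le> (\<integral>z. g z * u z \<partial>gauss_measure)"
      proof (rule LIMSEQ_le_const[OF lim], intro exI allI impI)
        fix k
        show "(\<integral>z. g z * ((mv u - C) + - ln (1 + norm z)) \<partial>gauss_measure) \<le> (\<integral>z. g z * ?Q k z \<partial>gauss_measure)"
          by (intro integral_mono Qint gint g low mult_left_mono bounds)
      qed
      then show "0 \<le> (\<integral>z. g z * (u z - ((mv u - C) + - ln (1 + norm z))) \<partial>gauss_measure)"
        unfolding right_diff_distrib[of "g _" "u _"]
        by (subst Bochner_Integration.integral_diff[OF gu gint[OF g low]]) simp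
    qed
    have "AE z in gauss_measure. 0 \<le> ((mv u + C) + ln (1 + norm z)) - u z"
      by (rule AE_nonneg_if_integrals_nonneg[OF _ ge]) (intro Bochner_Integration.integrable_diff gauss_L2_integrable up u)
    moreover have "AE z in gauss_measure. 0 \<le> u z - ((mv u - C) + - ln (1 + norm z))"
      by (rule AE_nonneg_if_integrals_nonneg[OF _ le]) (intro Bochner_Integration.integrable_diff gauss_L2_integrable low u)
    ultimately show ?thesis by eventually_elim linarith
  qed
  then show ?thesis by blast
qed

text \<open>On a ball of measure larger than one half, \<open>u\<close> differs from its mean by at most a constant \<open>B\<close> which
  depends only on \<open>C\<close> and the dimension. Hence \<open>u > t\<close> on more than half of the space for every
  \<open>t < mv u - B\<close>, and \<open>u > mv u + B\<close> on less than half of it.\<close>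

lemma med_mv_distance:
  "\<exists>B. \<forall>u. u \<in> borel_measurable borel \<longrightarrow>
    (AE z::'a::euclidean_space in gauss_measure. \<bar>u z - mv u\<bar> \<le> C + ln (1 + norm z)) \<longrightarrow> \<bar>med u - mv u\<bar> \<le> B"
proof -
  let ?m = "measure (gauss_measure :: 'a measure)"
  have "(\<lambda>n. ?m (cball 0 (real n))) \<longlonglongrightarrow> ?m (\<Union>n. cball 0 (real n))"
    by (rule gauss.finite_Lim_measure_incseq) (auto intro!: incseq_SucI)
  moreover have "(\<Union>n. cball 0 (real n)) = (UNIV :: 'a set)"
    using real_arch_simple by (auto simp: mem_cball)
  ultimately have "(\<lambda>n. ?m (cball 0 (real n))) \<longlonglongrightarrow> 1"
    using gauss.prob_space[where 'a='a] by simp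
  then have "eventually (\<lambda>n. ?m (cball 0 (real n)) > 1 / 2) sequentially"
    by (rule order_tendstoD) simp
  then obtain n where n: "?m (cball 0 (real n)) > 1 / 2"
    by (auto simp: eventually_sequentially)
  define B where "B = C + ln (1 + real n)"
  have "\<bar>med u - mv u\<bar> \<le> B"
    if um[measurable]: "u \<in> borel_measurable borel"
      and ae: "AE z in gauss_measure. \<bar>u z - mv u\<bar> \<le> C + ln (1 + norm z)" for u :: "'a \<Rightarrow> real"
  proof -
    have sets: "{x. u x > t} \<in> sets gauss_measure" for t by measurable
    have ball: "AE z in gauss_measure. z \<in> cball 0 (real n) \<longrightarrow> \<bar>u z - mv u\<bar> \<le> B"
      using ae
    proof eventually_elim
      case (elim z)
      have "ln (1 + norm z) \<le> ln (1 + real n)" if "z \<in> cball 0 (real n)"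
        using that by (subst ln_le_cancel_iff) (auto simp: add_pos_nonneg)
      with elim show ?case by (auto simp: B_def)
    qed
    let ?S = "{t. ?m {x. u x > t} \<le> 1 / 2}"
    have lower: "mv u - B \<le> t" if t: "t \<in> ?S" for t
    proof (rule ccontr)
      assume "\<not> mv u - B \<le> t"
      then have "AE z in gauss_measure. z \<in> cball 0 (real n) \<longrightarrow> z \<in> {x. u x > t}"
        using ball by (auto elim!: eventually_mono)
      then have "?m (cball 0 (real n)) \<le> ?m {x. u x > t}"
        by (rule gauss.finite_measure_mono_AE[OF _ sets])
      with n t show False by simp
    qed
    have mem: "mv u + B \<in> ?S"
    proof -
      have "AE z in gauss_measure. z \<in> {x. u x > mv u + B} \<longrightarrow> z \<in> - cball 0 (real n)"
        using ball by (auto elim!: eventually_mono)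
      then have "?m {x. u x > mv u + B} \<le> ?m (- cball 0 (real n))"
        by (rule gauss.finite_measure_mono_AE) simp
      also have "\<dots> = 1 - ?m (cball 0 (real n))"
        using gauss.prob_compl[of "cball 0 (real n) :: 'a set"] by (simp add: Compl_eq_Diff_UNIV)
      finally show ?thesis using n by simp
    qed
    have "mv u - B \<le> Inf ?S" by (rule cInf_greatest) (use mem lower in blast)+
    moreover have "Inf ?S \<le> mv u + B" by (rule cInf_lower[OF mem]) (use lower in \<open>auto simp: bdd_below_def\<close>)
    ultimately show ?thesis unfolding med_def by linarith
  qed
  then show ?thesis by blast
qed

text \<open>The normalisation \<open>m u = 0\<close> bounds the mean of \<open>u\<close>: trivially if \<open>m\<close> is the mean, and by comparing mean
  and median otherwise.\<close>

lemma admissible_log_growth: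
  assumes m: "m = mv \<or> m = med"
  shows "\<exists>A. \<forall>u\<in>admissible m. AE z::'a::euclidean_space in gauss_measure. \<bar>u z\<bar> \<le> A + ln (1 + norm z)"
proof -
  obtain C where C: "\<And>(u::'a \<Rightarrow> real) f. has_ornstein_uhlenbeck u f \<Longrightarrow> (AE x in gauss_measure. \<bar>f x\<bar> \<le> 1) \<Longrightarrow>
    (AE z in gauss_measure. \<bar>u z - mv u\<bar> \<le> C + ln (1 + norm z))"
    using OU_log_growth by blast
  obtain B where B: "\<And>u. u \<in> borel_measurable borel \<Longrightarrow>
    (AE z::'a in gauss_measure. \<bar>u z - mv u\<bar> \<le> C + ln (1 + norm z)) \<Longrightarrow> \<bar>med u - mv u\<bar> \<le> B"
    using med_mv_distance[of C] by blast
  have "AE z in gauss_measure. \<bar>u z\<bar> \<le> (C + max 0 B) + ln (1 + norm z)" if u: "u \<in> admissible m" for u :: "'a \<Rightarrow> real"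
  proof -
    obtain f where ou: "has_ornstein_uhlenbeck u f" and f: "gauss_Linf_norm f \<le> 1" and mu: "m u = 0"
      using u by (auto simp: admissible_def)
    have um: "u \<in> borel_measurable borel"
      using ou by (auto simp: has_ornstein_uhlenbeck_def has_gauss_W12_gradient_def gauss_L2_measurable)
    have "AE x in gauss_measure. \<bar>f x\<bar> \<le> 1"
      using esssup_AE[of "\<lambda>x. ereal \<bar>f x\<bar>" gauss_measure]
    proof eventually_elim
      case (elim x)
      then have "ereal \<bar>f x\<bar> \<le> 1" using f unfolding gauss_Linf_norm_def by (rule order_trans)
      then show ?case by simp
    qed
    note ae = C[OF ou this]
    have "\<bar>mv u\<bar> \<le> max 0 B"
      using m mu B[OF um ae] by auto
    then show ?thesis using ae by (auto elim!: eventually_mono)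
  qed
  then show ?thesis by blast
qed

section \<open>Integrability of the double exponential\<close>

text \<open>Either \<open>(1 + t) powr (2 - \<eta>)\<close> is so large that \<open>K (1 + t) powr \<eta>\<close> is at most \<open>(1 + t)\<^sup>2 / 8\<close>, or
  \<open>1 + t\<close> is bounded by a constant.\<close>

lemma powr_le_quadratic:
  fixes K \<eta> :: real
  assumes K: "K > 0" and \<eta>: "0 < \<eta>" "\<eta> < 2"
  shows "\<exists>D. \<forall>t\<ge>0. K * (1 + t) powr \<eta> \<le> D + t\<^sup>2 / 4"
proof -
  \<comment> \<open>The condition \<open>(1 + t) powr (2 - \<eta>) \<le> 8 K\<close> amounts to \<open>1 + t \<le> V\<close>.\<close>
  define V where "V = (8 * K) powr (1 / (2 - \<eta>))"
  have "K * (1 + t) powr \<eta> \<le> (K * V powr \<eta> + 1/4) + t\<^sup>2 / 4" if t: "t \<ge> 0" for t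
  proof (cases "(1 + t) powr (2 - \<eta>) \<le> 8 * K")
    case True
    have "1 + t = ((1 + t) powr (2 - \<eta>)) powr (1 / (2 - \<eta>))"
      using t \<eta> by (simp add: powr_powr)
    also have "\<dots> \<le> V" unfolding V_def using True \<eta> by (intro powr_mono2) auto
    finally have "K * (1 + t) powr \<eta> \<le> K * V powr \<eta>"
      using t K \<eta> by (intro mult_left_mono powr_mono2) auto
    then show ?thesis using zero_le_power2[of t] by linarith
  next
    case False
    have "8 * (K * (1 + t) powr \<eta>) \<le> (1 + t) powr (2 - \<eta>) * (1 + t) powr \<eta>"
      using False by (simp add: mult_right_mono flip: mult.assoc)
    also have "\<dots> = (1 + t)\<^sup>2" using t by (simp add: powr_add[symmetric])
    also have "\<dots> \<le> 2 + 2 * t\<^sup>2"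
      using zero_le_power2[of "1 - t"] by (simp add: power2_eq_square algebra_simps)
    finally have "K * (1 + t) powr \<eta> \<le> 1/4 + t\<^sup>2 / 4" by simp
    moreover have "0 \<le> K * V powr \<eta>" using K by simp
    ultimately show ?thesis by linarith
  qed
  then show ?thesis by blast
qed

text \<open>By the logarithmic growth, \<open>exp (\<eta> \<bar>u\<bar>)\<close> is at most a multiple of \<open>(1 + \<bar>x\<bar>) powr \<eta>\<close>, which for
  \<open>\<eta> < 2\<close> stays below \<open>\<bar>x\<bar>\<^sup>2 / 4\<close> up to a constant; the exponential of the latter is integrable.\<close>

lemma exp_exp_integral_uniform_bound:
  assumes m: "m = mv \<or> m = med" and \<eta>: "0 < \<eta>" "\<eta> < 2"
  shows "(SUP u\<in>(admissible m :: ('a::euclidean_space \<Rightarrow> real) set). exp_exp_integral \<eta> u) < \<infinity>"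
proof -
  obtain A where A: "\<And>u. u \<in> admissible m \<Longrightarrow> AE z::'a in gauss_measure. \<bar>u z\<bar> \<le> A + ln (1 + norm z)"
    using admissible_log_growth[OF m] by blast
  obtain D where D: "\<And>t. t \<ge> 0 \<Longrightarrow> exp (\<eta> * A) * (1 + t) powr \<eta> \<le> D + t\<^sup>2 / 4"
    using powr_le_quadratic[of "exp (\<eta> * A)" \<eta>] \<eta> by auto
  have int: "integrable gauss_measure (\<lambda>x::'a. exp D * exp (1/4 * (norm x)\<^sup>2))"
    by (intro integrable_mult_right integrable_gauss_exp_norm_sq) simp
  have "exp_exp_integral \<eta> u \<le> ennreal (\<integral>x. exp D * exp (1/4 * (norm (x::'a))\<^sup>2) \<partial>gauss_measure)"
    if u: "u \<in> admissible m" for u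
  proof -
    have "exp_exp_integral \<eta> u \<le> (\<integral>\<^sup>+x. ennreal (exp D * exp (1/4 * (norm (x::'a))\<^sup>2)) \<partial>gauss_measure)"
      unfolding exp_exp_integral_def
    proof (rule nn_integral_mono_AE)
      show "AE x in gauss_measure. ennreal (exp (exp (\<eta> * \<bar>u x\<bar>))) \<le> ennreal (exp D * exp (1/4 * (norm x)\<^sup>2))"
        using A[OF u]
      proof eventually_elim
        case (elim x)
        have "exp (\<eta> * \<bar>u x\<bar>) \<le> exp (\<eta> * (A + ln (1 + norm x)))"
          using elim \<eta> by simp
        also have "\<dots> = exp (\<eta> * A) * (1 + norm x) powr \<eta>"
          by (simp add: powr_def distrib_left exp_add add_nonneg_eq_0_iff)
        also have "\<dots> \<le> D + (norm x)\<^sup>2 / 4" by (rule D) simp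
        finally show ?case
          by (intro ennreal_leI) (simp add: mult_exp_exp)
      qed
    qed
    also have "\<dots> = ennreal (\<integral>x. exp D * exp (1/4 * (norm (x::'a))\<^sup>2) \<partial>gauss_measure)"
      by (rule nn_integral_eq_integral[OF int]) auto
    finally show ?thesis .
  qed
  then have "(SUP u\<in>(admissible m :: ('a \<Rightarrow> real) set). exp_exp_integral \<eta> u)
      \<le> ennreal (\<integral>x. exp D * exp (1/4 * (norm (x::'a))\<^sup>2) \<partial>gauss_measure)"
    by (rule SUP_least)
  also have "\<dots> < \<infinity>" by simp
  finally show ?thesis .
qed

theorem theorem1p4:
  fixes m :: "(real ^ 'n \<Rightarrow> real) \<Rightarrow> real" and \<eta> :: real
  assumes "m = mv \<or> m = med" and "\<eta> > 0"
  shows "(\<eta> < 2 \<longrightarrow> (SUP u\<in>admissible m. exp_exp_integral \<eta> u) < \<infinity>) \<and>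
         (\<eta> \<ge> 2 \<longrightarrow>
            \<not> (SUP u\<in>admissible m. exp_exp_integral \<eta> u) < \<infinity> \<and>
            (\<exists>u\<in>admissible m. exp_exp_integral \<eta> u = \<infinity>))"
proof (intro conjI impI)
  show "(SUP u\<in>admissible m. exp_exp_integral \<eta> u) < \<infinity>" if "\<eta> < 2"
    by (rule exp_exp_integral_uniform_bound[OF assms that])
  obtain b where b: "b \<in> (Basis :: (real ^ 'n) set)" using nonempty_Basis by blast
  note adm = witness_admissible[OF b assms(1)]
  show "\<exists>u\<in>admissible m. exp_exp_integral \<eta> u = \<infinity>" if "\<eta> \<ge> 2"
    using adm witness_exp_exp_integral[OF b that] by blast
  then show "\<not> (SUP u\<in>admissible m. exp_exp_integral \<eta> u) < \<infinity>" if "\<eta> \<ge> 2"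
    using that by (metis SUP_upper infinity_ennreal_def not_less)
qed

end
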